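(* Let $G$ be an infinite discrete countable abelian group and let $(X,G)$ be a minimal $G$-system. Let $(H,G)$ be the maximal equicontinuous factor of $(X,G)$, $\pi:X\to H$ the factor map, and $\nu$ the Haar measure on $H$. Then there exists $K\in\mathbb{N}\cup\{\infty\}$ with $\log K\le h_{top}^*(X,G)$ (where $\log\infty=\infty$) such that $$\nu(\{y\in H:|\pi^{-1}(y)|=K\})=1.$$
   Context: A $G$-system $(X,G)$ is a compact metric space $(X,d)$ on which $G$ acts by homeomorphisms; it is minimal if every orbit is dense. A factor map between $G$-systems is a continuous surjection intertwining the actions. $(X,G)$ is equicontinuous if for every $\epsilon>0$ there is $\delta>0$ with $d(x,y)<\delta\Rightarrow d(gx,gy)<\epsilon$ for all $g\in G$. The maximal equicontinuous factor $(H,G)$ of $(X,G)$ is the quotient $X/S_{eq}$, where $S_{eq}$ is the smallest closed $G$-invariant equivalence relation on $X$ whose quotient system is equicontinuous; $\pi$ is the quotient map. Since $(H,G)$ is minimal and equicontinuous it has a unique $G$-invariant Borel probability measure $\nu$, called the Haar measure. Topological sequence entropy: for a sequence $\mathcal{A}=(g_n)_{n\ge1}$ in $G$ and a finite open cover $\mathcal{U}$ of $X$, $h_{top}^{\mathcal{A}}(G,\mathcal{U})=\limsup_{n\to\infty}\frac1n\log N(\bigvee_{i=1}^n g_i^{-1}\mathcal{U})$, where $N(\cdot)$ is the minimal cardinality of a subcover; $h_{top}^{\mathcal{A}}(X,G)=\sup_{\mathcal{U}}h_{top}^{\mathcal{A}}(G,\mathcal{U})$ over finite open covers, and $h_{top}^*(X,G)=\sup_{\mathcal{A}}h_{top}^{\mathcal{A}}(X,G)$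 over all sequences $\mathcal{A}$ in $G$. *)

theory Defs
  imports "HOL-Analysis.Analysis" "HOL-Probability.Probability"
begin

definition G_system :: "'x::metric_space set \<Rightarrow> ('g::ab_group_add \<Rightarrow> 'x \<Rightarrow> 'x) \<Rightarrow> bool" where
  "G_system X act \<longleftrightarrow> compact X \<and>
     (\<forall>x\<in>X. act 0 x = x) \<and>
     (\<forall>g h. \<forall>x\<in>X. act (g + h) x = act g (act h x)) \<and>
     (\<forall>g. act g ` X \<subseteq> X \<and> continuous_on X (act g))"

definition minimal_system :: "'x::metric_space set \<Rightarrow> ('g \<Rightarrow> 'x \<Rightarrow> 'x) \<Rightarrow> bool" where
  "minimal_system X act \<longleftrightarrow> (\<forall>x\<in>X. closure (range (\<lambda>g. act g x)) = X)"

definition factor_map ::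
  "'x::metric_space set \<Rightarrow> ('g \<Rightarrow> 'x \<Rightarrow> 'x) \<Rightarrow> 'h::metric_space set \<Rightarrow> ('g \<Rightarrow> 'h \<Rightarrow> 'h) \<Rightarrow> ('x \<Rightarrow> 'h) \<Rightarrow> bool" where
  "factor_map X act Y actY p \<longleftrightarrow> continuous_on X p \<and> p ` X = Y \<and>
     (\<forall>g. \<forall>x\<in>X. p (act g x) = actY g (p x))"

definition equicontinuous_system :: "'x::metric_space set \<Rightarrow> ('g \<Rightarrow> 'x \<Rightarrow> 'x) \<Rightarrow> bool" where
  "equicontinuous_system X act \<longleftrightarrow>
     (\<forall>\<epsilon>>0. \<exists>\<delta>>0. \<forall>x\<in>X. \<forall>y\<in>X. dist x y < \<delta> \<longrightarrow> (\<forall>g. dist (act g x) (act g y) < \<epsilon>))"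

definition closed_inv_equiv :: "'x::metric_space set \<Rightarrow> ('g \<Rightarrow> 'x \<Rightarrow> 'x) \<Rightarrow> ('x \<times> 'x) set \<Rightarrow> bool" where
  "closed_inv_equiv X act R \<longleftrightarrow> equiv X R \<and> closed R \<and>
     (\<forall>g x y. (x, y) \<in> R \<longrightarrow> (act g x, act g y) \<in> R)"

text \<open>The quotient system X/R (carrier X//R with the quotient topology, action
  g.[x] = [g x]) is equicontinuous: it is a (compact) metric space for some metric d
  inducing the quotient topology, and the induced action is equicontinuous for d.\<close>
definition quotient_equicontinuous :: "'x::metric_space set \<Rightarrow> ('g \<Rightarrow> 'x \<Rightarrow> 'x) \<Rightarrow> ('x \<times> 'x) set \<Rightarrow> bool" where
  "quotient_equicontinuous X act R \<longleftrightarrow>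
     (\<exists>d. Metric_space (X // R) d \<and>
          (\<forall>U. openin (Metric_space.mtopology (X // R) d) U \<longleftrightarrow>
                 U \<subseteq> X // R \<and> openin (top_of_set X) (\<Union>U)) \<and>
          (\<forall>\<epsilon>>0. \<exists>\<delta>>0. \<forall>x\<in>X. \<forall>y\<in>X. d (R `` {x}) (R `` {y}) < \<delta> \<longrightarrow>
                 (\<forall>g. d (R `` {act g x}) (R `` {act g y}) < \<epsilon>)))"

definition S_eq :: "'x::metric_space set \<Rightarrow> ('g \<Rightarrow> 'x \<Rightarrow> 'x) \<Rightarrow> ('x \<times> 'x) set" where
  "S_eq X act = \<Inter> {R. closed_inv_equiv X act R \<and> quotient_equicontinuous X act R}"

text \<open>(H, actH) with factor map p is the maximal equicontinuous factor: it is an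
  equicontinuous factor whose fibre relation is exactly S_eq (so H is conjugate to X/S_eq).\<close>
definition max_equicontinuous_factor ::
  "'x::metric_space set \<Rightarrow> ('g::ab_group_add \<Rightarrow> 'x \<Rightarrow> 'x) \<Rightarrow> 'h::metric_space set \<Rightarrow> ('g \<Rightarrow> 'h \<Rightarrow> 'h) \<Rightarrow> ('x \<Rightarrow> 'h) \<Rightarrow> bool" where
  "max_equicontinuous_factor X act H actH p \<longleftrightarrow>
     G_system H actH \<and> factor_map X act H actH p \<and> equicontinuous_system H actH \<and>
     {(x, y). x \<in> X \<and> y \<in> X \<and> p x = p y} = S_eq X act"

text \<open>A G-invariant Borel probability measure on H (for minimal equicontinuous H it is
  unique: the Haar measure).\<close>
definition invariant_borel_prob :: "'h::metric_space set \<Rightarrow> ('g \<Rightarrow> 'h \<Rightarrow> 'h) \<Rightarrow> 'h measure \<Rightarrow> bool" where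
  "invariant_borel_prob H actH \<nu> \<longleftrightarrow> prob_space \<nu> \<and> sets \<nu> = sets (restrict_space borel H) \<and>
     space \<nu> = H \<and>
     (\<forall>g. \<forall>A\<in>sets \<nu>. emeasure \<nu> (actH g -` A \<inter> H) = emeasure \<nu> A)"

definition open_covers :: "'x::metric_space set \<Rightarrow> 'x set set set" where
  "open_covers X = {U. finite U \<and> (\<forall>u\<in>U. openin (top_of_set X) u) \<and> X \<subseteq> \<Union>U}"

definition Ncov :: "'x set \<Rightarrow> 'x set set \<Rightarrow> nat" where
  "Ncov X V = (LEAST k. \<exists>W\<subseteq>V. finite W \<and> X \<subseteq> \<Union>W \<and> card W = k)"

definition join_cover :: "'x set \<Rightarrow> ('g \<Rightarrow> 'x \<Rightarrow> 'x) \<Rightarrow> (nat \<Rightarrow> 'g) \<Rightarrow> 'x set set \<Rightarrow> nat \<Rightarrow> 'x set set" where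
  "join_cover X act A U n =
     {X \<inter> (\<Inter>i\<in>{1..n}. act (A i) -` f i) | f. \<forall>i\<in>{1..n}. f i \<in> U}"

definition seq_entropy_cover :: "'x set \<Rightarrow> ('g \<Rightarrow> 'x \<Rightarrow> 'x) \<Rightarrow> (nat \<Rightarrow> 'g) \<Rightarrow> 'x set set \<Rightarrow> ereal" where
  "seq_entropy_cover X act A U =
     limsup (\<lambda>n. ereal (ln (real (Ncov X (join_cover X act A U n))) / real n))"

definition seq_entropy :: "'x::metric_space set \<Rightarrow> ('g \<Rightarrow> 'x \<Rightarrow> 'x) \<Rightarrow> (nat \<Rightarrow> 'g) \<Rightarrow> ereal" where
  "seq_entropy X act A = (SUP U\<in>open_covers X. seq_entropy_cover X act A U)"

text \<open>h^*_top(X,G): supremum over all sequences (g_n)_{n>=1} (index 0 unused).\<close>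
definition sup_seq_entropy :: "'x::metric_space set \<Rightarrow> ('g \<Rightarrow> 'x \<Rightarrow> 'x) \<Rightarrow> ereal" where
  "sup_seq_entropy X act = (SUP A. seq_entropy X act A)"

definition ecard :: "'a set \<Rightarrow> enat" where
  "ecard S = (if finite S then enat (card S) else \<infinity>)"

definition elog :: "enat \<Rightarrow> ereal" where
  "elog K = (case K of enat k \<Rightarrow> ereal (ln (real k)) | \<infinity> \<Rightarrow> \<infinity>)"

end

theory Submission
  imports Defs
begin

text \<open>A product of copies of X carries a finitely additive mean that is invariant under coordinatewise
  translations and charges all open sets; made outer regular it becomes a submodular content.
  For a closed set W invariant under the diagonal action, comparing the contents of the
  sections of W over two points gives a continuous invariant pseudometric, which must vanish on
  pairs in \<open>S_eq\<close>. Hence the closure of the diagonal orbit of a product of open sets contains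
  the product of their saturations under the factor map, and one group element can move
  finitely many open sets into prescribed open sets over the same base points.

  If almost every fibre has at least k points, some k disjoint balls in X have images in H with an
  intersection C of positive Haar measure. Perturbing translations of H slightly, all patterns
  of k symbols over L positions are realised in the base by points of the interiors of these images,
  and the previous paragraph lifts them to X. So the k balls have independence sets of
  every length, and the sequence entropy is at least \<open>ln k\<close>. Ergodicity of the Haar measure makes
  the cardinality of the fibres almost surely constant.\<close>

section \<open>Invariant pseudometrics\<close>

text \<open>The difficulty is simultaneity. Minimality moves one point of X into an open set, but
  independence of length L asks that the same L group elements realise all k^L patterns, so a single
  element has to hit k^L open sets. The diagonal orbit of a box is in general not dense in the
  product, since the equicontinuous factor is an obstruction; the aim is to see that it is the only
  one. As \<open>S_eq\<close> is given only as the smallest relation with an equicontinuous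
  quotient, it is exploited by producing invariant continuous pseudometrics, and measuring the
  sections of a closed invariant set is a source of them. The mean is finitely additive on all
  subsets because it then comes from averaging and the compactness of a cube; its lack of continuity
  is what the outer regularisation repairs. Commutativity of G enters in the averaging and in the
  fact that an element moving one point of H slightly moves all points of H slightly.\<close>

lemma S_eq_pseudometric_eq_0:
  fixes d :: "'x::metric_space \<Rightarrow> 'x \<Rightarrow> real" and act :: "'g::ab_group_add \<Rightarrow> 'x \<Rightarrow> 'x"
  assumes sys: "G_system X act"
    and d0: "\<And>x. x \<in> X \<Longrightarrow> d x x = 0"
    and sym: "\<And>x y. x \<in> X \<Longrightarrow> y \<in> X \<Longrightarrow> d x y = d y x"
    and tri: "\<And>x y z. x \<in> X \<Longrightarrow> y \<in> X \<Longrightarrow> z \<in> X \<Longrightarrow> d x z \<le> d x y + d y z"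
    and cont: "\<And>x e. x \<in> X \<Longrightarrow> e > 0 \<Longrightarrow> \<exists>\<delta>>0. \<forall>y\<in>X. dist x y < \<delta> \<longrightarrow> d x y < e"
    and inv: "\<And>g x y. x \<in> X \<Longrightarrow> y \<in> X \<Longrightarrow> d (act g x) (act g y) = d x y"
    and uv: "(u, v) \<in> S_eq X act"
  shows "d u v = 0"
proof -
  \<comment> \<open>The zero relation of \<open>d\<close> is one of the relations intersected in
    \<open>S_eq\<close>: \<open>d\<close> descends to a metric for the quotient topology, and since
    \<open>act\<close> preserves it, equicontinuity holds with \<delta> equal to \<epsilon>.\<close>
  define R where "R = {(x, y). x \<in> X \<and> y \<in> X \<and> d x y = 0}"
  have cX: "compact X" and actX: "\<And>g x. x \<in> X \<Longrightarrow> act g x \<in> X"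
    using sys unfolding G_system_def by blast+
  have nn: "0 \<le> d x y" if "x \<in> X" "y \<in> X" for x y
    using tri[of x y x] sym[of x y] d0[of x] that by simp
  \<comment> \<open>Only continuity along the diagonal is assumed. This four-point estimate turns it
    into joint continuity and shows that \<open>d\<close> does not depend on the representatives of
    classes.\<close>
  have lip: "\<bar>d x y - d x' y'\<bar> \<le> d x x' + d y y'" if "x \<in> X" "y \<in> X" "x' \<in> X" "y' \<in> X" for x y x' y'
    using tri[of x x' y] tri[of x' y' y] tri[of x' x y'] tri[of x y y'] sym[of x x'] sym[of y y'] that
    by simp
  have lim: "(\<lambda>n. d x (s n)) \<longlonglongrightarrow> 0" if s: "\<And>n. s n \<in> X" "s \<longlonglongrightarrow> x" and x: "x \<in> X" for s x
  proof (rule LIMSEQ_I)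
    fix r :: real assume "r > 0"
    then obtain \<delta> where \<delta>: "\<delta> > 0" "\<forall>y\<in>X. dist x y < \<delta> \<longrightarrow> d x y < r" using cont[OF x] by blast
    obtain N where "\<forall>n\<ge>N. dist (s n) x < \<delta>" using s(2) \<delta>(1) unfolding lim_sequentially by blast
    then show "\<exists>N. \<forall>n\<ge>N. norm (d x (s n) - 0) < r"
      using \<delta>(2) s(1) nn[OF x] by (intro exI[of _ N]) (auto simp: dist_commute)
  qed
  have "closed R" unfolding closed_sequential_limits
  proof (intro allI impI)
    fix s l assume "(\<forall>n. s n \<in> R) \<and> s \<longlonglongrightarrow> l"
    then have sR: "\<And>n. s n \<in> R" and sl: "s \<longlonglongrightarrow> l" by auto
    have sX: "\<And>n. fst (s n) \<in> X" "\<And>n. snd (s n) \<in> X" "\<And>n. d (fst (s n)) (snd (s n)) = 0"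
      using sR by (auto simp: R_def case_prod_beta)
    have clX: "closed X" using cX compact_imp_closed by blast
    have l1: "fst l \<in> X" by (rule closed_sequentially[OF clX _ tendsto_fst[OF sl]]) (rule sX)
    have l2: "snd l \<in> X" by (rule closed_sequentially[OF clX _ tendsto_snd[OF sl]]) (rule sX)
    note l = l1 l2
    have "(\<lambda>n. d (fst l) (fst (s n)) + d (snd l) (snd (s n))) \<longlonglongrightarrow> 0 + 0"
      by (intro tendsto_add lim sX l tendsto_fst[OF sl] tendsto_snd[OF sl])
    moreover have "\<bar>d (fst l) (snd l)\<bar> \<le> d (fst l) (fst (s n)) + d (snd l) (snd (s n))" for n
      using lip[of "fst l" "snd l" "fst (s n)" "snd (s n)"] sX l by simp
    ultimately have "\<bar>d (fst l) (snd l)\<bar> \<le> 0"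
      using LIMSEQ_le_const[of _ "0 + 0" "\<bar>d (fst l) (snd l)\<bar>"] by auto
    then show "l \<in> R" using l by (auto simp: R_def case_prod_beta)
  qed
  have eqv: "equiv X R"
  proof (rule equivI)
    show "R \<subseteq> X \<times> X" by (auto simp: R_def)
    show "refl_on X R" by (auto simp: R_def refl_on_def d0)
    show "Relation.sym R" by (auto simp: R_def sym_def sym)
    show "trans R"
    proof (rule transI)
      fix x y z assume "(x, y) \<in> R" "(y, z) \<in> R"
      then show "(x, z) \<in> R" using tri[of x y z] nn[of x z] by (auto simp: R_def)
    qed
  qed
  define r where "r A = (SOME x. x \<in> A)" for A :: "'x set"
  \<comment> \<open>\<open>Metric_space\<close> demands nonnegativity and symmetry for all
    arguments, hence the value 0 off \<open>X // R\<close>.\<close>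
  define dq where "dq A B = (if A \<in> X // R \<and> B \<in> X // R then d (r A) (r B) else 0)" for A B
  have rep: "r (R `` {x}) \<in> X \<and> d x (r (R `` {x})) = 0" if "x \<in> X" for x
  proof -
    have "x \<in> R `` {x}" using that d0 by (auto simp: R_def)
    then have "r (R `` {x}) \<in> R `` {x}" unfolding r_def by (rule someI)
    then show ?thesis by (auto simp: R_def)
  qed
  have Reps: "A \<in> X // R \<longleftrightarrow> (\<exists>x\<in>X. A = R `` {x})" for A by (auto simp: quotient_def)
  have dq: "dq (R `` {x}) (R `` {y}) = d x y" if "x \<in> X" "y \<in> X" for x y
  proof -
    have "R `` {x} \<in> X // R" "R `` {y} \<in> X // R" using that by (auto simp: Reps)
    then show ?thesis
      using lip[of x y "r (R `` {x})" "r (R `` {y})"] rep[OF that(1)] rep[OF that(2)] that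
      by (simp add: dq_def)
  qed
  have Req: "R `` {x} = R `` {y} \<longleftrightarrow> d x y = 0" if "x \<in> X" "y \<in> X" for x y
    using eq_equiv_class_iff[OF eqv that] that by (auto simp: R_def)
  interpret M: Metric_space "X // R" dq
  proof
    show "0 \<le> dq A B" for A B
      using nn rep by (auto simp: dq_def Reps)
  next
    show "dq A B = dq B A" for A B
      using sym rep by (auto simp: dq_def Reps)
  next
    fix A B assume "A \<in> X // R" "B \<in> X // R"
    then obtain x y where "x \<in> X" "A = R `` {x}" "y \<in> X" "B = R `` {y}" by (metis Reps)
    then show "(dq A B = 0) = (A = B)" using dq Req by simp
  next
    fix A B C assume "A \<in> X // R" "B \<in> X // R" "C \<in> X // R"
    then show "dq A C \<le> dq A B + dq B C" by (auto simp: Reps dq tri)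
  qed
  have UX_sub: "\<Union>U \<subseteq> X" if "U \<subseteq> X // R" for U
    using Union_mono[OF that] Union_quotient[OF eqv] by simp
  have UN: "x \<in> \<Union>U \<longleftrightarrow> R `` {x} \<in> U" if "U \<subseteq> X // R" "x \<in> X" for U x
  proof
    assume "x \<in> \<Union>U"
    then obtain A where A: "A \<in> U" "x \<in> A" by blast
    then have "A \<in> X // R" using that(1) by blast
    then obtain z where "z \<in> X" "R `` {z} \<in> U" "x \<in> R `` {z}" using A unfolding Reps by blast
    then show "R `` {x} \<in> U" using Req[of z x] by (auto simp: R_def)
  next
    assume "R `` {x} \<in> U"
    moreover have "x \<in> R `` {x}" using that d0 by (auto simp: R_def)
    ultimately show "x \<in> \<Union>U" by blast
  qed
  have top: "openin M.mtopology U \<longleftrightarrow> U \<subseteq> X // R \<and> openin (top_of_set X) (\<Union>U)" for U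
  proof (intro iffI conjI)
    assume U: "openin M.mtopology U"
    then show UX: "U \<subseteq> X // R" by (auto simp: M.openin_mtopology)
    show "openin (top_of_set X) (\<Union>U)" unfolding openin_euclidean_subtopology_iff
    proof (intro conjI ballI)
      show "\<Union>U \<subseteq> X" using UX_sub UX by blast
      fix x assume x: "x \<in> \<Union>U"
      then have xX: "x \<in> X" using UX_sub UX by blast
      then have "R `` {x} \<in> U" using UN UX x by blast
      then obtain e where e: "e > 0" "M.mball (R `` {x}) e \<subseteq> U" using U by (auto simp: M.openin_mtopology)
      obtain \<delta> where \<delta>: "\<delta> > 0" "\<forall>y\<in>X. dist x y < \<delta> \<longrightarrow> d x y < e" using cont[OF xX e(1)] by blast
      have "x' \<in> \<Union>U" if "x' \<in> X" "dist x' x < \<delta>" for x'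
      proof -
        have "d x x' < e" using \<delta> that by (auto simp: dist_commute)
        then have "R `` {x'} \<in> M.mball (R `` {x}) e" using that xX by (auto simp: dq Reps)
        then show ?thesis using e(2) UN[OF UX that(1)] by blast
      qed
      then show "\<exists>e>0. \<forall>x'\<in>X. dist x' x < e \<longrightarrow> x' \<in> \<Union>U" using \<delta>(1) by blast
    qed
  next
    assume U: "U \<subseteq> X // R \<and> openin (top_of_set X) (\<Union>U)"
    show "openin M.mtopology U" unfolding M.openin_mtopology
    proof (intro conjI allI impI)
      show "U \<subseteq> X // R" using U by blast
      fix A assume A: "A \<in> U"
      then have "A \<in> X // R" using U by blast
      then obtain x where x: "x \<in> X" "A = R `` {x}" unfolding Reps by blast
      show "\<exists>e>0. M.mball A e \<subseteq> U"
      \<comment> \<open>Compactness makes \<open>d\<close>-balls fit into saturated open sets: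
        otherwise points outside the saturated set accumulate at some \<open>w\<close> outside it
        with \<open>d x w = 0\<close>, so that \<open>w\<close> lies in the class
        \<open>A\<close>.\<close>
      proof (rule ccontr)
        assume "\<not> ?thesis"
        then have "\<not> M.mball A (1 / real (Suc n)) \<subseteq> U" for n by auto
        then have "\<exists>B. B \<in> M.mball A (1 / real (Suc n)) \<and> B \<notin> U" for n by blast
        then obtain B where B: "\<And>n. B n \<in> M.mball A (1 / real (Suc n)) \<and> B n \<notin> U" by metis
        then have "\<exists>z\<in>X. B n = R `` {z}" for n by (auto simp: Reps)
        then obtain z where z: "\<And>n. z n \<in> X" "\<And>n. B n = R `` {z n}" by metis
        have dz: "d x (z n) < 1 / real (Suc n)" for n using B[of n] z x dq by simp
        have "z n \<in> X - \<Union>U" for n using UN[of U "z n"] z B[of n] U by auto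
        moreover have "compact (X - \<Union>U)"
        proof -
          obtain T where "open T" "\<Union>U = X \<inter> T" using U by (auto simp: openin_open)
          then have "X - \<Union>U = X - T" by auto
          then show ?thesis using cX \<open>open T\<close> by (simp add: compact_diff)
        qed
        ultimately obtain w \<rho> where w: "w \<in> X - \<Union>U" "strict_mono \<rho>" "(z \<circ> \<rho>) \<longlonglongrightarrow> w"
          using compact_imp_seq_compact seq_compactE by metis
        have "(\<lambda>n. d w (z (\<rho> n)) + 1 / real (Suc (\<rho> n))) \<longlonglongrightarrow> 0 + 0"
        proof (intro tendsto_add)
          show "(\<lambda>n. d w (z (\<rho> n))) \<longlonglongrightarrow> 0" using lim[of "z \<circ> \<rho>" w] w z by (auto simp: o_def)
          show "(\<lambda>n. 1 / real (Suc (\<rho> n))) \<longlonglongrightarrow> 0"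
            using LIMSEQ_subseq_LIMSEQ[OF LIMSEQ_Suc[OF lim_1_over_n] w(2)] by (simp add: o_def)
        qed
        moreover have "d x w \<le> d w (z (\<rho> n)) + 1 / real (Suc (\<rho> n))" for n
          using tri[of x "z (\<rho> n)" w] dz[of "\<rho> n"] sym[of w "z (\<rho> n)"] z x w by simp
        ultimately have "d x w \<le> 0" using LIMSEQ_le_const[of _ "0 + 0" "d x w"] by auto
        then have "d x w = 0" using nn[of x w] x w by auto
        then have "w \<in> A" using x w by (auto simp: R_def)
        then show False using w A by blast
      qed
    qed
  qed
  have "closed_inv_equiv X act R"
    using eqv \<open>closed R\<close> inv actX by (auto simp: closed_inv_equiv_def R_def)
  moreover have "quotient_equicontinuous X act R"
    unfolding quotient_equicontinuous_def
  proof (intro exI[of _ dq] conjI)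
    show "Metric_space (X // R) dq" by (rule M.Metric_space_axioms)
    show "\<forall>U. openin M.mtopology U \<longleftrightarrow> U \<subseteq> X // R \<and> openin (top_of_set X) (\<Union>U)" by (intro allI top)
    show "\<forall>e>0. \<exists>\<delta>>0. \<forall>x\<in>X. \<forall>y\<in>X. dq (R `` {x}) (R `` {y}) < \<delta> \<longrightarrow>
        (\<forall>g. dq (R `` {act g x}) (R `` {act g y}) < e)"
    proof (intro allI impI)
      fix e :: real assume "e > 0"
      then show "\<exists>\<delta>>0. \<forall>x\<in>X. \<forall>y\<in>X. dq (R `` {x}) (R `` {y}) < \<delta> \<longrightarrow>
        (\<forall>g. dq (R `` {act g x}) (R `` {act g y}) < e)"
      proof (intro exI[of _ e] conjI ballI impI allI)
        fix x y g assume xy: "x \<in> X" "y \<in> X" "dq (R `` {x}) (R `` {y}) < e"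
        have "dq (R `` {act g x}) (R `` {act g y}) = dq (R `` {x}) (R `` {y})"
          using dq[OF actX[OF xy(1)] actX[OF xy(2)]] inv[OF xy(1,2)] dq[OF xy(1,2)] by simp
        then show "dq (R `` {act g x}) (R `` {act g y}) < e" using xy(3) by simp
      qed
    qed
  qed
  ultimately have "R \<in> {R. closed_inv_equiv X act R \<and> quotient_equicontinuous X act R}" by simp
  then have "(u, v) \<in> R" using uv unfolding S_eq_def by (rule InterD[rotated])
  then show ?thesis unfolding R_def by simp
qed

section \<open>Finitely additive invariant measures\<close>

text \<open>Tychonoff's theorem, carried over to the type class topology on functions.\<close>

lemma compact_PiE_fun:
  assumes "\<And>i. compact (K i)"
  shows "compact {f :: 'i \<Rightarrow> 'b::topological_space. \<forall>i. f i \<in> K i}"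
proof -
  have "compactin (product_topology (\<lambda>i. euclidean) UNIV) (PiE UNIV K)"
    using assms by (simp add: compactin_PiE)
  then show ?thesis by (simp add: euclidean_product_topology PiE_UNIV_domain Pi_def)
qed

text \<open>All subsets of the type are measured, so preimages raise no measurability question;
  \<open>m Y = 1\<close> says that the mean lives on \<open>Y\<close>.\<close>

definition fin_add_prob :: "'y set \<Rightarrow> ('y set \<Rightarrow> real) \<Rightarrow> bool" where
  "fin_add_prob Y m \<longleftrightarrow> (\<forall>A. 0 \<le> m A) \<and> m UNIV = 1 \<and> m Y = 1 \<and>
     (\<forall>A B. A \<inter> B = {} \<longrightarrow> m (A \<union> B) = m A + m B)"

lemma fin_add_probD:
  assumes "fin_add_prob Y m"
  shows fin_add_prob_nonneg: "0 \<le> m A" and fin_add_prob_UNIV: "m UNIV = 1" and fin_add_prob_carrier: "m Y = 1"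
    and fin_add_prob_disjoint: "A \<inter> B = {} \<Longrightarrow> m (A \<union> B) = m A + m B"
  using assms unfolding fin_add_prob_def by blast+

lemma fin_add_prob_mono: "fin_add_prob Y m \<Longrightarrow> A \<subseteq> B \<Longrightarrow> m A \<le> m B"
proof -
  assume m: "fin_add_prob Y m" and "A \<subseteq> B"
  then have "m (A \<union> (B - A)) = m A + m (B - A)" by (intro fin_add_prob_disjoint) auto
  moreover have "A \<union> (B - A) = B" using \<open>A \<subseteq> B\<close> by blast
  moreover have "0 \<le> m (B - A)" by (rule fin_add_prob_nonneg[OF m])
  ultimately show "m A \<le> m B" by simp
qed

lemma fin_add_prob_modular: "fin_add_prob Y m \<Longrightarrow> m (A \<union> B) + m (A \<inter> B) = m A + m B"
proof -
  assume m: "fin_add_prob Y m"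
  have "m (A \<union> (B - A)) = m A + m (B - A)" "m ((A \<inter> B) \<union> (B - A)) = m (A \<inter> B) + m (B - A)"
    by (rule fin_add_prob_disjoint[OF m], blast)+
  moreover have "A \<union> (B - A) = A \<union> B" "(A \<inter> B) \<union> (B - A) = B" by blast+
  ultimately show ?thesis by simp
qed

lemma fin_add_prob_Int: "fin_add_prob Y m \<Longrightarrow> m (A \<inter> Y) = m A"
  using fin_add_prob_modular[of Y m A Y] fin_add_prob_mono[of Y m Y "A \<union> Y"] fin_add_prob_mono[of Y m "A \<union> Y" UNIV]
    fin_add_prob_UNIV[of Y m] fin_add_prob_carrier[of Y m]
  by simp

lemma fin_add_prob_le_1: "fin_add_prob Y m \<Longrightarrow> m A \<le> 1"
  using fin_add_prob_mono[of Y m A UNIV] fin_add_prob_UNIV[of Y m] by simp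

text \<open>Each axiom relates finitely many values of \<open>m\<close>, hence is closed for
  pointwise convergence, and all values lie in the unit interval: the means form a closed subset of
  a cube.\<close>

lemma compact_fin_add_prob: "compact {m. fin_add_prob (Y :: 'y set) m}"
proof -

  have "closed (\<Inter>A. {m :: 'y set \<Rightarrow> real. 0 \<le> m A})"
    by (intro closed_INT ballI closed_Collect_le continuous_on_const continuous_on_product_coordinates)
  moreover have "closed {m :: 'y set \<Rightarrow> real. m A = 1}" for A
    by (intro closed_Collect_eq continuous_on_const continuous_on_product_coordinates)
  moreover have "closed (\<Inter>p\<in>{(A, B). A \<inter> B = {}}. {m :: 'y set \<Rightarrow> real. m (fst p \<union> snd p) = m (fst p) + m (snd p)})"
    by (intro closed_INT ballI closed_Collect_eq continuous_on_add continuous_on_product_coordinates)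
  ultimately have "closed ((\<Inter>A. {m :: 'y set \<Rightarrow> real. 0 \<le> m A}) \<inter> {m. m UNIV = 1} \<inter> {m. m Y = 1} \<inter>
      (\<Inter>p\<in>{(A, B). A \<inter> B = {}}. {m. m (fst p \<union> snd p) = m (fst p) + m (snd p)}))"
    by (intro closed_Int)
  also have "(\<Inter>A. {m :: 'y set \<Rightarrow> real. 0 \<le> m A}) \<inter> {m. m UNIV = 1} \<inter> {m. m Y = 1} \<inter>
      (\<Inter>p\<in>{(A, B). A \<inter> B = {}}. {m. m (fst p \<union> snd p) = m (fst p) + m (snd p)}) = {m. fin_add_prob Y m}"
    by (fastforce simp: fin_add_prob_def)
  finally have "closed {m :: 'y set \<Rightarrow> real. fin_add_prob Y m}" .
  moreover have "{m. fin_add_prob Y m} \<subseteq> {m. \<forall>A. m A \<in> {0..1}}"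
    using fin_add_prob_le_1 fin_add_prob_nonneg by auto
  moreover have "compact {m :: 'y set \<Rightarrow> real. \<forall>A. m A \<in> {0..1}}"
    by (rule compact_PiE_fun) simp
  ultimately show ?thesis using compact_Int_closed[of "{m. \<forall>A. m A \<in> {0..1}}" "{m. fin_add_prob Y m}"]
    by (simp add: Int_absorb1)
qed

lemma fin_add_prob_vimage:
  assumes "fin_add_prob Y m" "T ` Y \<subseteq> Y" shows "fin_add_prob Y (\<lambda>A. m (T -` A))"
proof -
  have "m (T -` Y) = 1"
    using fin_add_prob_mono[OF assms(1), of Y "T -` Y"] fin_add_prob_le_1[OF assms(1), of "T -` Y"]
      fin_add_prob_carrier[OF assms(1)] assms(2)
    by (simp add: image_subset_iff_subset_vimage)
  moreover have "m (T -` (A \<union> B)) = m (T -` A) + m (T -` B)" if "A \<inter> B = {}" for A B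
  proof -
    have "T -` A \<inter> T -` B = {}" using that by blast
    then show ?thesis unfolding vimage_Un by (rule fin_add_prob_disjoint[OF assms(1)])
  qed
  ultimately show ?thesis unfolding fin_add_prob_def
    by (simp add: fin_add_prob_nonneg[OF assms(1)] fin_add_prob_UNIV[OF assms(1)])
qed

lemma fin_add_prob_average:
  assumes "\<And>a. a < n \<Longrightarrow> fin_add_prob Y (M a)" "0 < n"
  shows "fin_add_prob Y (\<lambda>A. (\<Sum>a<n. M a A) / real n)"
proof -
  have "(\<Sum>a<n. M a UNIV) = (\<Sum>a<n. 1)" "(\<Sum>a<n. M a Y) = (\<Sum>a<n. 1)"
    by (intro sum.cong; simp add: fin_add_prob_UNIV[OF assms(1)] fin_add_prob_carrier[OF assms(1)])+
  moreover have "(\<Sum>a<n. M a (A \<union> B)) = (\<Sum>a<n. M a A) + (\<Sum>a<n. M a B)" if "A \<inter> B = {}" for A B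
    unfolding sum.distrib[symmetric] using that by (intro sum.cong) (simp_all add: fin_add_prob_disjoint[OF assms(1)])
  moreover have "0 \<le> (\<Sum>a<n. M a A)" for A
    by (intro sum_nonneg) (simp add: fin_add_prob_nonneg[OF assms(1)])
  ultimately show ?thesis unfolding fin_add_prob_def using assms(2) by (simp add: add_divide_distrib)
qed

text \<open>Markov-Kakutani averaging: by telescoping, the average over the first n iterates of a
  new map \<open>T\<close> is invariant under \<open>T\<close> up to 1/n; since the maps commute,
  averaging does not spoil the bounds already obtained.\<close>

lemma almost_invariant_fin_add_prob:
  assumes fin: "finite F" and y0: "y0 \<in> Y" and F: "\<And>T. T \<in> F \<Longrightarrow> T ` Y \<subseteq> Y"
    and comm: "\<And>S T y. S \<in> F \<Longrightarrow> T \<in> F \<Longrightarrow> y \<in> Y \<Longrightarrow> S (T y) = T (S y)"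
    and e: "e > 0"
  shows "\<exists>m. fin_add_prob Y m \<and> (\<forall>T\<in>F. \<forall>A. \<bar>m (T -` A) - m A\<bar> \<le> e)"
  using fin F comm
proof (induction F)
  case empty
  have "fin_add_prob Y (\<lambda>A. if y0 \<in> A then 1 else 0)" using y0 by (auto simp: fin_add_prob_def)
  then show ?case by blast
next
  case (insert T F)
  then obtain m where m: "fin_add_prob Y m" and inv: "\<And>S A. S \<in> F \<Longrightarrow> \<bar>m (S -` A) - m A\<bar> \<le> e"
    by (metis insertCI)
  obtain n :: nat where n: "0 < n" "1 / real n < e" using e
    using reals_Archimedean[OF e] by (metis inverse_eq_divide zero_less_Suc)
  define M where "M a A = m ((T ^^ a) -` A)" for a A
  have TY: "(T ^^ a) ` Y \<subseteq> Y" for a using insert.prems(1)[of T] by (induction a) auto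
  have fM: "fin_add_prob Y (M a)" for a unfolding M_def by (rule fin_add_prob_vimage[OF m TY])
  define m' where "m' A = (\<Sum>a<n. M a A) / real n" for A
  have fm': "fin_add_prob Y m'" unfolding m'_def using fin_add_prob_average[of n Y M] fM n by simp
  have "\<bar>m' (S -` A) - m' A\<bar> \<le> e" if S: "S \<in> F" for S A
  proof -
    have sw: "S ((T ^^ a) y) = (T ^^ a) (S y) \<and> (T ^^ a) y \<in> Y" if "y \<in> Y" for a y
    proof (induction a)
      case 0 show ?case using that by simp
    next
      case (Suc a)
      then show ?case using insert.prems(2)[of S T "(T ^^ a) y"] insert.prems(1)[of T] S by auto
    qed
    \<comment> \<open>The maps commute only on \<open>Y\<close>; the two preimages agree there, and
      \<open>m\<close> sees nothing else.\<close>
    have "M a (S -` A) = m (S -` ((T ^^ a) -` A))" for a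
    proof -
      have "(T ^^ a) -` (S -` A) \<inter> Y = S -` ((T ^^ a) -` A) \<inter> Y" using sw by auto
      then show ?thesis unfolding M_def using fin_add_prob_Int[OF m] by metis
    qed
    then have "\<bar>M a (S -` A) - M a A\<bar> \<le> e" for a using inv[OF S] by (simp add: M_def)
    then have "\<bar>\<Sum>a<n. M a (S -` A) - M a A\<bar> \<le> (\<Sum>a<n. e)"
      by (intro order_trans[OF sum_abs] sum_mono)
    then show ?thesis using n(1) by (simp add: m'_def sum_subtractf diff_divide_distrib[symmetric] field_simps)
  qed
  moreover have "\<bar>m' (T -` A) - m' A\<bar> \<le> e" for A
  proof -
    have "M a (T -` A) = M (Suc a) A" for a
    proof -
      have "(T ^^ a) -` (T -` A) = (T ^^ Suc a) -` A" by (simp add: vimage_comp)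
      then show ?thesis unfolding M_def by simp
    qed
    then have "(\<Sum>a<n. M a (T -` A) - M a A) = M n A - M 0 A" using sum_lessThan_telescope[of "\<lambda>a. M a A" n] by simp
    moreover have "\<bar>M n A - M 0 A\<bar> \<le> 1"
      using fM[of n] fM[of 0] fin_add_prob_le_1[OF fM, of n A] fin_add_prob_le_1[OF fM, of 0 A]
      unfolding fin_add_prob_def by (smt (verit))
    ultimately have "\<bar>m' (T -` A) - m' A\<bar> \<le> 1 / real n"
      using n(1) by (simp add: m'_def sum_subtractf diff_divide_distrib[symmetric] divide_right_mono)
    then show ?thesis using n(2) by simp
  qed
  ultimately show ?case using fm' by (intro exI[of _ m'] conjI) auto
qed

text \<open>Means nearly invariant under finitely many maps exist, and near-invariance is a closed
  condition; the finite intersection property in the compact space of means does the rest.\<close>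

lemma invariant_fin_add_prob:
  assumes y0: "y0 \<in> Y" and F: "\<And>T. T \<in> \<Gamma> \<Longrightarrow> T ` Y \<subseteq> Y"
    and comm: "\<And>S T y. S \<in> \<Gamma> \<Longrightarrow> T \<in> \<Gamma> \<Longrightarrow> y \<in> Y \<Longrightarrow> S (T y) = T (S y)"
  shows "\<exists>m. fin_add_prob Y m \<and> (\<forall>T\<in>\<Gamma>. \<forall>A. m (T -` A) = m A)"
proof -
  define K where "K T n = {m. \<forall>A. \<bar>m (T -` A) - m A\<bar> \<le> 1 / real (Suc n)}" for T :: "'a \<Rightarrow> 'a" and n
  have "{m. fin_add_prob Y m} \<inter> (\<Inter>p\<in>\<Gamma> \<times> UNIV. K (fst p) (snd p)) \<noteq> {}"
  proof (rule compact_imp_fip_image[OF compact_fin_add_prob])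
    show "closed (K (fst p) (snd p))" for p
      unfolding K_def
      by (intro closed_Collect_all closed_Collect_le continuous_intros continuous_on_product_coordinates)
    fix I assume I: "finite I" "I \<subseteq> \<Gamma> \<times> (UNIV :: nat set)"
    define N where "N = Max (insert 0 (snd ` I))"
    have I': "T \<in> \<Gamma>" if "T \<in> fst ` I" for T using that I(2) by auto
    have "\<exists>m. fin_add_prob Y m \<and> (\<forall>T\<in>fst ` I. \<forall>A. \<bar>m (T -` A) - m A\<bar> \<le> 1 / real (Suc N))"
      using I(1) y0 F[OF I'] comm[OF I' I'] by (intro almost_invariant_fin_add_prob) auto
    then obtain m where m: "fin_add_prob Y m" "\<forall>T\<in>fst ` I. \<forall>A. \<bar>m (T -` A) - m A\<bar> \<le> 1 / real (Suc N)"
      by blast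
    have "m \<in> K (fst p) (snd p)" if "p \<in> I" for p
    proof -
      have "snd p \<le> N" unfolding N_def using I(1) that by auto
      then have le: "1 / real (Suc N) \<le> 1 / real (Suc (snd p))" by (simp add: frac_le)
      show ?thesis unfolding K_def mem_Collect_eq
      proof
        fix A
        have "\<bar>m (fst p -` A) - m A\<bar> \<le> 1 / real (Suc N)" using m(2) that by blast
        then show "\<bar>m (fst p -` A) - m A\<bar> \<le> 1 / real (Suc (snd p))"
          using le by linarith
      qed
    qed
    then show "{m. fin_add_prob Y m} \<inter> (\<Inter>p\<in>I. K (fst p) (snd p)) \<noteq> {}" using m(1) by blast
  qed
  then obtain m where m: "fin_add_prob Y m" and mK: "m \<in> (\<Inter>p\<in>\<Gamma> \<times> UNIV. K (fst p) (snd p))" by blast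
  have "m (T -` A) = m A" if "T \<in> \<Gamma>" for T A
  proof -
    have "\<bar>m (T -` A) - m A\<bar> \<le> 1 / real (Suc n)" for n     proof -
      have "m \<in> K (fst (T, n)) (snd (T, n))" by (rule INT_D[OF mK]) (use that in simp)
      then show ?thesis unfolding K_def fst_conv snd_conv mem_Collect_eq by (rule spec)
    qed
    then have "\<bar>m (T -` A) - m A\<bar> \<le> 0"
      using LIMSEQ_le_const[OF LIMSEQ_Suc[OF lim_1_over_n], of "\<bar>m (T -` A) - m A\<bar>"] by blast
    then show ?thesis by simp
  qed
  then show ?thesis using m by (intro exI[of _ m] conjI) auto
qed

section \<open>Contents and sections of closed invariant relations\<close>

text \<open>Outer regularisation. A finitely additive \<open>m\<close> need not have any continuity,
  whereas here every set has an open neighbourhood whose \<open>m\<close>-value is almost the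
  content; upper semicontinuity of a set-valued map thus passes to the content.\<close>

definition open_content :: "('y::topological_space set \<Rightarrow> real) \<Rightarrow> 'y set \<Rightarrow> real" where
  "open_content m K = Inf (m ` {N. open N \<and> K \<subseteq> N})"

context
  fixes Y :: "'y::metric_space set" and m
  assumes m: "fin_add_prob Y m"
begin

lemma open_content_le: "open N \<Longrightarrow> K \<subseteq> N \<Longrightarrow> open_content m K \<le> m N"
  unfolding open_content_def
  by (rule cInf_lower) (auto intro!: bdd_belowI2[of _ 0] fin_add_prob_nonneg[OF m])

lemma open_content_greatest: "(\<And>N. open N \<Longrightarrow> K \<subseteq> N \<Longrightarrow> c \<le> m N) \<Longrightarrow> c \<le> open_content m K"
  unfolding open_content_def by (rule cInf_greatest) auto

lemma open_content_approx:
  assumes "e > 0" obtains N where "open N" "K \<subseteq> N" "m N < open_content m K + e"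
proof -
  have "\<exists>N. open N \<and> K \<subseteq> N \<and> m N < open_content m K + e"
  proof (rule ccontr)
    assume "\<not> ?thesis"
    then have "\<And>N. open N \<Longrightarrow> K \<subseteq> N \<Longrightarrow> open_content m K + e \<le> m N" by (meson not_less)
    then have "open_content m K + e \<le> open_content m K" by (rule open_content_greatest)
    then show False using assms by simp
  qed
  then show ?thesis by (elim exE conjE) (rule that)
qed

lemma le_open_content: "m K \<le> open_content m K"
  by (rule open_content_greatest) (rule fin_add_prob_mono[OF m])

lemma open_content_mono: "K \<subseteq> L \<Longrightarrow> open_content m K \<le> open_content m L"
  by (rule open_content_greatest) (auto intro: open_content_le)

lemma open_content_submodular:
  "open_content m (P \<union> Q) + open_content m (P \<inter> Q) \<le> open_content m P + open_content m Q"
proof (rule field_le_epsilon)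
  fix e :: real assume "e > 0"
  then have e2: "e / 2 > 0" by simp
  obtain A where A: "open A" "P \<subseteq> A" "m A < open_content m P + e / 2" by (rule open_content_approx[OF e2])
  obtain B where B: "open B" "Q \<subseteq> B" "m B < open_content m Q + e / 2" by (rule open_content_approx[OF e2])
  have "open_content m (P \<union> Q) \<le> m (A \<union> B)" using A B by (intro open_content_le) auto
  moreover have "open_content m (P \<inter> Q) \<le> m (A \<inter> B)" using A B by (intro open_content_le) auto
  ultimately show "open_content m (P \<union> Q) + open_content m (P \<inter> Q) \<le> open_content m P + open_content m Q + e"
    using A(3) B(3) fin_add_prob_modular[OF m, of A B] by argo
qed

text \<open>Any open neighbourhood of the union contains disjoint open neighbourhoods of both sets,
  separated by comparing the distances to \<open>P\<close> and \<open>Q\<close>.\<close>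

lemma open_content_disjoint:
  assumes "compact P" "compact Q" "P \<inter> Q = {}"
  shows "open_content m P + open_content m Q \<le> open_content m (P \<union> Q)"
proof (rule open_content_greatest)
  fix N assume N: "open N" "P \<union> Q \<subseteq> N"
  obtain A B where AB: "open A" "open B" "P \<subseteq> A" "Q \<subseteq> B" "A \<inter> B = {}"
  proof (cases "P = {} \<or> Q = {}")
    \<comment> \<open>\<open>infdist\<close> to the empty set is 0 by convention, so comparing
      distances cannot serve here.\<close>
    case True
    then show thesis using that[of "{}" UNIV] that[of UNIV "{}"] by auto
  next
    case False
    have P: "infdist x P = 0 \<longleftrightarrow> x \<in> P" and Q: "infdist x Q = 0 \<longleftrightarrow> x \<in> Q" for x
      using in_closed_iff_infdist_zero[of P x] in_closed_iff_infdist_zero[of Q x] assms(1,2) False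
      by (simp_all add: compact_imp_closed)
    show thesis
    proof (rule that)
      show "open {x. infdist x P < infdist x Q}" "open {x. infdist x Q < infdist x P}"
        by (intro open_Collect_less continuous_intros)+
      show "P \<subseteq> {x. infdist x P < infdist x Q}"
      proof
        fix x assume "x \<in> P"
        then have "infdist x P = 0" "infdist x Q \<noteq> 0" using P Q assms(3) by auto
        then show "x \<in> {x. infdist x P < infdist x Q}" using infdist_nonneg[of x Q] by simp
      qed
      show "Q \<subseteq> {x. infdist x Q < infdist x P}"
      proof
        fix x assume "x \<in> Q"
        then have "infdist x Q = 0" "infdist x P \<noteq> 0" using P Q assms(3) by auto
        then show "x \<in> {x. infdist x Q < infdist x P}" using infdist_nonneg[of x P] by simp
      qed
      show "{x. infdist x P < infdist x Q} \<inter> {x. infdist x Q < infdist x P} = {}" by auto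
    qed
  qed
  have "open_content m P \<le> m (N \<inter> A)" using N AB by (intro open_content_le) auto
  moreover have "open_content m Q \<le> m (N \<inter> B)" using N AB by (intro open_content_le) auto
  moreover have "m (N \<inter> A \<union> N \<inter> B) = m (N \<inter> A) + m (N \<inter> B)"
    using AB(5) by (intro fin_add_prob_disjoint[OF m]) blast
  moreover have "m (N \<inter> A \<union> N \<inter> B) \<le> m N" by (intro fin_add_prob_mono[OF m]) blast
  ultimately show "open_content m P + open_content m Q \<le> m N" by argo
qed

text \<open>Neighbourhoods are pulled back to relatively open subsets of \<open>Y\<close>, which
  suffices because \<open>m\<close> lives on \<open>Y\<close>. Applied to a map and its inverse, the
  inequality yields invariance of the content.\<close>

lemma open_content_le_image:
  assumes "continuous_on Y T" "\<And>A. m (T -` A) = m A" "K \<subseteq> Y"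
  shows "open_content m K \<le> open_content m (T ` K)"
proof (rule open_content_greatest)
  fix N assume N: "open N" "T ` K \<subseteq> N"
  obtain N' where N': "open N'" "Y \<inter> T -` N = Y \<inter> N'"
    using continuous_openin_preimage_gen[OF assms(1) N(1)] by (auto simp: openin_open)
  have "K \<subseteq> Y \<inter> T -` N" using N(2) assms(3) by blast
  then have "open_content m K \<le> m N'" using N' by (intro open_content_le) auto
  also have "m N' = m (T -` N)" using fin_add_prob_Int[OF m, of N'] fin_add_prob_Int[OF m, of "T -` N"] N'(2)
    by (simp add: Int_commute)
  finally show "open_content m K \<le> m N" using assms(2) by simp
qed

end

text \<open>All sections have the same content \<open>c\<close> by semicontinuity and minimality, hence the content of
  \<open>S x \<union> S y\<close> minus \<open>c\<close> is a continuous invariant pseudometric in \<open>x\<close> and \<open>y\<close>.\<close>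
lemma section_S_eq_invariant:
  fixes act :: "'g::ab_group_add \<Rightarrow> 'x::metric_space \<Rightarrow> 'x" and S :: "'x \<Rightarrow> 'y::metric_space set"
    and \<tau> :: "'g \<Rightarrow> 'y \<Rightarrow> 'y"
  assumes sys: "G_system X act" and min: "minimal_system X act"
    and Y: "compact Y" and m: "fin_add_prob Y m"
    and \<tau>m: "\<And>g A. m (\<tau> g -` A) = m A" and \<tau>cont: "\<And>g. continuous_on Y (\<tau> g)"
    and \<tau>Y: "\<And>g. \<tau> g ` Y \<subseteq> Y" and \<tau>inv: "\<And>g y. y \<in> Y \<Longrightarrow> \<tau> (- g) (\<tau> g y) = y"
    and pos: "\<And>V. open V \<Longrightarrow> Y \<inter> V \<noteq> {} \<Longrightarrow> 0 < m (Y \<inter> V)"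
    and SY: "\<And>u. u \<in> X \<Longrightarrow> S u \<subseteq> Y" and Sc: "\<And>u. u \<in> X \<Longrightarrow> compact (S u)"
    and usc: "\<And>u N. u \<in> X \<Longrightarrow> open N \<Longrightarrow> S u \<subseteq> N \<Longrightarrow> \<exists>\<delta>>0. \<forall>u'\<in>X. dist u u' < \<delta> \<longrightarrow> S u' \<subseteq> N"
    and eqv: "\<And>g u. u \<in> X \<Longrightarrow> S (act g u) = \<tau> g ` S u"
    and uv: "(u, v) \<in> S_eq X act" "u \<in> X" "v \<in> X" and V: "open V" "Y \<inter> V \<subseteq> S u"
  shows "Y \<inter> V \<subseteq> S v"
proof -
  define c where "c = open_content m (S u)"
  have actX: "\<And>g x. x \<in> X \<Longrightarrow> act g x \<in> X" using sys unfolding G_system_def by blast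
  have ocT: "open_content m (\<tau> g ` K) = open_content m K" if "K \<subseteq> Y" for g K
  proof (rule antisym)
    show "open_content m K \<le> open_content m (\<tau> g ` K)"
      by (rule open_content_le_image[OF m \<tau>cont \<tau>m that])
    have "open_content m (\<tau> g ` K) \<le> open_content m (\<tau> (- g) ` \<tau> g ` K)"
      using that \<tau>Y by (intro open_content_le_image[OF m \<tau>cont \<tau>m]) blast
    also have "\<tau> (- g) ` \<tau> g ` K = (\<lambda>y. y) ` K"
      unfolding image_image using that \<tau>inv by (intro image_cong) auto
    also have "\<dots> = K" by simp
    finally show "open_content m (\<tau> g ` K) \<le> open_content m K" .
  qed
  \<comment> \<open>Minimality brings \<open>x\<close> so close to \<open>x'\<close> that the
    translated section enters a neighbourhood of \<open>S x'\<close> of almost the same value, and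
    translation preserves the content.\<close>
  have le: "open_content m (S x) \<le> open_content m (S x')" if x: "x \<in> X" "x' \<in> X" for x x'
  proof (rule field_le_epsilon)
    fix e :: real assume "e > 0"
    then obtain N where N: "open N" "S x' \<subseteq> N" "m N < open_content m (S x') + e"
      by (rule open_content_approx[OF m])
    obtain \<delta> where \<delta>: "\<delta> > 0" "\<forall>u'\<in>X. dist x' u' < \<delta> \<longrightarrow> S u' \<subseteq> N" using usc[OF x(2) N(1,2)] by blast
    have "x' \<in> closure (range (\<lambda>g. act g x))" using min x unfolding minimal_system_def by blast
    then obtain g where "dist (act g x) x' < \<delta>" using \<delta>(1) unfolding closure_approachable by blast
    then have "S (act g x) \<subseteq> N" using \<delta>(2) actX[OF x(1)] by (simp add: dist_commute)
    then have "open_content m (S (act g x)) \<le> m N" by (rule open_content_le[OF m N(1)])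
    then show "open_content m (S x) \<le> open_content m (S x') + e"
      using N(3) ocT[OF SY[OF x(1)]] eqv[OF x(1)] by simp
  qed
  have c: "open_content m (S x) = c" if "x \<in> X" for x
    unfolding c_def using le[OF that uv(2)] le[OF uv(2) that] by (rule antisym)
  define d where "d x y = open_content m (S x \<union> S y) - c" for x y
  have "d u v = 0"
  proof (rule S_eq_pseudometric_eq_0[OF sys _ _ _ _ _ uv(1)])
    show "d x x = 0" if "x \<in> X" for x unfolding d_def using c[OF that] by simp
    show "d x y = d y x" for x y unfolding d_def by (simp add: Un_commute)
    \<comment> \<open>Submodularity for \<open>S x \<union> S y\<close> and
      \<open>S y \<union> S z\<close>: the intersection contains \<open>S y\<close>, whose content
      is \<open>c\<close>.\<close>
    show "d x z \<le> d x y + d y z" if "x \<in> X" "y \<in> X" "z \<in> X" for x y z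
    proof -
      have "open_content m (S x \<union> S z) \<le> open_content m ((S x \<union> S y) \<union> (S y \<union> S z))"
        by (intro open_content_mono[OF m]) blast
      moreover have "open_content m (S y) \<le> open_content m ((S x \<union> S y) \<inter> (S y \<union> S z))"
        by (intro open_content_mono[OF m]) blast
      ultimately show ?thesis
        unfolding d_def using open_content_submodular[OF m, of "S x \<union> S y" "S y \<union> S z"] c[OF that(2)] by argo
    qed
    show "\<exists>\<delta>>0. \<forall>y\<in>X. dist x y < \<delta> \<longrightarrow> d x y < e" if x: "x \<in> X" and e: "e > 0" for x e
    proof -
      obtain N where N: "open N" "S x \<subseteq> N" "m N < open_content m (S x) + e"
        by (rule open_content_approx[OF m e])
      obtain \<delta> where \<delta>: "\<delta> > 0" "\<forall>u'\<in>X. dist x u' < \<delta> \<longrightarrow> S u' \<subseteq> N" using usc[OF x N(1,2)] by blast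
      have "d x y < e" if "y \<in> X" "dist x y < \<delta>" for y
      proof -
        have "S x \<union> S y \<subseteq> N" using \<delta>(2) N(2) that by blast
        then have "open_content m (S x \<union> S y) \<le> m N" by (rule open_content_le[OF m N(1)])
        then show ?thesis using N(3) c[OF x] unfolding d_def by argo
      qed
      then show ?thesis using \<delta>(1) by blast
    qed
    show "d (act g x) (act g y) = d x y" if "x \<in> X" "y \<in> X" for g x y
      unfolding d_def eqv[OF that(1)] eqv[OF that(2)] image_Un[symmetric]
      using ocT[of "S x \<union> S y" g] SY[OF that(1)] SY[OF that(2)] by simp
  qed
  show ?thesis
  proof (rule ccontr)
    assume "\<not> ?thesis"
    then obtain z where z: "z \<in> Y" "z \<in> V" "z \<notin> S v" by blast
    \<comment> \<open>A small closed ball about a missing point, cut with \<open>Y\<close>, would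
      lie in \<open>S u\<close> away from \<open>S v\<close> and add positive content to that of
      \<open>S v\<close>, although \<open>S u \<union> S v\<close> has content \<open>c\<close>
      only.\<close>
    have "open (V - S v)" using V(1) Sc[OF uv(3)] by (simp add: open_Diff compact_imp_closed)
    then obtain r where r: "r > 0" "cball z r \<subseteq> V - S v" using z open_contains_cball by blast
    define B where "B = Y \<inter> cball z r"
    have "compact B" unfolding B_def using Y by (simp add: compact_Int_closed)
    then have "open_content m (S v) + open_content m B \<le> open_content m (S v \<union> B)"
      using r(2) Sc[OF uv(3)] by (intro open_content_disjoint[OF m]) (auto simp: B_def)
    also have "\<dots> \<le> open_content m (S u \<union> S v)"
      using V(2) r(2) by (intro open_content_mono[OF m]) (auto simp: B_def)
    also have "\<dots> = c" using \<open>d u v = 0\<close> unfolding d_def by simp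
    finally have "open_content m B \<le> 0" using c[OF uv(3)] by simp
    moreover have "z \<in> Y \<inter> ball z r" using z(1) r(1) by simp
    then have "0 < m (Y \<inter> ball z r)" using pos[OF open_ball] by blast
    moreover have "m (Y \<inter> ball z r) \<le> m B" unfolding B_def by (intro fin_add_prob_mono[OF m]) auto
    moreover have "m B \<le> open_content m B" by (rule le_open_content[OF m])
    ultimately show False by argo
  qed
qed

section \<open>Simultaneous transfer along fibres\<close>

lemma G_systemD:
  assumes "G_system X act"
  shows G_system_compact: "compact X" and G_system_0: "x \<in> X \<Longrightarrow> act 0 x = x"
    and G_system_plus: "x \<in> X \<Longrightarrow> act (g + h) x = act g (act h x)"
    and G_system_in: "x \<in> X \<Longrightarrow> act g x \<in> X" and G_system_continuous: "continuous_on X (act g)"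
  using assms unfolding G_system_def by blast+

lemma G_system_uminus: "G_system X act \<Longrightarrow> x \<in> X \<Longrightarrow> act (- g) (act g x) = x"
  using G_system_plus[of X act x "- g" g] G_system_0[of X act x] by simp

lemma G_system_uminus': "G_system X act \<Longrightarrow> x \<in> X \<Longrightarrow> act g (act (- g) x) = x"
  using G_system_plus[of X act x g "- g"] G_system_0[of X act x] by simp

lemma minimal_system_approx:
  assumes "minimal_system X act" "x \<in> X" "z \<in> X" "e > 0"
  obtains g where "dist (act g x) z < e"
proof -
  have "z \<in> closure (range (\<lambda>g. act g x))" using assms unfolding minimal_system_def by blast
  then have "\<exists>y\<in>range (\<lambda>g. act g x). dist y z < e" using assms(4) unfolding closure_approachable by simp
  then show ?thesis using that by auto
qed

lemma minimal_system_open: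
  assumes "minimal_system X act" "G_system X act" "x \<in> X" "openin (top_of_set X) U" "U \<noteq> {}"
  obtains g where "act g x \<in> U"
proof -
  obtain T where T: "open T" "U = X \<inter> T" using assms(4) by (auto simp: openin_open)
  obtain z where z: "z \<in> X" "z \<in> T" using T(2) assms(5) by auto
  obtain e where e: "e > 0" "ball z e \<subseteq> T" using openE[OF T(1) z(2)] .
  obtain g where "dist (act g x) z < e" by (rule minimal_system_approx[OF assms(1,3) z(1) e(1)])
  then have "act g x \<in> T" using e(2) by (auto simp: dist_commute)
  then show ?thesis using that[of g] T(2) G_system_in[OF assms(2,3)] by simp
qed

section \<open>Diagonal actions on spaces of sequences\<close>

abbreviation sequences_in :: "'x set \<Rightarrow> (nat \<Rightarrow> 'x) set" where
  "sequences_in X \<equiv> {f. \<forall>i. f i \<in> X}"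

lemma continuous_on_coordinatewise_map:
  fixes h :: "nat \<Rightarrow> 'x::topological_space \<Rightarrow> 'x"
  assumes "\<And>i. continuous_on X (h i)"
  shows "continuous_on (sequences_in X) (\<lambda>f i. h i (f i))"
proof (intro continuous_on_coordinatewise_then_product)
  fix i
  show "continuous_on (sequences_in X) (\<lambda>f. h i (f i))"
    by (rule continuous_on_compose2[OF assms[of i] continuous_on_subset[OF continuous_on_product_coordinates[of i] subset_UNIV]]) auto
qed

lemma fin_add_prob_finite_Union_0:
  assumes m: "fin_add_prob Y m" and "finite I" "\<And>i. i \<in> I \<Longrightarrow> m (A i) = 0"
  shows "m (\<Union>i\<in>I. A i) = 0"
  using assms(2,3)
proof (induction I)
  case empty
  show ?case using fin_add_prob_disjoint[OF m, of "{}" "{}"] by simp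
next
  case (insert i I)
  have "m (A i \<union> (\<Union>i\<in>I. A i)) \<le> m (A i) + m (\<Union>i\<in>I. A i)"
    using fin_add_prob_modular[OF m, of "A i" "\<Union>i\<in>I. A i"] fin_add_prob_nonneg[OF m, of "A i \<inter> (\<Union>i\<in>I. A i)"]
    by linarith
  then show ?case using insert fin_add_prob_nonneg[OF m, of "A i \<union> (\<Union>i\<in>I. A i)"] by simp
qed

text \<open>The mean is built invariant under independent translations of the coordinates, which
  commute because G is abelian; the conclusion keeps the diagonal ones. The larger group gives
  positivity: by minimality in each coordinate the translates of \<open>V\<close> cover the compact
  product, finitely many suffice, and all have the mass of \<open>V\<close>. Sequences stand in for
  tuples since a countable index set keeps the function type a metric space.\<close>

lemma invariant_fin_add_prob_sequences:
  fixes act :: "'g::ab_group_add \<Rightarrow> 'x::metric_space \<Rightarrow> 'x"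
  assumes sys: "G_system X act" and min: "minimal_system X act" and ne: "X \<noteq> {}"
  shows "\<exists>m. fin_add_prob (sequences_in X) m \<and> (\<forall>g A. m ((\<lambda>f i. act g (f i)) -` A) = m A) \<and>
    (\<forall>V. open V \<longrightarrow> sequences_in X \<inter> V \<noteq> {} \<longrightarrow> 0 < m (sequences_in X \<inter> V))"
proof -
  let ?Y = "sequences_in X"
  define T where "T \<gamma> f i = act (\<gamma> i) (f i)" for \<gamma> :: "nat \<Rightarrow> 'g" and f :: "nat \<Rightarrow> 'x" and i
  obtain x0 where x0: "x0 \<in> X" using ne by blast
  have "\<exists>m. fin_add_prob ?Y m \<and> (\<forall>S\<in>range T. \<forall>A. m (S -` A) = m A)"
  proof (rule invariant_fin_add_prob)
    show "(\<lambda>i. x0) \<in> ?Y" using x0 by simp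
    show "S ` ?Y \<subseteq> ?Y" if "S \<in> range T" for S
      using that G_system_in[OF sys] by (auto simp: T_def)
    show "S (S' y) = S' (S y)" if SS: "S \<in> range T" "S' \<in> range T" and y: "y \<in> ?Y" for S S' y
    proof -
      obtain \<gamma> \<gamma>' where S: "S = T \<gamma>" "S' = T \<gamma>'" using SS by auto
      have "act (\<gamma> i) (act (\<gamma>' i) (y i)) = act (\<gamma>' i) (act (\<gamma> i) (y i))" for i
      proof -
        have yi: "y i \<in> X" using y by simp
        have "act (\<gamma> i) (act (\<gamma>' i) (y i)) = act (\<gamma> i + \<gamma>' i) (y i)" by (simp add: G_system_plus[OF sys yi])
        also have "\<dots> = act (\<gamma>' i + \<gamma> i) (y i)" by (simp add: add.commute)
        also have "\<dots> = act (\<gamma>' i) (act (\<gamma> i) (y i))" by (rule G_system_plus[OF sys yi])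
        finally show ?thesis .
      qed
      then show ?thesis unfolding S T_def by simp
    qed
  qed
  then obtain m where m: "fin_add_prob ?Y m" and mT0: "\<forall>S\<in>range T. \<forall>A. m (S -` A) = m A"
    by (elim exE conjE)
  have mT: "m (T \<gamma> -` A) = m A" for \<gamma> A using bspec[OF mT0 rangeI] by simp
  have "0 < m (?Y \<inter> V)" if V: "open V" "?Y \<inter> V \<noteq> {}" for V
  proof (rule ccontr)
    assume "\<not> ?thesis"
    then have m0: "m (?Y \<inter> V) = 0" using fin_add_prob_nonneg[OF m, of "?Y \<inter> V"] by simp
    obtain f0 where f0: "f0 \<in> V" "\<And>i. f0 i \<in> X" using V by auto
    have "openin (product_topology (\<lambda>i. euclidean) UNIV) V"
      using V(1) by (simp add: euclidean_product_topology)
    then obtain B where B: "f0 \<in> PiE UNIV B" "\<And>i. open (B i)" "PiE UNIV B \<subseteq> V"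
      using product_topology_open_contains_basis[of "\<lambda>i. euclidean" UNIV V f0] f0(1) by auto
    have cov: "\<exists>\<gamma>. T \<gamma> f \<in> V" if f: "f \<in> ?Y" for f
    proof -
      have "\<exists>g. act g (f i) \<in> B i" for i
      proof -
        have "f i \<in> X" using f by simp
        moreover have "openin (top_of_set X) (X \<inter> B i)" using B(2) by (simp add: openin_open_Int)
        moreover have "X \<inter> B i \<noteq> {}" using B(1) f0(2)[of i] by auto
        ultimately obtain g where "act g (f i) \<in> X \<inter> B i" by (rule minimal_system_open[OF min sys])
        then show ?thesis by blast
      qed
      then obtain \<gamma> where "\<And>i. act (\<gamma> i) (f i) \<in> B i" by metis
      then have "T \<gamma> f \<in> PiE UNIV B" by (simp add: T_def PiE_UNIV_domain)
      then show ?thesis using B(3) by blast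
    qed
    have "\<exists>N. open N \<and> ?Y \<inter> T \<gamma> -` V = ?Y \<inter> N" for \<gamma>
      using continuous_openin_preimage_gen[OF _ V(1), of ?Y "T \<gamma>"]
        continuous_on_coordinatewise_map[of X "\<lambda>i. act (\<gamma> i)"] G_system_continuous[OF sys]
      unfolding openin_open T_def by simp
    then obtain N where N: "\<And>\<gamma>. open (N \<gamma>)" "\<And>\<gamma>. ?Y \<inter> T \<gamma> -` V = ?Y \<inter> N \<gamma>" by metis
    have "?Y \<subseteq> (\<Union>\<gamma>\<in>UNIV. N \<gamma>)"
    proof
      fix f assume f: "f \<in> ?Y"
      obtain \<gamma> where "T \<gamma> f \<in> V" using cov[OF f] by (elim exE)
      then have "f \<in> ?Y \<inter> N \<gamma>" unfolding N(2)[symmetric] using f by simp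
      then show "f \<in> (\<Union>\<gamma>\<in>UNIV. N \<gamma>)" by blast
    qed
    then obtain I where I: "finite I" "?Y \<subseteq> (\<Union>\<gamma>\<in>I. N \<gamma>)"
      by (rule compactE_image[OF compact_PiE_fun[of "\<lambda>i. X", OF G_system_compact[OF sys]] N(1)])
    have "m (N \<gamma>) = 0" for \<gamma>
    proof -
      have "m (N \<gamma>) = m (?Y \<inter> N \<gamma>)" using fin_add_prob_Int[OF m, of "N \<gamma>"] by (simp add: Int_commute)
      also have "\<dots> = m (?Y \<inter> T \<gamma> -` V)" using N(2) by simp
      also have "\<dots> = m (T \<gamma> -` V)" using fin_add_prob_Int[OF m, of "T \<gamma> -` V"] by (simp add: Int_commute)
      also have "\<dots> = m V" by (rule mT)
      also have "\<dots> = 0" using m0 fin_add_prob_Int[OF m, of V] by (simp add: Int_commute)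
      finally show ?thesis .
    qed
    then have "m (\<Union>\<gamma>\<in>I. N \<gamma>) = 0" by (intro fin_add_prob_finite_Union_0[OF m I(1)])
    then show False using fin_add_prob_mono[OF m I(2)] fin_add_prob_carrier[OF m] by simp
  qed
  moreover have "m ((\<lambda>f i. act g (f i)) -` A) = m A" for g A
    using mT[of "\<lambda>i. g" A] unfolding T_def .
  ultimately show ?thesis using m by (intro exI[of _ m] conjI allI impI)
qed

text \<open>Fixing coordinate \<open>j\<close> slices \<open>D\<close> into sections. They inherit
  equivariance from the invariance of \<open>D\<close> and upper semicontinuity from its closedness,
  so an open set contained in one section passes to the section over an \<open>S_eq\<close>-related
  point.\<close>

lemma closed_invariant_coordinate_S_eq:
  fixes act :: "'g::ab_group_add \<Rightarrow> 'x::metric_space \<Rightarrow> 'x" and j :: nat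
  assumes sys: "G_system X act" and min: "minimal_system X act"
    and D: "closed D" "\<And>g f. f \<in> D \<Longrightarrow> (\<lambda>i. act g (f i)) \<in> D"
    and uv: "(u, v) \<in> S_eq X act" "u \<in> X" "v \<in> X"
    and V: "open V" "\<And>f. f \<in> sequences_in X \<inter> V \<Longrightarrow> f(j := u) \<in> D"
    and f: "f \<in> sequences_in X \<inter> V"
  shows "f(j := v) \<in> D"
proof -
  let ?Y = "sequences_in X"
  define \<tau> where "\<tau> g f i = act g (f i)" for g and f :: "nat \<Rightarrow> 'x" and i :: nat
  obtain m where m: "fin_add_prob ?Y m" "\<And>g A. m (\<tau> g -` A) = m A"
    "\<And>V. open V \<Longrightarrow> ?Y \<inter> V \<noteq> {} \<Longrightarrow> 0 < m (?Y \<inter> V)"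
    using invariant_fin_add_prob_sequences[OF sys min] uv(2) unfolding \<tau>_def by blast
  \<comment> \<open>The entry of \<open>f\<close> at \<open>j\<close> is overwritten and thus free,
    which keeps all sections in the same space.\<close>
  define S where "S u = {f \<in> ?Y. f(j := u) \<in> D}" for u
  define F where "F p = (snd p)(j := fst p)" for p :: "'x \<times> (nat \<Rightarrow> 'x)"
  have contF: "continuous_on UNIV F"
  proof (rule continuous_on_coordinatewise_then_product)
    fix i
    show "continuous_on UNIV (\<lambda>p. F p i)"
    proof (cases "i = j")
      case True then show ?thesis unfolding F_def by (simp add: continuous_on_fst)
    next
      case False
      then show ?thesis unfolding F_def
        using continuous_on_product_then_coordinatewise[OF continuous_on_snd[OF continuous_on_id], of UNIV i] by simp
    qed
  qed
  have cY: "compact ?Y" by (rule compact_PiE_fun[of "\<lambda>i. X", OF G_system_compact[OF sys]])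
  have "?Y \<inter> V \<subseteq> S v"
  proof (rule section_S_eq_invariant[OF sys min cY m(1,2) _ _ _ m(3) _ _ _ _ uv V(1)])
    show "continuous_on ?Y (\<tau> g)" for g
      unfolding \<tau>_def by (rule continuous_on_coordinatewise_map[OF G_system_continuous[OF sys]])
    show "\<tau> g ` ?Y \<subseteq> ?Y" for g using G_system_in[OF sys] by (auto simp: \<tau>_def)
    show "\<tau> (- g) (\<tau> g y) = y" if "y \<in> ?Y" for g y
      using that G_system_uminus[OF sys] by (auto simp: \<tau>_def)
    show "S u \<subseteq> ?Y" for u unfolding S_def by blast
    show "compact (S u)" for u
    proof -
      have "continuous_on UNIV (\<lambda>f. F (u, f))"
        by (rule continuous_on_compose2[OF contF]) (auto intro: continuous_intros)
      then have "closed ((\<lambda>f. F (u, f)) -` D)" using D(1) by (intro closed_vimage)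
      moreover have "S u = ?Y \<inter> (\<lambda>f. F (u, f)) -` D" unfolding S_def F_def by auto
      ultimately show ?thesis using cY by (simp add: compact_Int_closed)
    qed
    show "\<exists>\<delta>>0. \<forall>u'\<in>X. dist u u' < \<delta> \<longrightarrow> S u' \<subseteq> N" if N: "u \<in> X" "open N" "S u \<subseteq> N" for u N
    proof -
      \<comment> \<open>The base points whose section leaves \<open>N\<close>; as a projection of a
        compact set this is closed.\<close>
      define C where "C = fst ` ((X \<times> ?Y) \<inter> (UNIV \<times> (- N) \<inter> F -` D))"
      have "closed (F -` D)" using D(1) contF by (intro closed_vimage)
      then have "compact ((X \<times> ?Y) \<inter> (UNIV \<times> (- N) \<inter> F -` D))"
        using N(2) by (intro compact_Int_closed compact_Times cY G_system_compact[OF sys] closed_Int closed_Times) auto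
      then have "compact C" unfolding C_def by (intro compact_continuous_image continuous_intros)
      then have "open (- C)" by (intro open_Compl compact_imp_closed)
      moreover have "u \<in> - C" using N(3) unfolding C_def S_def F_def by auto
      ultimately obtain \<delta> where \<delta>: "\<delta> > 0" "ball u \<delta> \<subseteq> - C" using open_contains_ball by blast
      have "S u' \<subseteq> N" if "u' \<in> X" "dist u u' < \<delta>" for u'
      proof
        fix f assume "f \<in> S u'"
        have "u' \<notin> C" using \<delta>(2) that by auto
        moreover have "u' \<in> C" if "f \<notin> N"
          unfolding C_def using \<open>f \<in> S u'\<close> \<open>u' \<in> X\<close> that
          by (intro image_eqI[of _ _ "(u', f)"]) (auto simp: S_def F_def)
        ultimately show "f \<in> N" by blast
      qed
      then show ?thesis using \<delta>(1) by blast
    qed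
    show "S (act g u) = \<tau> g ` S u" if u: "u \<in> X" for g u
    proof (intro subset_antisym subsetI)
      fix f assume f: "f \<in> S (act g u)"
      have "\<tau> (- g) f \<in> S u"
      proof -
        have "(\<lambda>i. act (- g) ((f(j := act g u)) i)) \<in> D" using f D(2) unfolding S_def by blast
        moreover have "(\<lambda>i. act (- g) ((f(j := act g u)) i)) = (\<tau> (- g) f)(j := u)"
          using G_system_uminus[OF sys u] by (auto simp: \<tau>_def)
        ultimately show ?thesis using f G_system_in[OF sys] unfolding S_def by (auto simp: \<tau>_def)
      qed
      moreover have "f = \<tau> g (\<tau> (- g) f)"
        using f G_system_uminus'[OF sys] unfolding S_def \<tau>_def by auto
      ultimately show "f \<in> \<tau> g ` S u" by blast
    next
      fix f assume "f \<in> \<tau> g ` S u"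
      then obtain f' where f': "f' \<in> S u" "f = \<tau> g f'" by blast
      have "(\<lambda>i. act g ((f'(j := u)) i)) \<in> D" using f' D(2) unfolding S_def by blast
      moreover have "(\<lambda>i. act g ((f'(j := u)) i)) = f(j := act g u)" unfolding f'(2) by (auto simp: \<tau>_def)
      ultimately show "f \<in> S (act g u)" using f' G_system_in[OF sys] unfolding S_def by (auto simp: \<tau>_def)
    qed
    show "?Y \<inter> V \<subseteq> S u" using V(2) unfolding S_def by blast
  qed
  then show ?thesis using f unfolding S_def by blast
qed

text \<open>The closure \<open>D\<close> of the diagonal orbit of the box with sides \<open>U t\<close> contains the box with sides
  \<open>p -` p ` U t\<close>: the coordinates are moved within their fibres one after the other.\<close>
lemma simultaneous_hitting:
  fixes act :: "'g::ab_group_add \<Rightarrow> 'x::metric_space \<Rightarrow> 'x" and p :: "'x \<Rightarrow> 'h::metric_space" and M :: nat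
  assumes sys: "G_system X act" and min: "minimal_system X act" and ne: "X \<noteq> {}"
    and p: "continuous_on X p" "\<And>x y. x \<in> X \<Longrightarrow> y \<in> X \<Longrightarrow> p x = p y \<Longrightarrow> (x, y) \<in> S_eq X act"
    and U: "\<And>t. t < M \<Longrightarrow> openin (top_of_set X) (U t)" "\<And>t. t < M \<Longrightarrow> openin (top_of_set (p ` X)) (p ` U t)"
    and W: "\<And>t. t < M \<Longrightarrow> openin (top_of_set X) (W t)" "\<And>t. t < M \<Longrightarrow> \<exists>w\<in>W t. p w \<in> p ` U t"
  shows "\<exists>g. \<forall>t<M. \<exists>x\<in>U t. act g x \<in> W t"
proof -
  let ?Y = "sequences_in X"
  \<comment> \<open>The union of the translates of the box: \<open>f\<close> belongs to it if some
    \<open>g\<close> carries a point of the box to \<open>f\<close>. Coordinates from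
    \<open>M\<close> on are arbitrary in \<open>X\<close>.\<close>
  define E where "E = {f \<in> ?Y. \<exists>g. \<forall>t<M. act (- g) (f t) \<in> U t}"
  define D where "D = closure E"
  have UX: "U t \<subseteq> X" if "t < M" for t using U(1)[OF that] by (rule openin_imp_subset)
  have WX: "W t \<subseteq> X" if "t < M" for t using W(1)[OF that] by (rule openin_imp_subset)
  have cY: "compact ?Y" by (rule compact_PiE_fun[of "\<lambda>i. X", OF G_system_compact[OF sys]])
  have DY: "D \<subseteq> ?Y" unfolding D_def using compact_imp_closed[OF cY] by (intro closure_minimal) (auto simp: E_def)
  have Dinv: "(\<lambda>i. act g (f i)) \<in> D" if "f \<in> D" for g f
  proof -
    have "(\<lambda>f i. act g (f i)) ` closure E \<subseteq> D"
    proof (rule image_closure_subset)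
      show "continuous_on (closure E) (\<lambda>f i. act g (f i))"
        using continuous_on_subset[OF continuous_on_coordinatewise_map[OF G_system_continuous[OF sys]] DY[unfolded D_def]] .
      show "closed D" unfolding D_def by simp
      show "(\<lambda>f i. act g (f i)) ` E \<subseteq> D"
      proof
        fix f' assume "f' \<in> (\<lambda>f i. act g (f i)) ` E"
        then obtain f h where f: "f' = (\<lambda>i. act g (f i))" "\<And>i. f i \<in> X" "\<And>t. t < M \<Longrightarrow> act (- h) (f t) \<in> U t"
          unfolding E_def by auto
        have "act (- (h + g)) (f' t) \<in> U t" if "t < M" for t
        proof -
          have "- (h + g) + g = - h" by simp
          then have "act (- (h + g)) (f' t) = act (- h) (f t)"
            unfolding f(1) using G_system_plus[OF sys f(2)[of t], of "- (h + g)" g] by simp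
          then show ?thesis using f(3)[OF that] by simp
        qed
        then have "f' \<in> E" unfolding E_def using f(1,2) G_system_in[OF sys] by blast
        then show "f' \<in> D" unfolding D_def using closure_subset by blast
      qed
    qed
    then show ?thesis using that unfolding D_def by blast
  qed
  have claim: "f \<in> D" if "j \<le> M" "f \<in> ?Y" "\<forall>t<j. p (f t) \<in> p ` U t" "\<forall>t<M. j \<le> t \<longrightarrow> f t \<in> U t" for j f
    using that
  proof (induction j arbitrary: f)
    case 0
    then have "f \<in> E" unfolding E_def using G_system_0[OF sys] UX by (auto intro!: exI[of _ 0])
    then show ?case unfolding D_def using closure_subset by blast
  next
    case (Suc j)
    have jM: "j < M" using Suc.prems(1) by simp
    have "p (f j) \<in> p ` U j" using Suc.prems(3) by simp
    then obtain u where u: "u \<in> U j" "p u = p (f j)" by auto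
    have uX: "u \<in> X" "f j \<in> X" using UX[OF jM] u(1) Suc.prems(2) by auto
    obtain Q where Q: "\<And>t. t < M \<Longrightarrow> open (Q t) \<and> U t = X \<inter> Q t" using U(1) unfolding openin_open by metis
    have "\<exists>P. open P \<and> X \<inter> p -` (p ` U t) = X \<inter> P" if "t < M" for t
    proof -
      have "openin (top_of_set X) (X \<inter> p -` (p ` U t))"
        by (rule continuous_openin_preimage[OF p(1) _ U(2)[OF that]]) auto
      then show ?thesis unfolding openin_open by blast
    qed
    then obtain P where P: "\<And>t. t < M \<Longrightarrow> open (P t) \<and> X \<inter> p -` (p ` U t) = X \<inter> P t" by metis
    \<comment> \<open>No constraint falls on coordinate \<open>j\<close>. Earlier coordinates are
      constrained through their base points, which is an open condition because the sets
      \<open>U t\<close> have open images.\<close>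
    define V where "V = (\<Inter>t\<in>{..<j}. {f. f t \<in> P t}) \<inter> (\<Inter>t\<in>{j<..<M}. {f :: nat \<Rightarrow> 'x. f t \<in> Q t})"
    have op: "open {f :: nat \<Rightarrow> 'x. f t \<in> B}" if "open B" for t B
      using open_vimage[OF that continuous_on_product_coordinates[of t]] by (simp add: vimage_def)
    have "open V" unfolding V_def using P Q jM by (intro open_Int open_INT ballI op) auto
    have PX: "x \<in> P t \<longleftrightarrow> p x \<in> p ` U t" if "t < M" "x \<in> X" for t x using P[OF that(1)] that(2) by blast
    have QX: "x \<in> Q t \<longleftrightarrow> x \<in> U t" if "t < M" "x \<in> X" for t x using Q[OF that(1)] that(2) by blast
    have VE: "f' \<in> V \<longleftrightarrow> (\<forall>t<j. p (f' t) \<in> p ` U t) \<and> (\<forall>t<M. j < t \<longrightarrow> f' t \<in> U t)" if "f' \<in> ?Y" for f'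
      using that jM PX QX unfolding V_def by auto
    \<comment> \<open>Writing \<open>f\<close> with its own entry put in at \<open>j\<close>
      exhibits it as the result of a move from \<open>u\<close> to \<open>f j\<close> within one
      fibre.\<close>
    have "f(j := f j) \<in> D"
    proof (rule closed_invariant_coordinate_S_eq[OF sys min _ Dinv p(2)[OF uX u(2)] uX \<open>open V\<close>])
      show "closed D" unfolding D_def by simp
      show "f \<in> ?Y \<inter> V" using VE[OF Suc.prems(2)] Suc.prems by auto
      fix f' assume f': "f' \<in> ?Y \<inter> V"
      show "f'(j := u) \<in> D"
      proof (rule Suc.IH)
        show "j \<le> M" using jM by simp
        show "f'(j := u) \<in> ?Y" using f' uX by simp
        show "\<forall>t<j. p ((f'(j := u)) t) \<in> p ` U t" using f' VE[of f'] by simp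
        show "\<forall>t<M. j \<le> t \<longrightarrow> (f'(j := u)) t \<in> U t" using f' VE[of f'] u(1) by auto
      qed
    qed
    then show ?case by simp
  qed
  obtain w where w: "\<And>t. t < M \<Longrightarrow> w t \<in> W t \<and> p (w t) \<in> p ` U t" using W(2) by metis
  obtain x0 where x0: "x0 \<in> X" using ne by blast
  define f where "f t = (if t < M then w t else x0)" for t
  have "f \<in> D"
  proof (rule claim[of M])
    show "f \<in> ?Y" unfolding f_def using w WX x0 by auto
    show "\<forall>t<M. p (f t) \<in> p ` U t" unfolding f_def using w by auto
  qed auto
  obtain W' where W': "\<And>t. t < M \<Longrightarrow> open (W' t) \<and> W t = X \<inter> W' t" using W(1) unfolding openin_open by metis
  have op: "open {f :: nat \<Rightarrow> 'x. f t \<in> B}" if "open B" for t B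
    using open_vimage[OF that continuous_on_product_coordinates[of t]] by (simp add: vimage_def)
  have "open (\<Inter>t\<in>{..<M}. {f. f t \<in> W' t})" using W' by (intro open_INT ballI op) auto
  moreover have "f \<in> (\<Inter>t\<in>{..<M}. {f. f t \<in> W' t})" using w W' unfolding f_def by auto
  ultimately obtain f' where f': "f' \<in> E" "f' \<in> (\<Inter>t\<in>{..<M}. {f. f t \<in> W' t})"
    using \<open>f \<in> D\<close> open_Int_closure_eq_empty[of "\<Inter>t\<in>{..<M}. {f. f t \<in> W' t}" E] unfolding D_def by blast
  then obtain g where g: "\<And>t. t < M \<Longrightarrow> act (- g) (f' t) \<in> U t" and f'X: "\<And>i. f' i \<in> X" unfolding E_def by blast
  have "\<exists>x\<in>U t. act g x \<in> W t" if "t < M" for t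
  proof (rule bexI[OF _ g[OF that]])
    show "act g (act (- g) (f' t)) \<in> W t"
      using G_system_uminus'[OF sys f'X[of t]] f'(2) f'X[of t] W'[OF that] that by simp
  qed
  then show ?thesis by blast
qed

text \<open>Finitely many translates of a small ball cover \<open>X\<close>, so finitely many
  translates of the image of its closed version cover \<open>H\<close>. If that compact image had
  empty interior, the translates could be avoided one after the other on smaller nonempty open sets,
  leaving a point that none of them covers.\<close>

lemma factor_open_subset:
  fixes act :: "'g::ab_group_add \<Rightarrow> 'x::metric_space \<Rightarrow> 'x" and p :: "'x \<Rightarrow> 'h::metric_space"
  assumes sys: "G_system X act" and min: "minimal_system X act" and sysH: "G_system H actH"
    and p: "continuous_on X p" "p ` X = H" "\<And>g x. x \<in> X \<Longrightarrow> p (act g x) = actH g (p x)"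
    and O: "openin (top_of_set X) O'" "O' \<noteq> {}"
  obtains Q where "openin (top_of_set H) Q" "Q \<noteq> {}" "Q \<subseteq> p ` O'"
proof -
  obtain T where T: "open T" "O' = X \<inter> T" using O(1) by (auto simp: openin_open)
  obtain z where z: "z \<in> X" "z \<in> T" using T(2) O(2) by auto
  obtain e where e: "e > 0" "cball z e \<subseteq> T" using T(1) z(2) open_contains_cball by blast
  have ne: "X \<inter> ball z e \<noteq> {}" using z e(1) by auto
  have op: "openin (top_of_set X) (X \<inter> ball z e)" by (simp add: openin_open_Int)
  \<comment> \<open>The open ball yields the cover by translates; the closed one has a compact
    image, whose complement is open.\<close>
  define B where "B = X \<inter> cball z e"
  have cB: "compact B" unfolding B_def by (intro compact_Int_closed G_system_compact[OF sys] closed_cball)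
  have cpB: "compact (p ` B)"
    by (rule compact_continuous_image[OF continuous_on_subset[OF p(1)] cB]) (auto simp: B_def)
  have cov: "\<exists>g. act g x \<in> ball z e" if x: "x \<in> X" for x
  proof -
    obtain g where "act g x \<in> X \<inter> ball z e" by (rule minimal_system_open[OF min sys x op ne])
    then show ?thesis by blast
  qed
  have "\<exists>N. open N \<and> X \<inter> act g -` ball z e = X \<inter> N" for g
    using continuous_openin_preimage_gen[OF G_system_continuous[OF sys] open_ball, of g z e]
    unfolding openin_open by simp
  then obtain N where N: "\<And>g. open (N g)" "\<And>g. X \<inter> act g -` ball z e = X \<inter> N g" by metis
  have "X \<subseteq> (\<Union>g\<in>UNIV. N g)"
  proof
    fix x assume x: "x \<in> X"
    obtain g where "act g x \<in> ball z e" using cov[OF x] by (elim exE)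
    then have "x \<in> X \<inter> N g" unfolding N(2)[symmetric] using x by simp
    then show "x \<in> (\<Union>g\<in>UNIV. N g)" by blast
  qed
  then obtain I where I: "finite I" "X \<subseteq> (\<Union>g\<in>I. N g)"
    by (rule compactE_image[OF G_system_compact[OF sys] N(1)])
  have HI: "\<exists>g\<in>I. actH g y \<in> p ` B" if y: "y \<in> H" for y
  proof -
    obtain x where x: "x \<in> X" "p x = y" using y p(2) by auto
    obtain g where g: "g \<in> I" "x \<in> N g" using I(2) x(1) by auto
    then have "x \<in> X \<inter> act g -` ball z e" unfolding N(2) using x(1) by simp
    then have "act g x \<in> B" unfolding B_def using G_system_in[OF sys x(1)] by simp
    then have "p (act g x) \<in> p ` B" by (rule imageI)
    then show ?thesis using g(1) p(3)[OF x(1)] x(2) by auto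
  qed
  define Z where "Z = {Q. openin (top_of_set H) Q \<and> Q \<subseteq> p ` B}"
  have "\<exists>Q\<in>Z. Q \<noteq> {}"
  proof (rule ccontr)
    assume "\<not> ?thesis"
    then have nd: "Q = {}" if "openin (top_of_set H) Q" "Q \<subseteq> p ` B" for Q
      using that unfolding Z_def by blast
    have "\<exists>Q. openin (top_of_set H) Q \<and> Q \<noteq> {} \<and> (\<forall>y\<in>Q. \<forall>g\<in>J. actH g y \<notin> p ` B)" if "finite J" for J
      using that
    proof (induction J)
      case empty
      have "H \<noteq> {}" using z(1) p(2) by auto
      then show ?case by (intro exI[of _ H]) simp
    next
      case (insert g J)
      then obtain Q where Q: "openin (top_of_set H) Q" "Q \<noteq> {}" "\<forall>y\<in>Q. \<forall>g\<in>J. actH g y \<notin> p ` B" by blast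
      have QH: "Q \<subseteq> H" using Q(1) by (rule openin_imp_subset)
      have "openin (top_of_set H) (H \<inter> actH g -` (- (p ` B)))"
        by (intro continuous_openin_preimage_gen G_system_continuous[OF sysH] open_Compl compact_imp_closed cpB)
      then have op: "openin (top_of_set H) (Q \<inter> (H \<inter> actH g -` (- (p ` B))))"
        using Q(1) by (rule openin_Int[rotated])
      have gQ: "openin (top_of_set H) (H \<inter> actH (- g) -` Q)"
        by (rule continuous_openin_preimage[OF G_system_continuous[OF sysH] _ Q(1)]) (auto simp: G_system_in[OF sysH])
      have "Q \<inter> (H \<inter> actH g -` (- (p ` B))) \<noteq> {}"
      proof
        assume "Q \<inter> (H \<inter> actH g -` (- (p ` B))) = {}"
        then have all: "actH g y \<in> p ` B" if "y \<in> Q" for y using that QH by blast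
        have "H \<inter> actH (- g) -` Q \<subseteq> p ` B"
        proof
          fix y assume y: "y \<in> H \<inter> actH (- g) -` Q"
          then have "actH g (actH (- g) y) \<in> p ` B" using all by blast
          then show "y \<in> p ` B" using G_system_uminus'[OF sysH, of y g] y by simp
        qed
        then have emp: "H \<inter> actH (- g) -` Q = {}" by (rule nd[OF gQ])
        obtain y where y: "y \<in> Q" using Q(2) by blast
        then have yH: "y \<in> H" using QH by blast
        have "actH g y \<in> H \<inter> actH (- g) -` Q"
          using G_system_in[OF sysH yH] G_system_uminus[OF sysH yH] y by simp
        then show False using emp by blast
      qed
      then show ?case using op Q(3) by (intro exI[of _ "Q \<inter> (H \<inter> actH g -` (- (p ` B)))"]) auto
    qed
    from this[OF I(1)] obtain Q where Q: "openin (top_of_set H) Q" "Q \<noteq> {}" "\<forall>y\<in>Q. \<forall>g\<in>I. actH g y \<notin> p ` B"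
      by blast
    then obtain y where "y \<in> Q" by blast
    then show False using HI[of y] Q(3) openin_imp_subset[OF Q(1)] by blast
  qed
  then obtain Q where Q: "openin (top_of_set H) Q" "Q \<noteq> {}" "Q \<subseteq> p ` B" unfolding Z_def by blast
  moreover have "B \<subseteq> O'" unfolding B_def T(2) using e(2) by blast
  ultimately show ?thesis by (intro that[of Q]) auto
qed

text \<open>Keeping only the points of \<open>O'\<close> over an open set contained in its image
  makes the image itself open, as \<open>simultaneous_hitting\<close> asks.\<close>

lemma factor_open_image_subset:
  fixes act :: "'g::ab_group_add \<Rightarrow> 'x::metric_space \<Rightarrow> 'x" and p :: "'x \<Rightarrow> 'h::metric_space"
  assumes sys: "G_system X act" and min: "minimal_system X act" and sysH: "G_system H actH"
    and p: "continuous_on X p" "p ` X = H" "\<And>g x. x \<in> X \<Longrightarrow> p (act g x) = actH g (p x)"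
    and O: "openin (top_of_set X) O'" "O' \<noteq> {}"
  obtains U where "openin (top_of_set X) U" "U \<noteq> {}" "U \<subseteq> O'" "openin (top_of_set H) (p ` U)"
proof -
  obtain Q where Q: "openin (top_of_set H) Q" "Q \<noteq> {}" "Q \<subseteq> p ` O'"
    by (rule factor_open_subset[where act = act and actH = actH and p = p and X = X and H = H, OF sys min sysH p O])
  have O'X: "O' \<subseteq> X" using O(1) by (rule openin_imp_subset)
  define U where "U = O' \<inter> (X \<inter> p -` Q)"
  have "openin (top_of_set X) (X \<inter> p -` Q)"
    by (rule continuous_openin_preimage[OF p(1) _ Q(1)]) (rule Pi_I, unfold p(2)[symmetric], rule imageI)
  then have "openin (top_of_set X) U" unfolding U_def by (rule openin_Int[OF O(1)])
  moreover have pU: "p ` U = Q"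
  proof
    show "p ` U \<subseteq> Q" unfolding U_def by blast
    show "Q \<subseteq> p ` U"
    proof
      fix y assume y: "y \<in> Q"
      then obtain x where "x \<in> O'" "y = p x" using Q(3) by auto
      then have "x \<in> U" unfolding U_def using O'X y by blast
      then show "y \<in> p ` U" using \<open>y = p x\<close> by simp
    qed
  qed
  moreover have "U \<noteq> {}"
  proof
    assume "U = {}"
    then have "p ` U = {}" by simp
    then show False using pU Q(2) by simp
  qed
  moreover have "U \<subseteq> O'" unfolding U_def by blast
  moreover have "openin (top_of_set H) (p ` U)" unfolding pU by (rule Q(1))
  ultimately show ?thesis by (intro that[of U])
qed

text \<open>Positions are lifted one at a time. At position \<open>j\<close> the element
  \<open>h j\<close> is right in the base for all patterns, and a single correction
  \<open>q\<close>, applied before it, makes it right in \<open>X\<close>. The open sets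
  \<open>O' n\<close> shrink on the way but stay over \<open>R n\<close>, so the base keeps
  guaranteeing the later positions.\<close>

lemma independence_from_base:
  fixes act :: "'g::ab_group_add \<Rightarrow> 'x::metric_space \<Rightarrow> 'x" and p :: "'x \<Rightarrow> 'h::metric_space"
    and \<tau> :: "nat \<Rightarrow> nat \<Rightarrow> nat"
  assumes sys: "G_system X act" and min: "minimal_system X act" and ne: "X \<noteq> {}" and sysH: "G_system H actH"
    and p: "continuous_on X p" "p ` X = H" "\<And>g x. x \<in> X \<Longrightarrow> p (act g x) = actH g (p x)"
    and pS: "\<And>x y. x \<in> X \<Longrightarrow> y \<in> X \<Longrightarrow> p x = p y \<Longrightarrow> (x, y) \<in> S_eq X act"
    and U: "\<And>i. openin (top_of_set X) (U i)"
    and Q: "\<And>i. openin (top_of_set H) (Q i)" "\<And>i. Q i \<subseteq> p ` U i"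
    and e: "\<And>n. n < M \<Longrightarrow> e n \<in> H" "\<And>n j. n < M \<Longrightarrow> j < L \<Longrightarrow> actH (h j) (e n) \<in> Q (\<tau> n j)"
  shows "\<exists>g. \<forall>n<M. \<exists>x\<in>X. \<forall>j<L. act (g j) x \<in> U (\<tau> n j)"
proof -
  define R where "R n = {y \<in> H. \<forall>j<L. actH (h j) y \<in> Q (\<tau> n j)}" for n
  have Ro: "openin (top_of_set H) (R n)" for n
  proof -
    have op: "openin (top_of_set H) (H \<inter> actH (h j) -` Q (\<tau> n j))" for j
      by (rule continuous_openin_preimage[OF G_system_continuous[OF sysH] _ Q(1)])
        (simp add: G_system_in[OF sysH])
    have "openin (top_of_set H) (H \<inter> (\<Inter>j\<in>{..<L}. H \<inter> actH (h j) -` Q (\<tau> n j)))"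
      using op by (intro openin_Int_Inter) auto
    moreover have "H \<inter> (\<Inter>j\<in>{..<L}. H \<inter> actH (h j) -` Q (\<tau> n j)) = R n" unfolding R_def by auto
    ultimately show ?thesis by simp
  qed
  have "\<exists>g O'. \<forall>n<M. openin (top_of_set X) (O' n) \<and> O' n \<noteq> {} \<and> p ` O' n \<subseteq> R n \<and>
      (\<forall>i<j. \<forall>x\<in>O' n. act (g i) x \<in> U (\<tau> n i))" if "j \<le> L" for j
    using that
  proof (induction j)
    case 0
    have "openin (top_of_set X) (X \<inter> p -` R n) \<and> X \<inter> p -` R n \<noteq> {} \<and> p ` (X \<inter> p -` R n) \<subseteq> R n" if n: "n < M" for n
    proof (intro conjI)
      show "openin (top_of_set X) (X \<inter> p -` R n)"
        by (rule continuous_openin_preimage[OF p(1) _ Ro]) (rule Pi_I, unfold p(2)[symmetric], rule imageI)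
      have "e n \<in> R n" using e n unfolding R_def by blast
      moreover have "e n \<in> p ` X" using e(1)[OF n] p(2) by simp
      ultimately show "X \<inter> p -` R n \<noteq> {}" by auto
    qed auto
    then show ?case by (intro exI[of _ "\<lambda>i. 0"] exI[of _ "\<lambda>n. X \<inter> p -` R n"]) simp
  next
    case (Suc j)
    then obtain g O1 where O1: "\<And>n. n < M \<Longrightarrow> openin (top_of_set X) (O1 n)" "\<And>n. n < M \<Longrightarrow> O1 n \<noteq> {}"
      "\<And>n. n < M \<Longrightarrow> p ` O1 n \<subseteq> R n" "\<And>n i x. n < M \<Longrightarrow> i < j \<Longrightarrow> x \<in> O1 n \<Longrightarrow> act (g i) x \<in> U (\<tau> n i)"
      by (metis Suc_leD)
    have "\<exists>V. openin (top_of_set X) V \<and> V \<noteq> {} \<and> V \<subseteq> O1 n \<and> openin (top_of_set H) (p ` V)" if n: "n < M" for n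
    proof -
      obtain V where "openin (top_of_set X) V" "V \<noteq> {}" "V \<subseteq> O1 n" "openin (top_of_set H) (p ` V)"
        by (rule factor_open_image_subset[where act = act and actH = actH and p = p and X = X and H = H, OF sys min sysH p O1(1)[OF n] O1(2)[OF n]])
      then show ?thesis by (intro exI[of _ V] conjI)
    qed
    then obtain V where V: "\<And>n. n < M \<Longrightarrow> openin (top_of_set X) (V n)" "\<And>n. n < M \<Longrightarrow> V n \<noteq> {}"
      "\<And>n. n < M \<Longrightarrow> V n \<subseteq> O1 n" "\<And>n. n < M \<Longrightarrow> openin (top_of_set H) (p ` V n)" by metis
    \<comment> \<open>If \<open>q\<close> moves a point of \<open>V n\<close> into
      \<open>W n\<close>, then \<open>h j + q\<close> moves it into the target. The hitting lemma
      wants a point of \<open>W n\<close> over the image of \<open>V n\<close>: a target point over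
      \<open>actH (h j) (p v)\<close> is pulled back by \<open>h j\<close>.\<close>
    define W where "W n = X \<inter> act (h j) -` U (\<tau> n j)" for n
    have Wo: "openin (top_of_set X) (W n)" for n unfolding W_def
      by (rule continuous_openin_preimage[OF G_system_continuous[OF sys] _ U]) (auto simp: G_system_in[OF sys])
    have VX: "V n \<subseteq> X" if "n < M" for n using V(1)[OF that] by (rule openin_imp_subset)
    have UX: "U i \<subseteq> X" for i using U by (rule openin_imp_subset)
    have "\<exists>w\<in>W n. p w \<in> p ` V n" if n: "n < M" for n
    proof -
      obtain v where v: "v \<in> V n" using V(2)[OF n] by blast
      have "p v \<in> R n" using v V(3)[OF n] O1(3)[OF n] by blast
      then have "actH (h j) (p v) \<in> Q (\<tau> n j)" using Suc.prems unfolding R_def by simp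
      then have "actH (h j) (p v) \<in> p ` U (\<tau> n j)" using Q(2) by blast
      then obtain u where u: "u \<in> U (\<tau> n j)" "p u = actH (h j) (p v)" by auto
      have vX: "v \<in> X" and uX: "u \<in> X" using v VX[OF n] u(1) UX by blast+
      have "p (act (- h j) u) = p v"
        using p(3)[OF uX] u(2) G_system_uminus[OF sysH, of "p v" "h j"] p(2) vX by auto
      moreover have "act (- h j) u \<in> W n"
        unfolding W_def using G_system_in[OF sys uX] G_system_uminus'[OF sys uX] u(1) by simp
      ultimately show ?thesis using v by (intro bexI[of _ "act (- h j) u"]) auto
    qed
    then obtain q where q: "\<forall>n<M. \<exists>x\<in>V n. act q x \<in> W n"
      using simultaneous_hitting[OF sys min ne p(1) pS, of M V W] V(1,4) Wo unfolding p(2) by blast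
    define g' where "g' = g(j := h j + q)"
    define O2 where "O2 n = V n \<inter> (X \<inter> act q -` W n)" for n
    have "openin (top_of_set X) (O2 n) \<and> O2 n \<noteq> {} \<and> p ` O2 n \<subseteq> R n \<and>
      (\<forall>i<Suc j. \<forall>x\<in>O2 n. act (g' i) x \<in> U (\<tau> n i))" if n: "n < M" for n
    proof (intro conjI allI impI ballI)
      show "openin (top_of_set X) (O2 n)" unfolding O2_def
        by (intro openin_Int V(1)[OF n] continuous_openin_preimage[OF G_system_continuous[OF sys] _ Wo])
          (auto simp: G_system_in[OF sys])
      show "O2 n \<noteq> {}" using q n VX[OF n] unfolding O2_def by blast
      show "p ` O2 n \<subseteq> R n" using V(3)[OF n] O1(3)[OF n] unfolding O2_def by blast
      fix i x assume i: "i < Suc j" and x: "x \<in> O2 n"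
      show "act (g' i) x \<in> U (\<tau> n i)"
      proof (cases "i = j")
        case True
        have "x \<in> X" "act q x \<in> W n" using x VX[OF n] unfolding O2_def by auto
        then show ?thesis using True G_system_plus[OF sys, of x "h j" q] unfolding g'_def W_def by simp
      next
        case False
        then show ?thesis using i x V(3)[OF n] O1(4)[OF n, of i x] unfolding g'_def O2_def by auto
      qed
    qed
    then show ?case by (intro exI[of _ g'] exI[of _ O2]) simp
  qed
  from this[OF order_refl] obtain g O' where all: "\<forall>n<M. openin (top_of_set X) (O' n) \<and> O' n \<noteq> {} \<and> p ` O' n \<subseteq> R n \<and>
      (\<forall>i<L. \<forall>x\<in>O' n. act (g i) x \<in> U (\<tau> n i))" by (elim exE)
  have O': "\<And>n. n < M \<Longrightarrow> openin (top_of_set X) (O' n)" "\<And>n. n < M \<Longrightarrow> O' n \<noteq> {}"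
    "\<And>n i x. n < M \<Longrightarrow> i < L \<Longrightarrow> x \<in> O' n \<Longrightarrow> act (g i) x \<in> U (\<tau> n i)" using all by auto
  have "\<exists>x\<in>X. \<forall>j<L. act (g j) x \<in> U (\<tau> n j)" if n: "n < M" for n
  proof -
    obtain x where x: "x \<in> O' n" using O'(2)[OF n] by blast
    then have "x \<in> X" using openin_imp_subset[OF O'(1)[OF n]] by blast
    then show ?thesis using O'(3)[OF n _ x] by blast
  qed
  then show ?thesis by blast
qed

section \<open>Lower bound for sequence entropy\<close>

lemma finite_join_cover: "finite U \<Longrightarrow> finite (join_cover X act A U n)"
proof -
  assume U: "finite U"
  have "join_cover X act A U n \<subseteq> (\<lambda>f. X \<inter> (\<Inter>i\<in>{1..n}. act (A i) -` f i)) ` PiE {1..n} (\<lambda>_. U)"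
  proof
    fix w assume "w \<in> join_cover X act A U n"
    then obtain f where f: "w = X \<inter> (\<Inter>i\<in>{1..n}. act (A i) -` f i)" "\<forall>i\<in>{1..n}. f i \<in> U"
      unfolding join_cover_def by blast
    have "w = X \<inter> (\<Inter>i\<in>{1..n}. act (A i) -` restrict f {1..n} i)" unfolding f(1) by simp
    moreover have "restrict f {1..n} \<in> PiE {1..n} (\<lambda>_. U)" using f(2) by auto
    ultimately show "w \<in> (\<lambda>f. X \<inter> (\<Inter>i\<in>{1..n}. act (A i) -` f i)) ` PiE {1..n} (\<lambda>_. U)"
      by (rule image_eqI)
  qed
  then show ?thesis using U by (meson finite_PiE finite_atLeastAtMost finite_imageI finite_subset)
qed

lemma join_cover_covers:
  assumes "X \<subseteq> \<Union>U" "\<And>g x. x \<in> X \<Longrightarrow> act g x \<in> X"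
  shows "X \<subseteq> \<Union>(join_cover X act A U n)"
proof
  fix x assume x: "x \<in> X"
  then have "\<exists>u\<in>U. act (A i) x \<in> u" for i using assms by blast
  then obtain f where f: "\<And>i. f i \<in> U" "\<And>i. act (A i) x \<in> f i" by metis
  then have "X \<inter> (\<Inter>i\<in>{1..n}. act (A i) -` f i) \<in> join_cover X act A U n"
    unfolding join_cover_def by blast
  moreover have "x \<in> X \<inter> (\<Inter>i\<in>{1..n}. act (A i) -` f i)" using x f(2) by simp
  ultimately show "x \<in> \<Union>(join_cover X act A U n)" by blast
qed

lemma Ncov_witness:
  assumes "finite V" "X \<subseteq> \<Union>V"
  obtains W where "W \<subseteq> V" "finite W" "X \<subseteq> \<Union>W" "card W = Ncov X V"
proof -
  have "\<exists>k. \<exists>W\<subseteq>V. finite W \<and> X \<subseteq> \<Union>W \<and> card W = k" using assms by blast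
  then have "\<exists>W\<subseteq>V. finite W \<and> X \<subseteq> \<Union>W \<and> card W = Ncov X V" unfolding Ncov_def by (rule LeastI_ex)
  then show ?thesis using that by auto
qed

text \<open>A cell of the join selects one member of \<open>U\<close> at each position in
  \<open>J\<close>, and that member meets at most one of the sets \<open>U' i\<close>; hence no cell
  serves two patterns.\<close>

lemma Ncov_join_cover_ge_independent:
  fixes U' :: "nat \<Rightarrow> 'x set"
  assumes "finite U" "X \<subseteq> \<Union>U" "\<And>g x. x \<in> X \<Longrightarrow> act g x \<in> X"
    and sep: "\<And>u i j. u \<in> U \<Longrightarrow> i < k \<Longrightarrow> j < k \<Longrightarrow> u \<inter> U' i \<noteq> {} \<Longrightarrow> u \<inter> U' j \<noteq> {} \<Longrightarrow> i = j"
    and J: "J \<subseteq> {1..n}" "finite J"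
    and ind: "\<And>t. t \<in> PiE J (\<lambda>_. {..<k}) \<Longrightarrow> \<exists>x\<in>X. \<forall>j\<in>J. act (A j) x \<in> U' (t j)"
  shows "k ^ card J \<le> Ncov X (join_cover X act A U n)"
proof -
  obtain W where W: "W \<subseteq> join_cover X act A U n" "finite W" "X \<subseteq> \<Union>W" "card W = Ncov X (join_cover X act A U n)"
    by (rule Ncov_witness[OF finite_join_cover[OF assms(1)] join_cover_covers[OF assms(2,3)]])
  have "\<exists>w\<in>W. \<exists>x\<in>w. \<forall>j\<in>J. act (A j) x \<in> U' (t j)" if t: "t \<in> PiE J (\<lambda>_. {..<k})" for t
  proof -
    obtain x where x: "x \<in> X" "\<forall>j\<in>J. act (A j) x \<in> U' (t j)" using ind[OF t] by (elim bexE)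
    obtain w where "w \<in> W" "x \<in> w" using W(3) x(1) by blast
    then show ?thesis using x(2) by (intro bexI[of _ w] bexI[of _ x])
  qed
  then have "\<forall>t\<in>PiE J (\<lambda>_. {..<k}). \<exists>w. w \<in> W \<and> (\<exists>x\<in>w. \<forall>j\<in>J. act (A j) x \<in> U' (t j))" by (simp add: Bex_def)
  then obtain w where w0: "\<forall>t\<in>PiE J (\<lambda>_. {..<k}). w t \<in> W \<and> (\<exists>x\<in>w t. \<forall>j\<in>J. act (A j) x \<in> U' (t j))"
    unfolding bchoice_iff by (elim exE)
  note w = bspec[OF w0]
  have "inj_on w (PiE J (\<lambda>_. {..<k}))"
  proof (rule inj_onI)
    fix s t assume st: "s \<in> PiE J (\<lambda>_. {..<k})" "t \<in> PiE J (\<lambda>_. {..<k})" "w s = w t"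
    obtain f where f: "w s = X \<inter> (\<Inter>i\<in>{1..n}. act (A i) -` f i)" "\<forall>i\<in>{1..n}. f i \<in> U"
    proof -
      have "w s \<in> join_cover X act A U n" using w[OF st(1)] W(1) by (elim conjE) (rule subsetD)
      then show thesis using that unfolding join_cover_def by auto
    qed
    obtain x where x: "x \<in> w s" "\<forall>j\<in>J. act (A j) x \<in> U' (s j)" using w[OF st(1)] by (elim conjE bexE)
    obtain y where y: "y \<in> w s" "\<forall>j\<in>J. act (A j) y \<in> U' (t j)" using w[OF st(2)] unfolding st(3) by (elim conjE bexE)
    have "s j = t j" if j: "j \<in> J" for j
    proof (rule sep)
      show "f j \<in> U" using f(2) j J(1) by blast
      show "s j < k" "t j < k" using st j by (auto simp: PiE_iff)
      have "act (A j) x \<in> f j" "act (A j) y \<in> f j" using x(1) y(1) j J(1) unfolding f(1) by auto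
      then show "f j \<inter> U' (s j) \<noteq> {}" "f j \<inter> U' (t j) \<noteq> {}" using x(2) y(2) j by blast+
    qed
    then show "s = t" using st by (intro PiE_ext) auto
  qed
  moreover have "w ` PiE J (\<lambda>_. {..<k}) \<subseteq> W" using w by (intro image_subsetI) (rule conjunct1)
  ultimately have "card (PiE J (\<lambda>_. {..<k})) \<le> card W" using W(2) by (rule card_inj_on_le)
  then show ?thesis using W(4) J(2) by (simp add: card_PiE)
qed

text \<open>Independent blocks are placed at the positions \<open>fact m < n \<le> fact (Suc m)\<close>; each block is so long
  that the preceding positions do not matter in the limit.\<close>
lemma sup_seq_entropy_ge:
  fixes U' :: "nat \<Rightarrow> 'x::metric_space set" and act :: "'g \<Rightarrow> 'x \<Rightarrow> 'x"
  assumes k: "k \<ge> 1" and actX: "\<And>g x. x \<in> X \<Longrightarrow> act g x \<in> X"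
    and disj: "\<And>i j. i < k \<Longrightarrow> j < k \<Longrightarrow> i \<noteq> j \<Longrightarrow> closure (U' i) \<inter> closure (U' j) = {}"
    and ind: "\<And>L. \<exists>g :: nat \<Rightarrow> 'g. \<forall>t. \<exists>x\<in>X. \<forall>j<L. t j < k \<longrightarrow> act (g j) x \<in> U' (t j)"
  shows "ereal (ln (real k)) \<le> sup_seq_entropy X act"
proof -
  obtain G :: "nat \<Rightarrow> nat \<Rightarrow> 'g" where G: "\<And>L t. \<exists>x\<in>X. \<forall>j<L. t j < k \<longrightarrow> act (G L j) x \<in> U' (t j)"
    using ind by metis
  define blk where "blk n = (LEAST m. n \<le> fact (Suc m))" for n :: nat
  \<comment> \<open>For \<open>n\<close> in block m the length is \<open>fact (Suc m) + 1\<close>: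
    independence counts positions from 0, and the last position \<open>fact (Suc m)\<close> has to
    be included.\<close>
  define A where "A n = G (Suc (fact (Suc (blk n)))) n" for n :: nat
  have blk: "blk n = m" if "n \<in> {fact m<..fact (Suc m)}" for n m :: nat
    unfolding blk_def
  proof (rule Least_equality)
    show "n \<le> fact (Suc m)" using that by simp
    fix y assume y: "n \<le> fact (Suc y)"
    show "m \<le> y"
    proof (rule ccontr)
      assume "\<not> m \<le> y"
      then have "fact (Suc y) \<le> (fact m :: nat)" by (intro fact_mono) simp
      then show False using y that by simp
    qed
  qed
  \<comment> \<open>Among the \<open>k\<close> sets, \<open>W j\<close> can meet only the
    \<open>j\<close>-th. These sets cover \<open>X\<close> because a point lies in at most one of
    the closures.\<close>
  define W where "W j = X \<inter> - (\<Union>i\<in>{..<k} - {j}. closure (U' i))" for j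
  define U where "U = W ` {..<k}"
  have Uo: "U \<in> open_covers X" unfolding open_covers_def
  proof (intro CollectI conjI ballI)
    show "finite U" unfolding U_def by simp
    show "openin (top_of_set X) u" if u: "u \<in> U" for u
    proof -
      obtain j where "u = W j" using u unfolding U_def by blast
      moreover have "open (- (\<Union>i\<in>{..<k} - {j}. closure (U' i)))" by (intro open_Compl closed_UN) auto
      ultimately show ?thesis unfolding W_def by (simp add: openin_open_Int)
    qed
    show "X \<subseteq> \<Union>U"
    proof
      fix x assume x: "x \<in> X"
      show "x \<in> \<Union>U"
      proof (cases "\<exists>i<k. x \<in> closure (U' i)")
        case True
        then obtain i where i: "i < k" "x \<in> closure (U' i)" by blast
        have "x \<notin> closure (U' j)" if "j < k" "j \<noteq> i" for j using disj[OF that(1) i(1) that(2)] i(2) by blast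
        then have "x \<in> W i" unfolding W_def using x by blast
        then show ?thesis unfolding U_def using i(1) by blast
      next
        case False
        then have "x \<in> W 0" unfolding W_def using x by blast
        moreover have "W 0 \<in> U" unfolding U_def using k by (intro imageI) simp
        ultimately show ?thesis by blast
      qed
    qed
  qed
  have sep: "i = j" if u: "u \<in> U" "i < k" "j < k" "u \<inter> U' i \<noteq> {}" "u \<inter> U' j \<noteq> {}" for u i j
  proof -
    obtain l where l: "u = W l" using u(1) unfolding U_def by blast
    have "i' = l" if "i' < k" "u \<inter> U' i' \<noteq> {}" for i'
      using that closure_subset[of "U' i'"] unfolding l W_def by blast
    from this[OF u(2,4)] this[OF u(3,5)] show ?thesis by simp
  qed
  have N: "k ^ (m * fact m) \<le> Ncov X (join_cover X act A U (fact (Suc m)))" for m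
  proof -
    let ?J = "{fact m<..fact (Suc m)} :: nat set"
    \<comment> \<open>The block fills \<open>m * fact m\<close> of the first
      \<open>Suc m * fact m\<close> positions, which is the fraction appearing in the limit.\<close>
    have cJ: "card ?J = m * fact m" by simp
    have "k ^ card ?J \<le> Ncov X (join_cover X act A U (fact (Suc m)))"
    proof (rule Ncov_join_cover_ge_independent[where U' = U', OF _ _ actX sep])
      show "finite U" "X \<subseteq> \<Union>U" using Uo unfolding open_covers_def by auto
      show "?J \<subseteq> {1..fact (Suc m)}" by auto
      show "finite ?J" by simp
      fix t assume t: "t \<in> PiE ?J (\<lambda>_. {..<k})"
      obtain x where x: "x \<in> X" "\<And>j. j < Suc (fact (Suc m)) \<Longrightarrow> t j < k \<Longrightarrow> act (G (Suc (fact (Suc m))) j) x \<in> U' (t j)"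
        using G by blast
      have "act (A j) x \<in> U' (t j)" if j: "j \<in> ?J" for j
      proof -
        have "t j < k" using t j by (auto simp: PiE_iff)
        moreover have "j < Suc (fact (Suc m))" using j by simp
        ultimately show ?thesis using x(2)[of j] unfolding A_def blk[OF j] by simp
      qed
      then show "\<exists>x\<in>X. \<forall>j\<in>?J. act (A j) x \<in> U' (t j)" using x(1) by blast
    qed
    then show ?thesis unfolding cJ .
  qed
  define a where "a n = ereal (ln (real (Ncov X (join_cover X act A U n))) / real n)" for n
  have "ereal (real m / real (Suc m) * ln (real k)) \<le> a (fact (Suc m))" for m
  proof -
    have "real m * fact m * ln (real k) = ln (real (k ^ (m * fact m)))" using k by (simp add: ln_realpow)
    also have "\<dots> \<le> ln (real (Ncov X (join_cover X act A U (fact (Suc m)))))"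
    proof -
      have "0 < real (k ^ (m * fact m))" using k by simp
      moreover have "real (k ^ (m * fact m)) \<le> real (Ncov X (join_cover X act A U (fact (Suc m))))"
        using N[of m] by (simp only: of_nat_le_iff)
      ultimately show ?thesis by (simp only: ln_mono)
    qed
    finally have le: "real m * fact m * ln (real k) \<le> ln (real (Ncov X (join_cover X act A U (fact (Suc m)))))" .
    have f: "real (fact (Suc m)) = real (Suc m) * fact m" by (simp add: distrib_right)
    have "real m / real (Suc m) * ln (real k) = real m * fact m * ln (real k) / real (fact (Suc m))"
      unfolding f by simp
    also have "\<dots> \<le> ln (real (Ncov X (join_cover X act A U (fact (Suc m))))) / real (fact (Suc m))"
      by (rule divide_right_mono[OF le]) simp
    finally show ?thesis unfolding a_def by (simp only: ereal_less_eq)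
  qed
  then have "limsup (\<lambda>m. ereal (real m / real (Suc m) * ln (real k))) \<le> limsup (\<lambda>m. a (fact (Suc m)))"
    by (intro Limsup_mono always_eventually allI)
  moreover have "(\<lambda>m. ereal (real m / real (Suc m) * ln (real k))) \<longlonglongrightarrow> ereal (1 * ln (real k))"
    by (intro tendsto_ereal tendsto_mult LIMSEQ_n_over_Suc_n tendsto_const)
  then have "(\<lambda>m. ereal (real m / real (Suc m) * ln (real k))) \<longlonglongrightarrow> ereal (ln (real k))" by simp
  then have "limsup (\<lambda>m. ereal (real m / real (Suc m) * ln (real k))) = ereal (ln (real k))"
    by (rule lim_imp_Limsup[OF sequentially_bot])
  moreover have "limsup (\<lambda>m. a (fact (Suc m))) \<le> limsup a"
  proof -
    \<comment> \<open>The subsequence starts at \<open>fact 1\<close>, since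
      \<open>fact 0 = fact 1\<close> would break strict monotonicity.\<close>
    have "strict_mono (\<lambda>m. fact (Suc m) :: nat)" by (intro strict_monoI_Suc fact_less_mono) auto
    then show ?thesis using limsup_subseq_mono[of "\<lambda>m. fact (Suc m)" a] by (simp add: comp_def)
  qed
  ultimately have "ereal (ln (real k)) \<le> limsup a" by simp
  also have "\<dots> = seq_entropy_cover X act A U" unfolding seq_entropy_cover_def a_def ..
  also have "\<dots> \<le> seq_entropy X act A" unfolding seq_entropy_def by (rule SUP_upper[OF Uo])
  also have "\<dots> \<le> sup_seq_entropy X act" unfolding sup_seq_entropy_def by (rule SUP_upper) simp
  finally show ?thesis .
qed

section \<open>Perturbation of patterns in the equicontinuous factor\<close>

text \<open>As G is abelian, \<open>actH g\<close> carries the pair of \<open>z\<close> and its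
  image under \<open>p\<close> to the corresponding pair for \<open>actH g z\<close>; by
  equicontinuity the displacement is small along the whole orbit of \<open>z\<close>, and the orbit
  is dense.\<close>

lemma minimal_equicontinuous_displacement:
  fixes actH :: "'g::ab_group_add \<Rightarrow> 'h::metric_space \<Rightarrow> 'h"
  assumes sys: "G_system H actH" and min: "minimal_system H actH" and eq: "equicontinuous_system H actH" and e: "e > 0"
  shows "\<exists>\<delta>>0. \<forall>p. \<forall>z\<in>H. \<forall>w\<in>H. dist (actH p z) z < \<delta> \<longrightarrow> dist (actH p w) w < e"
proof -
  have e3: "e / 3 > 0" using e by simp
  obtain d where d: "d > 0" "\<And>x y g. x \<in> H \<Longrightarrow> y \<in> H \<Longrightarrow> dist x y < d \<Longrightarrow> dist (actH g x) (actH g y) < e / 3"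
    using eq e3 unfolding equicontinuous_system_def by meson
  have "dist (actH p w) w < e" if z: "z \<in> H" and w: "w \<in> H" and pz: "dist (actH p z) z < d" for p z w
  proof -
    have m: "min d (e / 3) > 0" using d(1) e3 by simp
    obtain g where g: "dist (actH g z) w < min d (e / 3)" by (rule minimal_system_approx[OF min z w m])
    have gz: "actH g z \<in> H" and pzH: "actH p z \<in> H" using G_system_in[OF sys z] by auto
    have "actH p (actH g z) = actH g (actH p z)"
      using G_system_plus[OF sys z, of p g] G_system_plus[OF sys z, of g p] by (simp add: add.commute)
    then have "dist (actH p (actH g z)) (actH g z) < e / 3" using d(2)[OF pzH z pz] by simp
    moreover have "dist (actH p (actH g z)) (actH p w) < e / 3" using d(2)[OF gz w] g by simp
    moreover have "dist (actH g z) w < e / 3" using g by simp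
    ultimately show ?thesis
      using dist_triangle[of "actH p w" w "actH p (actH g z)"] dist_triangle[of "actH p (actH g z)" w "actH g z"]
      by (simp add: dist_commute)
  qed
  then show ?thesis using d(1) by (intro exI[of _ d]) simp
qed

section \<open>Measurability and small translations for the invariant measure\<close>

context
  fixes H :: "'h::metric_space set" and actH :: "'g::ab_group_add \<Rightarrow> 'h \<Rightarrow> 'h" and \<nu> :: "'h measure"
  assumes sys: "G_system H actH" and inv: "invariant_borel_prob H actH \<nu>"
begin

lemma haar_prob: "prob_space \<nu>" and haar_space: "space \<nu> = H"
  and haar_sets: "sets \<nu> = sets (restrict_space borel H)"
  using inv unfolding invariant_borel_prob_def by auto

lemma haar_borel: "A \<in> sets borel \<Longrightarrow> H \<inter> A \<in> sets \<nu>"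
  unfolding haar_sets by (simp add: sets_restrict_space)

lemma haar_closed: "closed C \<Longrightarrow> C \<subseteq> H \<Longrightarrow> C \<in> sets \<nu>"
  using haar_borel[of C] by (simp add: Int_absorb1)

lemma haar_openin: "openin (top_of_set H) U \<Longrightarrow> U \<in> sets \<nu>"
  unfolding openin_open using haar_borel by auto

lemma haar_vimage: "A \<in> sets \<nu> \<Longrightarrow> actH g -` A \<inter> H \<in> sets \<nu>"
proof -
  assume A: "A \<in> sets \<nu>"
  have "actH g \<in> measurable (restrict_space borel H) (restrict_space borel H)"
    using borel_measurable_continuous_on_restrict[OF G_system_continuous[OF sys, of g]] G_system_in[OF sys]
    by (intro measurable_restrict_space2) (auto simp: space_restrict_space)
  then have "actH g \<in> measurable \<nu> \<nu>" using measurable_cong_sets[OF haar_sets haar_sets] by blast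
  from measurable_sets[OF this A] show ?thesis by (simp add: haar_space)
qed

lemma haar_measure_vimage: "A \<in> sets \<nu> \<Longrightarrow> measure \<nu> (actH g -` A \<inter> H) = measure \<nu> A"
  using inv unfolding invariant_borel_prob_def measure_def by simp

text \<open>\<open>C\<close> and its preimage have equal measure, and both lie in a neighbourhood of
  \<open>C\<close> of measure below \<open>measure \<nu> C + \<eta>\<close>, because a closed set is
  the decreasing limit of its neighbourhoods. So little of \<open>C\<close> can lie outside the
  preimage.\<close>

lemma haar_small_displacement:
  assumes C: "closed C" "C \<subseteq> H" and \<eta>: "\<eta> > 0"
  shows "\<exists>e>0. \<forall>p. (\<forall>w\<in>H. dist (actH p w) w < e) \<longrightarrow> measure \<nu> (C - (actH p -` C \<inter> H)) < \<eta>"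
proof (cases "C = {}")
  case True
  then show ?thesis using \<eta> by (intro exI[of _ 1]) simp
next
  case ne: False
  interpret prob_space \<nu> by (rule haar_prob)
  define K where "K n = H \<inter> {w. infdist w C < 1 / real (Suc n)}" for n
  have Km: "K n \<in> sets \<nu>" for n unfolding K_def
    by (intro haar_borel borel_open open_Collect_less continuous_intros)
  have "decseq K"
  proof (rule decseq_SucI)
    fix n
    have "1 / real (Suc (Suc n)) \<le> 1 / real (Suc n)" by (intro divide_left_mono) auto
    then show "K (Suc n) \<subseteq> K n" unfolding K_def by (intro Int_mono order_refl Collect_mono) linarith
  qed
  then have "(\<lambda>n. measure \<nu> (K n)) \<longlonglongrightarrow> measure \<nu> (\<Inter>n. K n)"
    using Km by (intro finite_Lim_measure_decseq) auto
  moreover have "(\<Inter>n. K n) = C"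
  proof (intro subset_antisym subsetI)
    fix w assume w: "w \<in> (\<Inter>n. K n)"
    have "infdist w C \<le> 0"
    proof (rule LIMSEQ_le_const[OF LIMSEQ_Suc[OF lim_1_over_n]])
      show "\<exists>N. \<forall>n\<ge>N. infdist w C \<le> 1 / real (Suc n)"
      proof (intro exI allI impI)
        fix n :: nat
        have "w \<in> K n" using w by blast
        then show "infdist w C \<le> 1 / real (Suc n)" unfolding K_def by simp
      qed
    qed
    then have "infdist w C = 0" using infdist_nonneg[of w C] by simp
    then show "w \<in> C" using in_closed_iff_infdist_zero[OF C(1) ne] by simp
  next
    fix w assume "w \<in> C"
    then have "w \<in> H" "infdist w C = 0" using C(2) by auto
    then show "w \<in> (\<Inter>n. K n)" unfolding K_def by simp
  qed
  ultimately have "\<forall>\<^sub>F n in sequentially. measure \<nu> (K n) < measure \<nu> C + \<eta>"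
    using \<eta> by (intro order_tendstoD(2)) auto
  then obtain n where n: "measure \<nu> (K n) < measure \<nu> C + \<eta>" by (auto simp: eventually_sequentially)
  show ?thesis
  proof (intro exI[of _ "1 / real (Suc n)"] conjI allI impI)
    fix p assume p: "\<forall>w\<in>H. dist (actH p w) w < 1 / real (Suc n)"
    let ?D = "actH p -` C \<inter> H"
    have Cm: "C \<in> sets \<nu>" by (rule haar_closed[OF C])
    have Dm: "?D \<in> sets \<nu>" by (rule haar_vimage[OF Cm])
    have sub: "C \<union> ?D \<subseteq> K n"
    proof
      fix w assume w: "w \<in> C \<union> ?D"
      then have wH: "w \<in> H" using C(2) by blast
      show "w \<in> K n"
      proof (cases "w \<in> C")
        case True
        then show ?thesis unfolding K_def using wH by simp
      next
        case False
        then have "actH p w \<in> C" using w by blast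
        then have "infdist w C \<le> dist w (actH p w)" by (rule infdist_le)
        then show ?thesis unfolding K_def using wH bspec[OF p wH] by (simp add: dist_commute)
      qed
    qed
    have "measure \<nu> ((C - ?D) \<union> ?D) = measure \<nu> (C - ?D) + measure \<nu> ?D"
      using Cm Dm by (intro finite_measure_Union) auto
    moreover have "measure \<nu> ((C - ?D) \<union> ?D) \<le> measure \<nu> (K n)"
      using sub by (intro finite_measure_mono Km) auto
    ultimately show "measure \<nu> (C - ?D) < \<eta>" using n haar_measure_vimage[OF Cm, of p] by simp
  qed simp
qed

end

text \<open>The translations \<open>h\<close> are perturbed once per pattern, so slightly that the earlier patterns survive
  (they are open conditions) and the intersection of the translates of \<open>C\<close> keeps positive measure.\<close>
lemma realize_patterns_in_base:
  fixes actH :: "'g::ab_group_add \<Rightarrow> 'h::metric_space \<Rightarrow> 'h" and \<tau> :: "nat \<Rightarrow> nat \<Rightarrow> nat"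
  assumes sys: "G_system H actH" and min: "minimal_system H actH" and eq: "equicontinuous_system H actH"
    and inv: "invariant_borel_prob H actH \<nu>"
    and Q: "\<And>i. openin (top_of_set H) (Q i)" and C: "closed C" "\<And>i. C \<subseteq> closure (Q i)" "C \<subseteq> H" "0 < measure \<nu> C"
  shows "\<exists>h e. \<forall>n<M. e n \<in> H \<and> (\<forall>j<L. actH (h j) (e n) \<in> Q (\<tau> n j))"
proof -
  interpret prob_space \<nu> by (rule haar_prob[OF sys inv])
  have spc: "space \<nu> = H" by (rule haar_space[OF sys inv])
  define P where "P h = {y \<in> H. \<forall>j<L. actH (h j) y \<in> C}" for h
  have Cm: "C \<in> sets \<nu>" by (rule haar_closed[OF sys inv C(1,3)])
  have vm: "actH g -` C \<inter> H \<in> sets \<nu>" for g by (rule haar_vimage[OF sys inv Cm])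
  have Hm: "H \<in> sets \<nu>" using sets.top[of \<nu>] spc by simp
  have Pm: "P h \<in> sets \<nu>" for h
  proof (cases "L = 0")
    case True
    then show ?thesis unfolding P_def using Hm by simp
  next
    case False
    then have "(\<Inter>j\<in>{..<L}. actH (h j) -` C \<inter> H) \<in> sets \<nu>" using vm by (intro sets.finite_INT) auto
    then have "H \<inter> (\<Inter>j\<in>{..<L}. actH (h j) -` C \<inter> H) \<in> sets \<nu>" by (intro sets.Int Hm)
    moreover have "H \<inter> (\<Inter>j\<in>{..<L}. actH (h j) -` C \<inter> H) = P h" unfolding P_def by blast
    ultimately show ?thesis by simp
  qed
  have "\<exists>h e. 0 < measure \<nu> (P h) \<and> (\<forall>n<M. e n \<in> H \<and> (\<forall>j<L. actH (h j) (e n) \<in> Q (\<tau> n j)))"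
  proof (induction M)
    case 0
    have "C \<subseteq> P (\<lambda>j. 0)" unfolding P_def using C(3) G_system_0[OF sys] by auto
    then have "measure \<nu> C \<le> measure \<nu> (P (\<lambda>j. 0))" by (intro finite_measure_mono Pm)
    then show ?case using C(4) by (intro exI[of _ "\<lambda>j. 0"] exI[of _ undefined]) simp
  next
    case (Suc M)
    then obtain h e where h: "0 < measure \<nu> (P h)" and e0: "\<forall>n<M. e n \<in> H \<and> (\<forall>j<L. actH (h j) (e n) \<in> Q (\<tau> n j))"
      by (elim exE conjE)
    have e: "e n \<in> H" "j < L \<Longrightarrow> actH (h j) (e n) \<in> Q (\<tau> n j)" if "n < M" for n j using e0 that by auto
    have "P h \<noteq> {}" using h by auto
    then obtain y where y: "y \<in> P h" by blast
    then have yH: "y \<in> H" unfolding P_def by simp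
    \<comment> \<open>\<open>L\<close> losses below this bound leave positive measure.\<close>
    define \<eta> where "\<eta> = measure \<nu> (P h) / (real L + 1)"
    have \<eta>: "\<eta> > 0" unfolding \<eta>_def using h by simp
    obtain \<epsilon>0 where \<epsilon>0: "\<epsilon>0 > 0" "\<forall>p. (\<forall>w\<in>H. dist (actH p w) w < \<epsilon>0) \<longrightarrow> measure \<nu> (C - (actH p -` C \<inter> H)) < \<eta>"
      using haar_small_displacement[OF sys inv C(1) C(3) \<eta>] by (elim exE conjE)
    have "\<exists>r>0. \<forall>z\<in>H. dist z (actH (h j) (e n)) < r \<longrightarrow> z \<in> Q (\<tau> n j)" if nj: "n < M" "j < L" for n j
      using Q[of "\<tau> n j"] e(2)[OF nj] unfolding openin_euclidean_subtopology_iff by blast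
    then have "\<forall>n\<in>{..<M}. \<forall>j\<in>{..<L}. \<exists>r>0. \<forall>z\<in>H. dist z (actH (h j) (e n)) < r \<longrightarrow> z \<in> Q (\<tau> n j)" by simp
    then obtain r where r: "\<forall>n\<in>{..<M}. \<forall>j\<in>{..<L}. r n j > 0 \<and> (\<forall>z\<in>H. dist z (actH (h j) (e n)) < r n j \<longrightarrow> z \<in> Q (\<tau> n j))"
      unfolding bchoice_iff by (elim exE)
    \<comment> \<open>Displacements below \<epsilon> keep the patterns already realised, by the
      radii \<open>r\<close>, and lose less than \<eta> of the measure of \<open>C\<close> at each
      position, by \<open>\<epsilon>0\<close>.\<close>
    define \<epsilon> where "\<epsilon> = Min (insert \<epsilon>0 ((\<lambda>(n, j). r n j) ` ({..<M} \<times> {..<L})))"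
    have \<epsilon>: "\<epsilon> > 0" unfolding \<epsilon>_def using \<epsilon>0(1) r by (subst Min_gr_iff) auto
    have \<epsilon>le0: "\<epsilon> \<le> \<epsilon>0" unfolding \<epsilon>_def by (intro Min_le) auto
    have \<epsilon>le: "\<epsilon> \<le> r n j" if "n < M" "j < L" for n j unfolding \<epsilon>_def using that by (intro Min_le) auto
    obtain \<delta> where \<delta>: "\<delta> > 0" "\<forall>p. \<forall>z\<in>H. \<forall>w\<in>H. dist (actH p z) z < \<delta> \<longrightarrow> dist (actH p w) w < \<epsilon>"
      using minimal_equicontinuous_displacement[OF sys min eq \<epsilon>] by (elim exE conjE)
    \<comment> \<open>The base point \<open>y\<close> is kept as the witness of the new pattern, and
      each \<open>h j\<close> is adjusted separately. Displacement below \<delta> at one point is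
      enough, as it bounds the displacement everywhere.\<close>
    have "\<exists>p. dist (actH p (actH (h j) y)) (actH (h j) y) < \<delta> \<and> actH p (actH (h j) y) \<in> Q (\<tau> M j)" if j: "j < L" for j
    proof -
      have yC: "actH (h j) y \<in> C" using y j unfolding P_def by simp
      then have yh: "actH (h j) y \<in> H" using C(3) by blast
      have "actH (h j) y \<in> closure (Q (\<tau> M j))" using C(2) yC by blast
      then obtain q where q: "q \<in> Q (\<tau> M j)" "dist q (actH (h j) y) < \<delta> / 2"
        using \<delta>(1) unfolding closure_approachable by (metis half_gt_zero)
      have qH: "q \<in> H" using q(1) openin_imp_subset[OF Q] by blast
      obtain s where s: "s > 0" "\<forall>z\<in>H. dist z q < s \<longrightarrow> z \<in> Q (\<tau> M j)"
        using Q[of "\<tau> M j"] q(1) unfolding openin_euclidean_subtopology_iff by blast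
      have ms: "min s (\<delta> / 2) > 0" using s(1) \<delta>(1) by simp
      obtain p where p: "dist (actH p (actH (h j) y)) q < min s (\<delta> / 2)"
        by (rule minimal_system_approx[OF min yh qH ms])
      have "dist (actH p (actH (h j) y)) (actH (h j) y) < \<delta>"
        using dist_triangle[of "actH p (actH (h j) y)" "actH (h j) y" q] p q(2) by simp
      moreover have "actH p (actH (h j) y) \<in> Q (\<tau> M j)" using s(2) p G_system_in[OF sys yh] by simp
      ultimately show ?thesis by blast
    qed
    then obtain p where p: "\<And>j. j < L \<Longrightarrow> dist (actH (p j) (actH (h j) y)) (actH (h j) y) < \<delta>"
      "\<And>j. j < L \<Longrightarrow> actH (p j) (actH (h j) y) \<in> Q (\<tau> M j)" by metis
    have small: "dist (actH (p j) w) w < \<epsilon>" if "j < L" "w \<in> H" for j w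
      using \<delta>(2) G_system_in[OF sys yH] that(2) p(1)[OF that(1)] by blast
    define h' where "h' j = p j + h j" for j
    have h': "actH (h' j) w = actH (p j) (actH (h j) w)" if "w \<in> H" for j w
      unfolding h'_def by (rule G_system_plus[OF sys that])
    \<comment> \<open>The points whose translate at position \<open>j\<close> is thrown out of
      \<open>C\<close> by the adjustment.\<close>
    define B where "B j = actH (h j) -` (C - (actH (p j) -` C \<inter> H)) \<inter> H" for j
    have CDm: "C - (actH (p j) -` C \<inter> H) \<in> sets \<nu>" for j using Cm vm by auto
    have Bm: "B j \<in> sets \<nu>" for j unfolding B_def by (rule haar_vimage[OF sys inv CDm])
    have Bs: "measure \<nu> (B j) < \<eta>" if "j < L" for j
    proof -
      have "measure \<nu> (C - (actH (p j) -` C \<inter> H)) < \<eta>"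
      proof (rule \<epsilon>0(2)[rule_format])
        fix w assume "w \<in> H"
        then show "dist (actH (p j) w) w < \<epsilon>0" using small[OF that] \<epsilon>le0 by (meson less_le_trans)
      qed
      then show ?thesis unfolding B_def using haar_measure_vimage[OF sys inv CDm, of "h j"] by simp
    qed
    have "P h \<subseteq> P h' \<union> (\<Union>j\<in>{..<L}. B j)"
    proof
      fix w assume w: "w \<in> P h"
      have wH: "w \<in> H" using w unfolding P_def by simp
      show "w \<in> P h' \<union> (\<Union>j\<in>{..<L}. B j)"
      proof (cases "w \<in> P h'")
        case False
        then obtain j where j: "j < L" "actH (h' j) w \<notin> C" unfolding P_def using wH by auto
        have "actH (h j) w \<in> C" using w j(1) unfolding P_def by simp
        then have "w \<in> B j" unfolding B_def using j(2) wH h'[OF wH] by simp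
        then show ?thesis using j(1) by blast
      qed simp
    qed
    then have "measure \<nu> (P h) \<le> measure \<nu> (P h' \<union> (\<Union>j\<in>{..<L}. B j))"
      using Pm Bm by (intro finite_measure_mono) auto
    also have "\<dots> \<le> measure \<nu> (P h') + measure \<nu> (\<Union>j\<in>{..<L}. B j)"
      using Pm Bm by (intro measure_Un_le) auto
    also have "measure \<nu> (\<Union>j\<in>{..<L}. B j) \<le> (\<Sum>j\<in>{..<L}. measure \<nu> (B j))"
      using Bm by (intro measure_UNION_le) auto
    also have "\<dots> \<le> (\<Sum>j\<in>{..<L}. \<eta>)" using Bs by (intro sum_mono less_imp_le) auto
    also have "\<dots> = real L * \<eta>" by simp
    also have "real L * \<eta> < measure \<nu> (P h)" unfolding \<eta>_def using h by (simp add: field_simps)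
    finally have pos: "0 < measure \<nu> (P h')" by simp
    define e' where "e' = e(M := y)"
    have "e' n \<in> H \<and> (\<forall>j<L. actH (h' j) (e' n) \<in> Q (\<tau> n j))" if n: "n < Suc M" for n
    proof (cases "n = M")
      case True
      then show ?thesis unfolding e'_def using yH p(2) h'[OF yH] by simp
    next
      case False
      then have nM: "n < M" using n by simp
      have "actH (h' j) (e n) \<in> Q (\<tau> n j)" if j: "j < L" for j
      proof -
        have hn: "actH (h j) (e n) \<in> H" by (rule G_system_in[OF sys e(1)[OF nM]])
        have "dist (actH (p j) (actH (h j) (e n))) (actH (h j) (e n)) < r n j"
          using small[OF j hn] \<epsilon>le[OF nM j] by linarith
        then show ?thesis using r nM j h'[OF e(1)[OF nM]] G_system_in[OF sys hn] by simp
      qed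
      then show ?thesis unfolding e'_def using False e(1)[OF nM] by simp
    qed
    then show ?case using pos by (intro exI[of _ h'] exI[of _ e']) simp
  qed
  then show ?thesis by (elim exE conjE) (intro exI)
qed

section \<open>Ergodicity of the Haar measure\<close>

lemma compact_countable_dense:
  fixes K :: "'a::metric_space set"
  assumes "compact K"
  obtains D where "countable D" "D \<subseteq> K" "K \<subseteq> closure D"
proof -
  have "\<exists>F. finite F \<and> F \<subseteq> K \<and> K \<subseteq> (\<Union>x\<in>F. ball x (1 / real (Suc n)))" for n
    using seq_compact_imp_totally_bounded[OF compact_imp_seq_compact[OF assms]] by simp
  then obtain F where F: "\<And>n. finite (F n)" "\<And>n. F n \<subseteq> K" "\<And>n. K \<subseteq> (\<Union>x\<in>F n. ball x (1 / real (Suc n)))"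
    by metis
  show ?thesis
  proof (rule that)
    show "countable (\<Union>n. F n)" using F(1) by (intro countable_UN countableI_type countable_finite)
    show "(\<Union>n. F n) \<subseteq> K" using F(2) by blast
    show "K \<subseteq> closure (\<Union>n. F n)"
    proof
      fix x assume x: "x \<in> K"
      show "x \<in> closure (\<Union>n. F n)" unfolding closure_approachable
      proof (intro allI impI)
        fix e :: real assume "e > 0"
        then obtain n where n: "inverse (real (Suc n)) < e" using reals_Archimedean by blast
        obtain y where "y \<in> F n" "dist y x < 1 / real (Suc n)" using F(3)[of n] x by auto
        then show "\<exists>y\<in>\<Union>n. F n. dist y x < e" using n by (intro bexI[of _ y]) (auto simp: inverse_eq_divide)
      qed
    qed
  qed
qed

section \<open>An invariant metric and ergodicity\<close>

context
  fixes H :: "'h::metric_space set" and actH :: "'g::ab_group_add \<Rightarrow> 'h \<Rightarrow> 'h" and \<nu> :: "'h measure"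
  assumes sys: "G_system H actH" and min: "minimal_system H actH" and eq: "equicontinuous_system H actH"
    and inv: "invariant_borel_prob H actH \<nu>"
begin

text \<open>The action is isometric for this supremum, and equicontinuity makes it uniformly
  equivalent to \<open>dist\<close> on \<open>H\<close>; translations thus carry balls to balls of
  the same radius.\<close>

definition inv_dist :: "'h \<Rightarrow> 'h \<Rightarrow> real" where
  "inv_dist x y = (SUP g. dist (actH g x) (actH g y))"

lemma inv_dist_bdd: "x \<in> H \<Longrightarrow> y \<in> H \<Longrightarrow> bdd_above (range (\<lambda>g. dist (actH g x) (actH g y)))"
proof -
  assume xy: "x \<in> H" "y \<in> H"
  obtain B where B: "\<forall>a\<in>H. \<forall>b\<in>H. dist a b \<le> B"
    using compact_imp_bounded[OF G_system_compact[OF sys]] bounded_two_points by blast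
  show ?thesis using B G_system_in[OF sys] xy by (intro bdd_aboveI2[where M = B]) blast
qed

lemma inv_dist_ge: "x \<in> H \<Longrightarrow> y \<in> H \<Longrightarrow> dist (actH g x) (actH g y) \<le> inv_dist x y"
  unfolding inv_dist_def by (rule cSUP_upper[OF UNIV_I inv_dist_bdd])

lemma dist_le_inv_dist: "x \<in> H \<Longrightarrow> y \<in> H \<Longrightarrow> dist x y \<le> inv_dist x y"
  using inv_dist_ge[of x y 0] G_system_0[OF sys, of x] G_system_0[OF sys, of y] by simp

lemma inv_dist_leI: "(\<And>g. dist (actH g x) (actH g y) \<le> c) \<Longrightarrow> inv_dist x y \<le> c"
  unfolding inv_dist_def by (rule cSUP_least) auto

lemma inv_dist_commute: "inv_dist x y = inv_dist y x"
  unfolding inv_dist_def by (simp add: dist_commute)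

lemma inv_dist_triangle: "x \<in> H \<Longrightarrow> y \<in> H \<Longrightarrow> z \<in> H \<Longrightarrow> inv_dist x z \<le> inv_dist x y + inv_dist y z"
proof (rule inv_dist_leI)
  fix g assume H: "x \<in> H" "y \<in> H" "z \<in> H"
  have "dist (actH g x) (actH g z) \<le> dist (actH g x) (actH g y) + dist (actH g y) (actH g z)" by (rule dist_triangle)
  then show "dist (actH g x) (actH g z) \<le> inv_dist x y + inv_dist y z"
    using inv_dist_ge[OF H(1,2), of g] inv_dist_ge[OF H(2,3), of g] by linarith
qed

lemma inv_dist_act: "x \<in> H \<Longrightarrow> y \<in> H \<Longrightarrow> inv_dist (actH g x) (actH g y) = inv_dist x y"
proof -
  have le: "inv_dist (actH g x) (actH g y) \<le> inv_dist x y" if H: "x \<in> H" "y \<in> H" for g x y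
  proof (rule inv_dist_leI)
    fix h
    show "dist (actH h (actH g x)) (actH h (actH g y)) \<le> inv_dist x y"
      using inv_dist_ge[OF H, of "h + g"] G_system_plus[OF sys H(1)] G_system_plus[OF sys H(2)] by simp
  qed
  assume H: "x \<in> H" "y \<in> H"
  have "inv_dist (actH (- g) (actH g x)) (actH (- g) (actH g y)) \<le> inv_dist (actH g x) (actH g y)"
    by (rule le[OF G_system_in[OF sys H(1)] G_system_in[OF sys H(2)]])
  then show ?thesis using le[OF H, of g] G_system_uminus[OF sys H(1)] G_system_uminus[OF sys H(2)] by simp
qed

lemma inv_dist_small: "e > 0 \<Longrightarrow> \<exists>d>0. \<forall>x\<in>H. \<forall>y\<in>H. dist x y < d \<longrightarrow> inv_dist x y < e"
proof -
  assume "e > 0"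
  then have e2: "e / 2 > 0" by simp
  obtain d where d: "d > 0" "\<forall>x\<in>H. \<forall>y\<in>H. dist x y < d \<longrightarrow> (\<forall>g. dist (actH g x) (actH g y) < e / 2)"
    using eq e2 unfolding equicontinuous_system_def by meson
  have "inv_dist x y < e" if "x \<in> H" "y \<in> H" "dist x y < d" for x y
  proof -
    have "inv_dist x y \<le> e / 2" using d(2) that by (intro inv_dist_leI less_imp_le) blast
    then show ?thesis using e2 by simp
  qed
  then show ?thesis using d(1) by blast
qed

lemma inv_ball_open: "y \<in> H \<Longrightarrow> openin (top_of_set H) {x \<in> H. inv_dist x y < r}"
  unfolding openin_euclidean_subtopology_iff
proof (intro conjI ballI)
  fix x assume y: "y \<in> H" and x: "x \<in> {x \<in> H. inv_dist x y < r}"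
  then have "r - inv_dist x y > 0" by simp
  then obtain d where d: "d > 0" "\<forall>a\<in>H. \<forall>b\<in>H. dist a b < d \<longrightarrow> inv_dist a b < r - inv_dist x y"
    using inv_dist_small by blast
  have "x' \<in> {x \<in> H. inv_dist x y < r}" if x': "x' \<in> H" "dist x' x < d" for x'
  proof -
    have "inv_dist x' x < r - inv_dist x y" using d(2) x x' by blast
    then show ?thesis using inv_dist_triangle[OF x'(1) _ y, of x] x x'(1) by simp
  qed
  then show "\<exists>e>0. \<forall>x'\<in>H. dist x' x < e \<longrightarrow> x' \<in> {x \<in> H. inv_dist x y < r}" using d(1) by blast
qed blast

text \<open>Translations preserve \<open>A\<close> and carry the ball about \<open>y\<close> to the
  balls about its orbit. The orbit comes arbitrarily close to \<open>z\<close>, so every smaller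
  ball about \<open>y\<close> has a translate inside the ball about \<open>z\<close>; an open ball
  is the union of the smaller ones, and symmetry gives the reverse inequality.\<close>

lemma inv_ball_constant:
  assumes A: "A \<in> sets \<nu>" "\<And>g. actH g -` A \<inter> H = A" and yz: "y \<in> H" "z \<in> H"
  shows "measure \<nu> (A \<inter> {x \<in> H. inv_dist x y < r}) = measure \<nu> (A \<inter> {x \<in> H. inv_dist x z < r})"
proof -
  interpret prob_space \<nu> by (rule haar_prob[OF sys inv])
  have bm: "{x \<in> H. inv_dist x y < r} \<in> sets \<nu>" if "y \<in> H" for y r
    by (rule haar_openin[OF sys inv inv_ball_open[OF that]])
  have g_inv: "measure \<nu> (A \<inter> {x \<in> H. inv_dist x (actH g y) < r}) = measure \<nu> (A \<inter> {x \<in> H. inv_dist x y < r})"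
    if y: "y \<in> H" for y g r
  proof -
    have "actH g -` (A \<inter> {x \<in> H. inv_dist x (actH g y) < r}) \<inter> H = A \<inter> {x \<in> H. inv_dist x y < r}"
    proof -
      have "x \<in> H \<Longrightarrow> actH g x \<in> A \<longleftrightarrow> x \<in> A" for x using A(2)[of g] by blast
      moreover have "A \<subseteq> H" using A(2) by blast
      ultimately show ?thesis using inv_dist_act[OF _ y] G_system_in[OF sys] by auto
    qed
    then show ?thesis
      using haar_measure_vimage[OF sys inv, of "A \<inter> {x \<in> H. inv_dist x (actH g y) < r}" g] A(1)
        bm[OF G_system_in[OF sys y]] by simp
  qed
  have le: "measure \<nu> (A \<inter> {x \<in> H. inv_dist x y < r}) \<le> measure \<nu> (A \<inter> {x \<in> H. inv_dist x z < r})"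
    if yz: "y \<in> H" "z \<in> H" for y z
  proof -
    define F where "F n = A \<inter> {x \<in> H. inv_dist x y < r - 1 / real (Suc n)}" for n
    have Fm: "F n \<in> sets \<nu>" for n unfolding F_def using A(1) bm[OF yz(1)] by (intro sets.Int)
    have "incseq F"
    proof (rule incseq_SucI)
      fix n
      have "1 / real (Suc (Suc n)) \<le> 1 / real (Suc n)" by (intro divide_left_mono) auto
      then show "F n \<subseteq> F (Suc n)" unfolding F_def by (intro Int_mono order_refl Collect_mono) linarith
    qed
    then have "(\<lambda>n. measure \<nu> (F n)) \<longlonglongrightarrow> measure \<nu> (\<Union>n. F n)"
      using Fm by (intro finite_Lim_measure_incseq) auto
    moreover have "(\<Union>n. F n) = A \<inter> {x \<in> H. inv_dist x y < r}"
    proof (intro subset_antisym subsetI)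
      fix x assume x: "x \<in> (\<Union>n. F n)"
      then obtain n where "x \<in> F n" by blast
      then have "x \<in> A" "x \<in> H" "inv_dist x y < r - 1 / real (Suc n)" unfolding F_def by auto
      moreover have "1 / real (Suc n) > 0" by simp
      ultimately have "x \<in> A" "x \<in> H" "inv_dist x y < r" by linarith+
      then show "x \<in> A \<inter> {x \<in> H. inv_dist x y < r}" by simp
    next
      fix x assume x: "x \<in> A \<inter> {x \<in> H. inv_dist x y < r}"
      then have "r - inv_dist x y > 0" by simp
      then obtain n where "inverse (real (Suc n)) < r - inv_dist x y" using reals_Archimedean by blast
      then have "x \<in> F n" unfolding F_def using x by (simp add: inverse_eq_divide)
      then show "x \<in> (\<Union>n. F n)" by blast
    qed
    ultimately have lim: "(\<lambda>n. measure \<nu> (F n)) \<longlonglongrightarrow> measure \<nu> (A \<inter> {x \<in> H. inv_dist x y < r})" by simp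
    show ?thesis
    proof (rule LIMSEQ_le_const2[OF lim], intro exI allI impI)
      fix n :: nat
      obtain d where d: "d > 0" "\<forall>a\<in>H. \<forall>b\<in>H. dist a b < d \<longrightarrow> inv_dist a b < 1 / real (Suc n)"
        using inv_dist_small[of "1 / real (Suc n)"] by auto
      obtain g where g: "dist (actH g y) z < d" by (rule minimal_system_approx[OF min yz d(1)])
      have gy: "actH g y \<in> H" by (rule G_system_in[OF sys yz(1)])
      have "measure \<nu> (F n) = measure \<nu> (A \<inter> {x \<in> H. inv_dist x (actH g y) < r - 1 / real (Suc n)})"
        unfolding F_def g_inv[OF yz(1)] ..
      also have "\<dots> \<le> measure \<nu> (A \<inter> {x \<in> H. inv_dist x z < r})"
      proof (rule finite_measure_mono)
        show "A \<inter> {x \<in> H. inv_dist x z < r} \<in> sets \<nu>" using A(1) bm[OF yz(2)] by (intro sets.Int)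
        have "inv_dist (actH g y) z < 1 / real (Suc n)" using d(2) gy yz(2) g by blast
        then show "A \<inter> {x \<in> H. inv_dist x (actH g y) < r - 1 / real (Suc n)} \<subseteq> A \<inter> {x \<in> H. inv_dist x z < r}"
          using inv_dist_triangle[OF _ gy yz(2)] by force
      qed
      finally show "measure \<nu> (F n) \<le> measure \<nu> (A \<inter> {x \<in> H. inv_dist x z < r})" .
    qed
  qed
  show ?thesis using le[OF yz] le[OF yz(2,1)] by (rule antisym)
qed

text \<open>Membership in the product sigma-algebra is obtained from countably many rectangles
  centred at a countable dense set; their radii \<open>1 / Suc n\<close> and
  \<open>r - 1 / Suc n\<close> add up to \<open>r\<close> in the triangle inequality.\<close>

lemma inv_ball_pair_measurable: "{p \<in> H \<times> H. inv_dist (fst p) (snd p) < r} \<in> sets (\<nu> \<Otimes>\<^sub>M \<nu>)"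
proof -
  obtain D where D: "countable D" "D \<subseteq> H" "H \<subseteq> closure D"
    by (rule compact_countable_dense[OF G_system_compact[OF sys]])
  define R where "R z n = {x \<in> H. inv_dist x z < 1 / real (Suc n)} \<times> {y \<in> H. inv_dist y z < r - 1 / real (Suc n)}" for z and n :: nat
  have "{p \<in> H \<times> H. inv_dist (fst p) (snd p) < r} = (\<Union>z\<in>D. \<Union>n. R z n)"
  proof (intro subset_antisym subsetI)
    fix p assume p: "p \<in> {p \<in> H \<times> H. inv_dist (fst p) (snd p) < r}"
    then have H: "fst p \<in> H" "snd p \<in> H" and lt: "r - inv_dist (fst p) (snd p) > 0" by auto
    then obtain n where n: "inverse (real (Suc n)) < (r - inv_dist (fst p) (snd p)) / 2"
      using reals_Archimedean half_gt_zero by blast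
    obtain d where d: "d > 0" "\<forall>a\<in>H. \<forall>b\<in>H. dist a b < d \<longrightarrow> inv_dist a b < 1 / real (Suc n)"
      using inv_dist_small[of "1 / real (Suc n)"] by auto
    have "fst p \<in> closure D" using D(3) H(1) by blast
    then obtain z where z: "z \<in> D" "dist z (fst p) < d" using d(1) unfolding closure_approachable by blast
    have zH: "z \<in> H" using z(1) D(2) by blast
    have zp: "inv_dist z (fst p) < 1 / real (Suc n)" using d(2) zH H(1) z(2) by blast
    moreover have "inv_dist (snd p) z \<le> inv_dist (snd p) (fst p) + inv_dist (fst p) z"
      by (rule inv_dist_triangle[OF H(2,1) zH])
    ultimately have "inv_dist (snd p) z < r - 1 / real (Suc n)"
      using n inv_dist_commute[of "snd p" "fst p"] inv_dist_commute[of "fst p" z] by (simp add: inverse_eq_divide)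
    then have "p \<in> R z n" unfolding R_def using H zp inv_dist_commute[of "fst p" z] by (simp add: mem_Times_iff)
    then show "p \<in> (\<Union>z\<in>D. \<Union>n. R z n)" using z(1) by blast
  next
    fix p assume "p \<in> (\<Union>z\<in>D. \<Union>n. R z n)"
    then obtain z n where z: "z \<in> D" "p \<in> R z n" by blast
    have H: "fst p \<in> H" "snd p \<in> H" "inv_dist (fst p) z < 1 / real (Suc n)" "inv_dist (snd p) z < r - 1 / real (Suc n)"
      using z(2) unfolding R_def by auto
    have zH: "z \<in> H" using z(1) D(2) by blast
    have "inv_dist (fst p) (snd p) < r"
      using inv_dist_triangle[OF H(1) zH H(2)] H(3,4) inv_dist_commute[of z "snd p"] by simp
    then show "p \<in> {p \<in> H \<times> H. inv_dist (fst p) (snd p) < r}" using H(1,2) by (simp add: mem_Times_iff)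
  qed
  moreover have "R z n \<in> sets (\<nu> \<Otimes>\<^sub>M \<nu>)" if "z \<in> D" for z n
    unfolding R_def using that D(2) by (intro pair_measureI haar_openin[OF sys inv] inv_ball_open) auto
  then have "(\<Union>z\<in>D. \<Union>n. R z n) \<in> sets (\<nu> \<Otimes>\<^sub>M \<nu>)"
    using D(1) by (intro sets.countable_UN' sets.countable_UN) auto
  ultimately show ?thesis by simp
qed

text \<open>By Fubini, the pairs in \<open>A \<times> C\<close> at \<open>inv_dist\<close> less than \<open>r\<close> are counted in two ways, using that all balls of
  radius \<open>r\<close> have the same measure, and also the same measure inside \<open>A\<close>.\<close>
lemma haar_invariant_null:
  assumes A: "A \<in> sets \<nu>" "\<And>g. actH g -` A \<inter> H = A" and C: "closed C" "C \<subseteq> H" "A \<inter> C = {}" "0 < measure \<nu> C"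
  shows "measure \<nu> A = 0"
proof -
  interpret prob_space \<nu> by (rule haar_prob[OF sys inv])
  interpret P: pair_sigma_finite \<nu> \<nu> ..
  have spc: "space \<nu> = H" by (rule haar_space[OF sys inv])
  have Cm: "C \<in> sets \<nu>" by (rule haar_closed[OF sys inv C(1,2)])
  have Hm: "H \<in> sets \<nu>" using sets.top[of \<nu>] spc by simp
  have AH: "A \<subseteq> H" using A(2) by blast
  have Cne: "C \<noteq> {}" using C(4) by auto
  then obtain y0 where y0: "y0 \<in> H" using C(2) by blast
  define a where "a r = measure \<nu> (A \<inter> {x \<in> H. inv_dist x y0 < r})" for r
  define b where "b r = measure \<nu> (H \<inter> {x \<in> H. inv_dist x y0 < r})" for r
  have a: "measure \<nu> (A \<inter> {x \<in> H. inv_dist x y < r}) = a r" if "y \<in> H" for y r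
    unfolding a_def by (rule inv_ball_constant[OF A that y0])
  have b: "measure \<nu> {x \<in> H. inv_dist x y < r} = b r" if "y \<in> H" for y r
  proof -
    have "actH g -` H \<inter> H = H" for g using G_system_in[OF sys] by auto
    from inv_ball_constant[OF Hm this that y0, of r] have "measure \<nu> (H \<inter> {x \<in> H. inv_dist x y < r}) = b r"
      unfolding b_def .
    moreover have "H \<inter> {x \<in> H. inv_dist x y < r} = {x \<in> H. inv_dist x y < r}" by blast
    ultimately show ?thesis by simp
  qed
  have bm: "{x \<in> H. inv_dist x y < r} \<in> sets \<nu>" if "y \<in> H" for y r
    by (rule haar_openin[OF sys inv inv_ball_open[OF that]])
  have fub: "(\<integral>y. measure \<nu> (S \<inter> {x \<in> H. inv_dist x y < r}) * indicator T y \<partial>\<nu>) =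
      (\<integral>x. measure \<nu> (T \<inter> {y \<in> H. inv_dist y x < r}) * indicator S x \<partial>\<nu>)"
    if S: "S \<in> sets \<nu>" "S \<subseteq> H" and T: "T \<in> sets \<nu>" "T \<subseteq> H" for S T r
  proof -
    let ?E = "(S \<times> T) \<inter> {p \<in> H \<times> H. inv_dist (fst p) (snd p) < r}"
    have E: "?E \<in> sets (\<nu> \<Otimes>\<^sub>M \<nu>)" using S(1) T(1) by (intro sets.Int pair_measureI inv_ball_pair_measurable)
    have "(\<integral>y. measure \<nu> (S \<inter> {x \<in> H. inv_dist x y < r}) * indicator T y \<partial>\<nu>) =
      (\<integral>y. (\<integral>x. indicator ?E (x, y) \<partial>\<nu>) \<partial>\<nu>)"
    proof (rule Bochner_Integration.integral_cong)
      fix y assume y: "y \<in> space \<nu>"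
      have eq: "S \<inter> {x \<in> H. inv_dist x y < r} \<inter> H = S \<inter> {x \<in> H. inv_dist x y < r}" by blast
      have "(\<lambda>x. indicator ?E (x, y) :: real) = (\<lambda>x. indicator (S \<inter> {x \<in> H. inv_dist x y < r}) x * indicator T y)"
        using S(2) y spc by (auto simp: fun_eq_iff indicator_def)
      then show "measure \<nu> (S \<inter> {x \<in> H. inv_dist x y < r}) * indicator T y = (\<integral>x. indicator ?E (x, y) \<partial>\<nu>)"
        using eq by (simp add: spc)
    qed simp
    also have "\<dots> = (\<integral>x. (\<integral>y. indicator ?E (x, y) \<partial>\<nu>) \<partial>\<nu>)"
    proof (rule P.Fubini_integral)
      have "integrable (\<nu> \<Otimes>\<^sub>M \<nu>) (indicator ?E :: _ \<Rightarrow> real)"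
      proof -
        interpret Q: pair_prob_space \<nu> \<nu> ..
        show ?thesis using E by (intro integrable_real_indicator) (simp_all add: less_top[symmetric])
      qed
      then show "integrable (\<nu> \<Otimes>\<^sub>M \<nu>) (case_prod (\<lambda>x y. indicator ?E (x, y) :: real))" by (simp add: case_prod_unfold)
    qed
    also have "\<dots> = (\<integral>x. measure \<nu> (T \<inter> {y \<in> H. inv_dist y x < r}) * indicator S x \<partial>\<nu>)"
    proof (rule Bochner_Integration.integral_cong)
      fix x assume x: "x \<in> space \<nu>"
      have eq: "T \<inter> {y \<in> H. inv_dist y x < r} \<inter> H = T \<inter> {y \<in> H. inv_dist y x < r}" by blast
      have "(\<lambda>y. indicator ?E (x, y) :: real) = (\<lambda>y. indicator (T \<inter> {y \<in> H. inv_dist y x < r}) y * indicator S x)"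
        using T(2) x spc inv_dist_commute[of x] by (auto simp: fun_eq_iff indicator_def)
      then show "(\<integral>y. indicator ?E (x, y) \<partial>\<nu>) = measure \<nu> (T \<inter> {y \<in> H. inv_dist y x < r}) * indicator S x"
        using eq by (simp add: spc)
    qed simp
    finally show ?thesis .
  qed
  \<comment> \<open>Fubini for \<open>A\<close> and \<open>H\<close>: the invariant set occupies the
    same share of every ball.\<close>
  have ab: "a r = b r * measure \<nu> A" for r
  proof -
    have "(\<integral>y. measure \<nu> (A \<inter> {x \<in> H. inv_dist x y < r}) * indicator H y \<partial>\<nu>) = (\<integral>y. a r * indicator H y \<partial>\<nu>)"
      using a spc by (intro Bochner_Integration.integral_cong) auto
    also have "\<dots> = a r" using Hm prob_space spc by simp
    finally have 1: "(\<integral>y. measure \<nu> (A \<inter> {x \<in> H. inv_dist x y < r}) * indicator H y \<partial>\<nu>) = a r" .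
    have "(\<integral>x. measure \<nu> (H \<inter> {y \<in> H. inv_dist y x < r}) * indicator A x \<partial>\<nu>) = (\<integral>x. b r * indicator A x \<partial>\<nu>)"
    proof (intro Bochner_Integration.integral_cong refl)
      fix x assume "x \<in> space \<nu>"
      moreover have "H \<inter> {y \<in> H. inv_dist y x < r} = {y \<in> H. inv_dist y x < r}" by blast
      ultimately show "measure \<nu> (H \<inter> {y \<in> H. inv_dist y x < r}) * indicator A x = b r * indicator A x"
        using b[of x r] spc by simp
    qed
    also have "\<dots> = b r * measure \<nu> A" using A(1) by simp
    finally show ?thesis using 1 fub[OF A(1) AH Hm order_refl, of r] by simp
  qed
  define K where "K n = {w \<in> H. infdist w C < 1 / real (Suc n)}" for n
  have Km: "K n \<in> sets \<nu>" for n
  proof -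
    have "H \<inter> {w. infdist w C < 1 / real (Suc n)} \<in> sets \<nu>"
      by (intro haar_borel[OF sys inv] borel_open open_Collect_less continuous_intros)
    then show ?thesis unfolding K_def by (simp add: Int_def)
  qed
  \<comment> \<open>Fubini for \<open>A\<close> and \<open>C\<close>: a ball of radius
    \<open>1 / Suc n\<close> about a point of \<open>A\<close> meets \<open>C\<close> only if the
    point lies in \<open>K n\<close>. The factor \<open>b\<close>, common to both sides, is then
    cancelled.\<close>
  have key: "measure \<nu> A * measure \<nu> C \<le> measure \<nu> (A \<inter> K n)" for n
  proof -
    let ?r = "1 / real (Suc n)"
    have "a ?r * measure \<nu> C = (\<integral>y. a ?r * indicator C y \<partial>\<nu>)" using Cm by simp
    also have "\<dots> = (\<integral>y. measure \<nu> (A \<inter> {x \<in> H. inv_dist x y < ?r}) * indicator C y \<partial>\<nu>)"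
      using a spc by (intro Bochner_Integration.integral_cong) auto
    also have "\<dots> = (\<integral>x. measure \<nu> (C \<inter> {y \<in> H. inv_dist y x < ?r}) * indicator A x \<partial>\<nu>)"
      by (rule fub[OF A(1) AH Cm C(2)])
    also have "\<dots> \<le> (\<integral>x. b ?r * indicator (A \<inter> K n) x \<partial>\<nu>)"
    proof (rule integral_mono')
      show "integrable \<nu> (\<lambda>x. b ?r * indicator (A \<inter> K n) x)" using A(1) Km
        by (intro integrable_mult_right integrable_real_indicator sets.Int) (simp_all add: emeasure_eq_measure)
      fix x assume x: "x \<in> space \<nu>"
      then have xH: "x \<in> H" using spc by simp
      have "0 \<le> b ?r" unfolding b_def by simp
      then show "0 \<le> b ?r * indicator (A \<inter> K n) x" by simp
      show "measure \<nu> (C \<inter> {y \<in> H. inv_dist y x < ?r}) * indicator A x \<le> b ?r * indicator (A \<inter> K n) x"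
      proof (cases "x \<in> K n")
        case True
        have "measure \<nu> (C \<inter> {y \<in> H. inv_dist y x < ?r}) \<le> b ?r"
          unfolding b[OF xH, symmetric] by (intro finite_measure_mono bm[OF xH]) blast
        then show ?thesis using True by (simp add: indicator_def)
      next
        case False
        have "C \<inter> {y \<in> H. inv_dist y x < ?r} = {}"
        proof (rule ccontr)
          assume "\<not> ?thesis"
          then obtain y where y: "y \<in> C" "y \<in> H" "inv_dist y x < ?r" by blast
          have "infdist x C \<le> dist x y" by (rule infdist_le[OF y(1)])
          also have "\<dots> \<le> inv_dist x y" by (rule dist_le_inv_dist[OF xH y(2)])
          also have "\<dots> < ?r" using y(3) inv_dist_commute[of x y] by simp
          finally show False using False xH unfolding K_def by simp
        qed
        then show ?thesis using False by simp
      qed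
    qed
    also have "\<dots> = b ?r * measure \<nu> (A \<inter> K n)" using A(1) Km by (simp add: sets.Int)
    finally have "b ?r * (measure \<nu> A * measure \<nu> C) \<le> b ?r * measure \<nu> (A \<inter> K n)" unfolding ab by simp
    \<comment> \<open>Otherwise finitely many null balls would cover \<open>H\<close>.\<close>
    moreover have "0 < b ?r"
    proof (rule ccontr)
      assume "\<not> ?thesis"
      then have b0: "b ?r = 0" unfolding b_def using measure_nonneg[of \<nu>] by (meson antisym_conv1 not_less)
      obtain d where d: "d > 0" "\<forall>x\<in>H. \<forall>y\<in>H. dist x y < d \<longrightarrow> inv_dist x y < ?r"
        using inv_dist_small[of ?r] by auto
      obtain F where F: "finite F" "F \<subseteq> H" "H \<subseteq> (\<Union>y\<in>F. ball y d)"
        using compactE_image[OF G_system_compact[OF sys], of H "\<lambda>y. ball y d"] d(1) by (metis centre_in_ball UN_I open_ball subsetI)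
      have "H \<subseteq> (\<Union>y\<in>F. {x \<in> H. inv_dist x y < ?r})"
      proof
        fix x assume x: "x \<in> H"
        then obtain y where y: "y \<in> F" "dist y x < d" using F(3) by auto
        then have "inv_dist x y < ?r" using d(2) x F(2) by (simp add: dist_commute subset_iff)
        then show "x \<in> (\<Union>y\<in>F. {x \<in> H. inv_dist x y < ?r})" using x y(1) by blast
      qed
      then have "measure \<nu> H \<le> measure \<nu> (\<Union>y\<in>F. {x \<in> H. inv_dist x y < ?r})"
        using F bm by (intro finite_measure_mono sets.finite_UN) auto
      also have "\<dots> \<le> (\<Sum>y\<in>F. measure \<nu> {x \<in> H. inv_dist x y < ?r})"
        using F bm by (intro measure_UNION_le) auto
      also have "\<dots> = 0" using b F(2) b0 by (intro sum.neutral) auto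
      finally show False using prob_space spc by simp
    qed
    ultimately show ?thesis by simp
  qed
  have "decseq (\<lambda>n. A \<inter> K n)"
  proof (rule decseq_SucI)
    fix n
    have "1 / real (Suc (Suc n)) \<le> 1 / real (Suc n)" by (intro divide_left_mono) auto
    then show "A \<inter> K (Suc n) \<subseteq> A \<inter> K n" unfolding K_def by (intro Int_mono order_refl Collect_mono) linarith
  qed
  then have "(\<lambda>n. measure \<nu> (A \<inter> K n)) \<longlonglongrightarrow> measure \<nu> (\<Inter>n. A \<inter> K n)"
    using A(1) Km by (intro finite_Lim_measure_decseq) auto
  \<comment> \<open>A common point would have distance 0 from the closed set \<open>C\<close>, which
    is disjoint from \<open>A\<close>.\<close>
  moreover have "(\<Inter>n. A \<inter> K n) = {}"
  proof (rule ccontr)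
    assume "\<not> ?thesis"
    then obtain w where w: "\<And>n. w \<in> A \<inter> K n" by blast
    have "infdist w C \<le> 0"
    proof (rule LIMSEQ_le_const[OF LIMSEQ_Suc[OF lim_1_over_n]], intro exI allI impI)
      fix n :: nat
      show "infdist w C \<le> 1 / real (Suc n)" using w[of n] unfolding K_def by simp
    qed
    then have "infdist w C = 0" using infdist_nonneg[of w C] by simp
    then have "w \<in> C" using in_closed_iff_infdist_zero[OF C(1) Cne] by simp
    then show False using w[of 0] C(3) by blast
  qed
  ultimately have "(\<lambda>n. measure \<nu> (A \<inter> K n)) \<longlonglongrightarrow> 0" by simp
  then have "measure \<nu> A * measure \<nu> C \<le> 0" using key by (intro LIMSEQ_le_const) auto
  then show ?thesis using C(4) measure_nonneg[of \<nu> A] by (simp add: mult_le_0_iff)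
qed

end

section \<open>Fibre cardinality\<close>

lemma minimal_factor:
  fixes act :: "'g::ab_group_add \<Rightarrow> 'x::metric_space \<Rightarrow> 'x" and p :: "'x \<Rightarrow> 'h::metric_space"
  assumes sys: "G_system X act" and min: "minimal_system X act" and sysH: "G_system H actH"
    and p: "continuous_on X p" "p ` X = H" "\<And>g x. x \<in> X \<Longrightarrow> p (act g x) = actH g (p x)"
  shows "minimal_system H actH"
  unfolding minimal_system_def
proof
  fix y assume y: "y \<in> H"
  then have "y \<in> p ` X" using p(2) by simp
  then obtain x where x: "x \<in> X" "y = p x" by (elim imageE)
  have cl: "closure (range (\<lambda>g. act g x)) = X" using min x(1) unfolding minimal_system_def by blast
  have "p ` closure (range (\<lambda>g. act g x)) \<subseteq> closure (range (\<lambda>g. actH g y))"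
  proof (rule image_closure_subset)
    show "continuous_on (closure (range (\<lambda>g. act g x))) p" unfolding cl by (rule p(1))
    show "closed (closure (range (\<lambda>g. actH g y)))" by simp
    have "p ` range (\<lambda>g. act g x) = range (\<lambda>g. actH g y)"
      unfolding image_image x(2) by (rule image_cong) (simp_all add: p(3)[OF x(1)])
    then show "p ` range (\<lambda>g. act g x) \<subseteq> closure (range (\<lambda>g. actH g y))" using closure_subset by simp
  qed
  then have "H \<subseteq> closure (range (\<lambda>g. actH g y))" unfolding cl p(2) .
  moreover have "closure (range (\<lambda>g. actH g y)) \<subseteq> H"
    using compact_imp_closed[OF G_system_compact[OF sysH]] G_system_in[OF sysH y] by (intro closure_minimal) auto
  ultimately show "closure (range (\<lambda>g. actH g y)) = H" by (rule subset_antisym[rotated])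
qed

text \<open>The union is the relative interior of the image. Points of the image are approximated by
  applying \<open>factor_open_subset\<close> to the part of \<open>U\<close> over a small
  ball.\<close>

lemma closure_factor_interior:
  fixes act :: "'g::ab_group_add \<Rightarrow> 'x::metric_space \<Rightarrow> 'x" and p :: "'x \<Rightarrow> 'h::metric_space"
  assumes sys: "G_system X act" and min: "minimal_system X act" and sysH: "G_system H actH"
    and p: "continuous_on X p" "p ` X = H" "\<And>g x. x \<in> X \<Longrightarrow> p (act g x) = actH g (p x)"
    and U: "openin (top_of_set X) U"
  shows "p ` U \<subseteq> closure (\<Union>{Q. openin (top_of_set H) Q \<and> Q \<subseteq> p ` U})"
proof
  fix y assume "y \<in> p ` U"
  then obtain x where x: "x \<in> U" "y = p x" by (elim imageE)
  have xX: "x \<in> X" using x(1) openin_imp_subset[OF U] by blast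
  show "y \<in> closure (\<Union>{Q. openin (top_of_set H) Q \<and> Q \<subseteq> p ` U})" unfolding closure_approachable
  proof (intro allI impI)
    fix e :: real assume e: "e > 0"
    have "openin (top_of_set X) (X \<inter> p -` ball y e)" by (rule continuous_openin_preimage_gen[OF p(1) open_ball])
    then have op: "openin (top_of_set X) (U \<inter> (X \<inter> p -` ball y e))" by (rule openin_Int[OF U])
    have ne: "U \<inter> (X \<inter> p -` ball y e) \<noteq> {}" using x xX e by auto
    obtain Q where Q: "openin (top_of_set H) Q" "Q \<noteq> {}" "Q \<subseteq> p ` (U \<inter> (X \<inter> p -` ball y e))"
      by (rule factor_open_subset[where act = act and actH = actH and p = p and X = X and H = H, OF sys min sysH p op ne])
    obtain z where z: "z \<in> Q" using Q(2) by blast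
    have "dist z y < e" using z Q(3) by (auto simp: dist_commute)
    moreover have "Q \<subseteq> p ` U" using Q(3) by blast
    ultimately show "\<exists>z\<in>\<Union>{Q. openin (top_of_set H) Q \<and> Q \<subseteq> p ` U}. dist z y < e" using z Q(1) by blast
  qed
qed

text \<open>The two halves of the argument meet here: patterns are realised in the base, with the
  relative interiors of the images as \<open>Q\<close>, and then lifted along the fibres.\<close>

lemma sup_seq_entropy_ge_if_common_base:
  fixes act :: "'g::ab_group_add \<Rightarrow> 'x::metric_space \<Rightarrow> 'x" and p :: "'x \<Rightarrow> 'h::metric_space"
  assumes sys: "G_system X act" and min: "minimal_system X act" and mef: "max_equicontinuous_factor X act H actH p"
    and inv: "invariant_borel_prob H actH \<nu>"
    and k: "k \<ge> 1" and U: "\<And>i. openin (top_of_set X) (U i)"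
    and disj: "\<And>i j. i < k \<Longrightarrow> j < k \<Longrightarrow> i \<noteq> j \<Longrightarrow> closure (U i) \<inter> closure (U j) = {}"
    and C: "closed C" "\<And>i. i < k \<Longrightarrow> C \<subseteq> p ` U i" "0 < measure \<nu> C"
  shows "ereal (ln (real k)) \<le> sup_seq_entropy X act"
proof (rule sup_seq_entropy_ge[OF k G_system_in[OF sys] disj])
  have sysH: "G_system H actH" and p: "continuous_on X p" "p ` X = H" "\<And>g x. x \<in> X \<Longrightarrow> p (act g x) = actH g (p x)"
    and eq: "equicontinuous_system H actH"
    and pS: "\<And>x y. x \<in> X \<Longrightarrow> y \<in> X \<Longrightarrow> p x = p y \<Longrightarrow> (x, y) \<in> S_eq X act"
    using mef unfolding max_equicontinuous_factor_def factor_map_def by auto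
  have minH: "minimal_system H actH" by (rule minimal_factor[where act = act and p = p and X = X, OF sys min sysH p])
  \<comment> \<open>Beyond \<open>k\<close> the whole space is a default, so that the conditions on
    \<open>U'\<close> and \<open>C\<close> hold for every index.\<close>
  define U' where "U' i = (if i < k then U i else X)" for i
  have U': "openin (top_of_set X) (U' i)" for i unfolding U'_def using U by simp
  define Q where "Q i = \<Union>{Q. openin (top_of_set H) Q \<and> Q \<subseteq> p ` U' i}" for i
  have Qo: "openin (top_of_set H) (Q i)" for i unfolding Q_def by (intro openin_Union) blast
  have QU: "Q i \<subseteq> p ` U' i" for i unfolding Q_def by blast
  have CH: "C \<subseteq> H"
  proof -
    have "C \<subseteq> p ` U 0" using C(2)[of 0] k by simp
    also have "\<dots> \<subseteq> H" using openin_imp_subset[OF U[of 0]] p(2) by blast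
    finally show ?thesis .
  qed
  have CU: "C \<subseteq> p ` U' i" for i unfolding U'_def using C(2) CH p(2) by simp
  have CQ: "C \<subseteq> closure (Q i)" for i
    unfolding Q_def using CU closure_factor_interior[where act = act and actH = actH, OF sys min sysH p U'] by (rule subset_trans)
  have ne: "X \<noteq> {}"
  proof
    assume "X = {}"
    then have "C = {}" using CH p(2) by simp
    then show False using C(3) by simp
  qed
  fix L :: nat
  let ?T = "PiE {..<L} (\<lambda>_. {..<k})"
  have fT: "finite ?T" by (intro finite_PiE) auto
  \<comment> \<open>All patterns of length \<open>L\<close> are enumerated, so that one choice of
    group elements serves every one of them.\<close>
  obtain \<tau> where \<tau>: "bij_betw \<tau> {..<card ?T} ?T" using ex_bij_betw_nat_finite[OF fT] by (metis atLeast0LessThan)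
  obtain h e where he: "\<forall>n<card ?T. e n \<in> H \<and> (\<forall>j<L. actH (h j) (e n) \<in> Q (\<tau> n j))"
    using realize_patterns_in_base[where \<tau> = \<tau> and L = L and M = "card ?T" and Q = Q, OF sysH minH eq inv Qo C(1) CQ CH C(3)]
    by (elim exE)
  have "\<exists>g. \<forall>n<card ?T. \<exists>x\<in>X. \<forall>j<L. act (g j) x \<in> U' (\<tau> n j)"
    by (rule independence_from_base[where h = h and e = e and actH = actH and p = p and H = H and Q = Q,
        OF sys min ne sysH p pS U' Qo QU]) (use he in auto)
  then obtain g where g: "\<forall>n<card ?T. \<exists>x\<in>X. \<forall>j<L. act (g j) x \<in> U' (\<tau> n j)" by (elim exE)
  have "\<exists>x\<in>X. \<forall>j<L. t j < k \<longrightarrow> act (g j) x \<in> U (t j)" for t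
  proof -
    \<comment> \<open>Entries outside the alphabet become the symbol 0, which is available since
      \<open>k \<ge> 1\<close>; nothing is claimed at those positions.\<close>
    define t' where "t' = restrict (\<lambda>j. if t j < k then t j else 0) {..<L}"
    have "t' \<in> ?T" unfolding t'_def using k by auto
    then have "t' \<in> \<tau> ` {..<card ?T}" using bij_betw_imp_surj_on[OF \<tau>] by simp
    then obtain n where n: "n < card ?T" "\<tau> n = t'" by auto
    obtain x where x: "x \<in> X" "\<forall>j<L. act (g j) x \<in> U' (t' j)" using g n by auto
    have "act (g j) x \<in> U (t j)" if "j < L" "t j < k" for j
      using x(2) that unfolding t'_def U'_def by auto
    then show ?thesis using x(1) by blast
  qed
  then show "\<exists>g. \<forall>t. \<exists>x\<in>X. \<forall>j<L. t j < k \<longrightarrow> act (g j) x \<in> U (t j)" by (intro exI[of _ g] allI)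
qed

section \<open>Counting the points of a fibre\<close>

lemma enat_le_ecard_imp_inj:
  assumes "enat k \<le> ecard F"
  obtains f where "inj_on f {..<k}" "f ` {..<k} \<subseteq> F"
proof -
  have "\<exists>B\<subseteq>F. finite B \<and> card B = k"
  proof (cases "finite F")
    case True
    then show ?thesis using assms unfolding ecard_def by (metis enat_ord_simps(1) obtain_subset_with_card_n)
  next
    case False
    then show ?thesis using infinite_arbitrarily_large by blast
  qed
  then obtain B where B: "B \<subseteq> F" "finite B" "card B = k" by blast
  obtain f where "bij_betw f {..<k} B" using ex_bij_betw_nat_finite[OF B(2)] B(3) by (metis atLeast0LessThan)
  then show ?thesis using that[of f] B(1) unfolding bij_betw_def by blast
qed

lemma enat_le_ecard:
  assumes "inj_on f {..<k}" "f ` {..<k} \<subseteq> F"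
  shows "enat k \<le> ecard F"
proof (cases "finite F")
  case True
  then have "card {..<k} \<le> card F" using assms by (intro card_inj_on_le)
  then show ?thesis using True unfolding ecard_def by simp
qed (simp add: ecard_def)

text \<open>Points with \<open>k\<close> preimages are detected by \<open>k\<close> balls centred in a countable dense set; the factor 4
  keeps the balls of twice the radius apart.\<close>
definition centre_tuples :: "'x::metric_space set \<Rightarrow> nat \<Rightarrow> ('x list \<times> nat) set" where
  "centre_tuples D k = {(c, n). c \<in> lists D \<and> length c = k \<and>
     (\<forall>i<k. \<forall>j<k. i \<noteq> j \<longrightarrow> 4 / real (Suc n) < dist (c ! i) (c ! j))}"

text \<open>Closed balls make the images compact and the intersection closed; it serves as the
  closed set \<open>C\<close> in both the entropy bound and the ergodicity argument.\<close>

definition common_base :: "'x::metric_space set \<Rightarrow> ('x \<Rightarrow> 'h) \<Rightarrow> 'x list \<times> nat \<Rightarrow> 'h set" where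
  "common_base X p cn = (\<Inter>i\<in>{..<length (fst cn)}. p ` (X \<inter> cball (fst cn ! i) (1 / real (Suc (snd cn)))))"

text \<open>For countable \<open>D\<close> the union is countable. With compact \<open>X\<close> and
  continuous \<open>p\<close> its members are closed, so the left-hand set is Borel, and if it is
  not null, some member is not null either.\<close>

lemma fibre_ge_eq_Union:
  fixes X :: "'x::metric_space set"
  assumes k: "k \<ge> 1" and D: "X \<subseteq> closure D"
  shows "{y \<in> p ` X. enat k \<le> ecard {x \<in> X. p x = y}} = (\<Union>cn\<in>centre_tuples D k. common_base X p cn)"
proof (intro subset_antisym subsetI)
  fix y assume "y \<in> {y \<in> p ` X. enat k \<le> ecard {x \<in> X. p x = y}}"
  then obtain f where f: "inj_on f {..<k}" "f ` {..<k} \<subseteq> {x \<in> X. p x = y}"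
    using enat_le_ecard_imp_inj by blast
  \<comment> \<open>The 1 keeps the minimum defined when \<open>k = 1\<close> and there are no
    pairs.\<close>
  define d where "d = Min (insert 1 ((\<lambda>(i, j). dist (f i) (f j)) ` {(i, j). i < k \<and> j < k \<and> i \<noteq> j}))"
  have fin: "finite {(i, j). i < k \<and> j < k \<and> i \<noteq> j}"
    by (rule finite_subset[of _ "{..<k} \<times> {..<k}"]) auto
  have "d > 0" unfolding d_def using fin f(1) by (subst Min_gr_iff) (auto simp: inj_on_def)
  then have "d / 8 > 0" by simp
  \<comment> \<open>Centres within \<open>d / 8\<close> of points at mutual distance at least
    \<open>d\<close> are more than \<open>d - 2 * (d / 8)\<close> apart, which exceeds
    \<open>4 * (d / 8)\<close>.\<close>
  then obtain n where n: "inverse (real (Suc n)) < d / 8" using reals_Archimedean by blast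
  have dle: "d \<le> dist (f i) (f j)" if "i < k" "j < k" "i \<noteq> j" for i j
    unfolding d_def using fin that by (intro Min_le) auto
  have "\<exists>c\<in>D. dist c (f i) < 1 / real (Suc n)" if "i < k" for i
  proof -
    have "f i \<in> closure D" using f(2) that D by blast
    moreover have "0 < 1 / real (Suc n)" by simp
    ultimately show ?thesis unfolding closure_approachable by blast
  qed
  then obtain c where c: "\<And>i. i < k \<Longrightarrow> c i \<in> D" "\<And>i. i < k \<Longrightarrow> dist (c i) (f i) < 1 / real (Suc n)" by metis
  have "(map c [0..<k], n) \<in> centre_tuples D k" unfolding centre_tuples_def
  proof (intro CollectI case_prodI conjI allI impI)
    show "map c [0..<k] \<in> lists D" using c(1) by auto
    show "length (map c [0..<k]) = k" by simp
    fix i j assume ij: "i < k" "j < k" "i \<noteq> j"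
    have "d \<le> dist (f i) (c i) + dist (c i) (c j) + dist (c j) (f j)"
      using dle[OF ij] dist_triangle[of "f i" "f j" "c i"] dist_triangle[of "c i" "f j" "c j"] by linarith
    moreover have "4 / real (Suc n) = 4 * (1 / real (Suc n))" "0 < 1 / real (Suc n)" by simp_all
    moreover have "1 / real (Suc n) < d / 8" using n by (simp add: inverse_eq_divide)
    ultimately have "4 / real (Suc n) < dist (c i) (c j)"
      using c(2)[OF ij(1)] c(2)[OF ij(2)] dist_commute[of "f i" "c i"] by linarith
    then show "4 / real (Suc n) < dist (map c [0..<k] ! i) (map c [0..<k] ! j)" using ij by simp
  qed
  moreover have "y \<in> common_base X p (map c [0..<k], n)" unfolding common_base_def
  proof (intro INT_I)
    fix i assume "i \<in> {..<length (fst (map c [0..<k], n))}"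
    then have i: "i < k" by simp
    have "f i \<in> X \<inter> cball (c i) (1 / real (Suc n))" "p (f i) = y" using f(2) i c(2)[OF i] by auto
    then show "y \<in> p ` (X \<inter> cball (fst (map c [0..<k], n) ! i) (1 / real (Suc (snd (map c [0..<k], n)))))"
      using i by (intro image_eqI[of _ _ "f i"]) simp_all
  qed
  ultimately show "y \<in> (\<Union>cn\<in>centre_tuples D k. common_base X p cn)" by blast
next
  fix y assume "y \<in> (\<Union>cn\<in>centre_tuples D k. common_base X p cn)"
  then obtain c n where cn: "(c, n) \<in> centre_tuples D k" "y \<in> common_base X p (c, n)" by auto
  have len: "length c = k" and sep: "\<And>i j. i < k \<Longrightarrow> j < k \<Longrightarrow> i \<noteq> j \<Longrightarrow> 4 / real (Suc n) < dist (c ! i) (c ! j)"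
    using cn(1) unfolding centre_tuples_def by auto
  have "\<exists>x\<in>X. dist (c ! i) x \<le> 1 / real (Suc n) \<and> p x = y" if "i < k" for i
  proof -
    have "y \<in> p ` (X \<inter> cball (c ! i) (1 / real (Suc n)))"
      using cn(2) that unfolding common_base_def fst_conv snd_conv len by blast
    then show ?thesis by auto
  qed
  then obtain f where f: "\<And>i. i < k \<Longrightarrow> f i \<in> X" "\<And>i. i < k \<Longrightarrow> dist (c ! i) (f i) \<le> 1 / real (Suc n)"
    "\<And>i. i < k \<Longrightarrow> p (f i) = y" by metis
  have "inj_on f {..<k}"
  proof (rule inj_onI)
    fix i j assume ij: "i \<in> {..<k}" "j \<in> {..<k}" "f i = f j"
    show "i = j"
    proof (rule ccontr)
      assume "i \<noteq> j"
      then have "4 / real (Suc n) < dist (c ! i) (c ! j)" using sep ij by simp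
      moreover have "dist (c ! i) (c ! j) \<le> 1 / real (Suc n) + 1 / real (Suc n)"
        using dist_triangle2[of "c ! i" "c ! j" "f i"] f(2)[of i] f(2)[of j] ij by simp
      moreover have "0 < 1 / real (Suc n)" "4 / real (Suc n) = 4 * (1 / real (Suc n))" by simp_all
      ultimately show False by linarith
    qed
  qed
  moreover have "f ` {..<k} \<subseteq> {x \<in> X. p x = y}" using f by auto
  ultimately have "enat k \<le> ecard {x \<in> X. p x = y}" by (rule enat_le_ecard)
  moreover have "y \<in> p ` X" using f(1,3)[of 0] k by auto
  ultimately show "y \<in> {y \<in> p ` X. enat k \<le> ecard {x \<in> X. p x = y}}" by simp
qed

lemma countable_centre_tuples: "countable D \<Longrightarrow> countable (centre_tuples D k)"
  by (rule countable_subset[of _ "lists D \<times> UNIV"]) (auto simp: centre_tuples_def)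

lemma closed_common_base:
  fixes p :: "'x::metric_space \<Rightarrow> 'h::metric_space"
  assumes "compact X" "continuous_on X p"
  shows "closed (common_base X p cn)"
  unfolding common_base_def
proof (intro closed_INT ballI compact_imp_closed compact_continuous_image)
  fix i
  show "continuous_on (X \<inter> cball (fst cn ! i) (1 / real (Suc (snd cn)))) p"
    by (rule continuous_on_subset[OF assms(2)]) blast
  show "compact (X \<inter> cball (fst cn ! i) (1 / real (Suc (snd cn))))"
    using assms(1) by (intro compact_Int_closed) auto
qed

lemma sup_seq_entropy_ge_if_positive_base:
  fixes act :: "'g::ab_group_add \<Rightarrow> 'x::metric_space \<Rightarrow> 'x" and p :: "'x \<Rightarrow> 'h::metric_space"
  assumes sys: "G_system X act" and min: "minimal_system X act" and mef: "max_equicontinuous_factor X act H actH p"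
    and inv: "invariant_borel_prob H actH \<nu>"
    and k: "k \<ge> 1" and cn: "(c, n) \<in> centre_tuples D k" and pos: "0 < measure \<nu> (common_base X p (c, n))"
  shows "ereal (ln (real k)) \<le> sup_seq_entropy X act"
proof -
  have len: "length c = k" and sep: "\<And>i j. i < k \<Longrightarrow> j < k \<Longrightarrow> i \<noteq> j \<Longrightarrow> 4 / real (Suc n) < dist (c ! i) (c ! j)"
    using cn unfolding centre_tuples_def by auto
  have pc: "continuous_on X p" using mef unfolding max_equicontinuous_factor_def factor_map_def by blast
  \<comment> \<open>Twice the radius used in \<open>common_base\<close>: the closed balls lie
    inside, and with centres more than \<open>4 / Suc n\<close> apart even the closures are
    disjoint.\<close>
  define U where "U i = X \<inter> ball (c ! i) (2 / real (Suc n))" for i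
  show ?thesis
  proof (rule sup_seq_entropy_ge_if_common_base[OF sys min mef inv k, of U])
    show "openin (top_of_set X) (U i)" for i unfolding U_def by (simp add: openin_open_Int)
    show "closed (common_base X p (c, n))" by (rule closed_common_base[OF G_system_compact[OF sys] pc])
    show "0 < measure \<nu> (common_base X p (c, n))" by (rule pos)
    show "common_base X p (c, n) \<subseteq> p ` U i" if "i < k" for i
    proof -
      have "cball (c ! i) (1 / real (Suc n)) \<subseteq> ball (c ! i) (2 / real (Suc n))"
      proof
        fix z assume "z \<in> cball (c ! i) (1 / real (Suc n))"
        then have "dist (c ! i) z \<le> 1 / real (Suc n)" by simp
        also have "\<dots> < 2 / real (Suc n)" by (intro divide_strict_right_mono) auto
        finally show "z \<in> ball (c ! i) (2 / real (Suc n))" by simp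
      qed
      then have "X \<inter> cball (c ! i) (1 / real (Suc n)) \<subseteq> U i" unfolding U_def by blast
      then show ?thesis unfolding common_base_def fst_conv snd_conv len using that by blast
    qed
    show "closure (U i) \<inter> closure (U j) = {}" if ij: "i < k" "j < k" "i \<noteq> j" for i j
    proof (rule ccontr)
      assume "\<not> ?thesis"
      then obtain z where z: "z \<in> closure (U i)" "z \<in> closure (U j)" by blast
      have cl: "closure (U i) \<subseteq> cball (c ! i) (2 / real (Suc n))" for i
        unfolding U_def by (intro closure_minimal) auto
      have "dist (c ! i) z \<le> 2 / real (Suc n)" "dist (c ! j) z \<le> 2 / real (Suc n)" using z cl by (auto simp: subset_iff)
      then have "dist (c ! i) (c ! j) \<le> 2 / real (Suc n) + 2 / real (Suc n)"
        using dist_triangle2[of "c ! i" "c ! j" z] by linarith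
      then show False using sep[OF ij] by simp
    qed
  qed
qed

theorem theorem1p1:
  fixes X :: "'x::metric_space set" and act :: "'g::{ab_group_add, countable} \<Rightarrow> 'x \<Rightarrow> 'x"
    and H :: "'h::metric_space set" and actH :: "'g \<Rightarrow> 'h \<Rightarrow> 'h"
    and \<pi> :: "'x \<Rightarrow> 'h" and \<nu> :: "'h measure"
  assumes "infinite (UNIV :: 'g set)"
    and "G_system X act" and "minimal_system X act"
    and "max_equicontinuous_factor X act H actH \<pi>"
    and "invariant_borel_prob H actH \<nu>"
  shows "\<exists>K::enat. elog K \<le> sup_seq_entropy X act \<and>
           emeasure \<nu> {y \<in> H. ecard {x \<in> X. \<pi> x = y} = K} = 1"
proof -
  note sys = assms(2) and min = assms(3) and mef = assms(4) and inv = assms(5)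
  have sysH: "G_system H actH" and p: "continuous_on X \<pi>" "\<pi> ` X = H" "\<And>g x. x \<in> X \<Longrightarrow> \<pi> (act g x) = actH g (\<pi> x)"
    and eq: "equicontinuous_system H actH"
    using mef unfolding max_equicontinuous_factor_def factor_map_def by auto
  have minH: "minimal_system H actH"
    by (rule minimal_factor[where act = act and p = \<pi> and X = X, OF sys min sysH p])
  interpret prob_space \<nu> by (rule haar_prob[OF sysH inv])
  have spc: "space \<nu> = H" by (rule haar_space[OF sysH inv])
  have Hm: "H \<in> sets \<nu>" using sets.top[of \<nu>] spc by simp
  obtain D where D: "countable D" "D \<subseteq> X" "X \<subseteq> closure D"
    by (rule compact_countable_dense[OF G_system_compact[OF sys]])
  define A where "A k = {y \<in> H. enat k \<le> ecard {x \<in> X. \<pi> x = y}}" for k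
  have A_Un: "A k = (\<Union>cn\<in>centre_tuples D k. common_base X \<pi> cn)" if "k \<ge> 1" for k
    using fibre_ge_eq_Union[OF that D(3), of \<pi>] unfolding A_def p(2) .
  have cbm: "common_base X \<pi> cn \<in> sets \<nu>" if "k \<ge> 1" "cn \<in> centre_tuples D k" for k cn
  proof (rule haar_closed[OF sysH inv closed_common_base[OF G_system_compact[OF sys] p(1)]])
    have "common_base X \<pi> cn \<subseteq> A k" unfolding A_Un[OF that(1)] using that(2) by blast
    then show "common_base X \<pi> cn \<subseteq> H" unfolding A_def by blast
  qed
  have A0: "A 0 = H" unfolding A_def by (auto simp: zero_enat_def[symmetric])
  have Am: "A k \<in> sets \<nu>" for k
  proof (cases "k = 0")
    case True
    then show ?thesis using A0 Hm by simp
  next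
    case False
    then have k: "k \<ge> 1" by simp
    show ?thesis unfolding A_Un[OF k] using cbm[OF k] countable_centre_tuples[OF D(1)]
      by (intro sets.countable_UN') auto
  qed
  \<comment> \<open>Translations map fibres bijectively onto fibres. The complement is treated
    because it is the set to be shown null.\<close>
  have Ainv: "actH g -` (H - A k) \<inter> H = H - A k" for g k
  proof -
    have fib: "ecard {x \<in> X. \<pi> x = actH g y} = ecard {x \<in> X. \<pi> x = y}" if y: "y \<in> H" for y
    proof -
      have "bij_betw (act g) {x \<in> X. \<pi> x = y} {x \<in> X. \<pi> x = actH g y}"
      proof (rule bij_betw_byWitness[where f' = "act (- g)"])
        show "\<forall>x\<in>{x \<in> X. \<pi> x = y}. act (- g) (act g x) = x" using G_system_uminus[OF sys] by blast
        show "\<forall>x\<in>{x \<in> X. \<pi> x = actH g y}. act g (act (- g) x) = x" using G_system_uminus'[OF sys] by blast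
        show "act g ` {x \<in> X. \<pi> x = y} \<subseteq> {x \<in> X. \<pi> x = actH g y}" using p(3) G_system_in[OF sys] by auto
        show "act (- g) ` {x \<in> X. \<pi> x = actH g y} \<subseteq> {x \<in> X. \<pi> x = y}"
          using p(3) G_system_in[OF sys] G_system_uminus[OF sysH y] by auto
      qed
      then show ?thesis unfolding ecard_def by (simp add: bij_betw_finite bij_betw_same_card)
    qed
    show ?thesis unfolding A_def using fib G_system_in[OF sysH] by auto
  qed
  \<comment> \<open>A zero-one law: if \<open>A k\<close> has positive measure, so has one closed
    piece of its countable decomposition, and this piece yields the entropy bound and, by
    ergodicity, full measure.\<close>
  have pos: "elog (enat k) \<le> sup_seq_entropy X act \<and> measure \<nu> (A k) = 1" if k: "k \<ge> 1" and Ak: "0 < measure \<nu> (A k)" for k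
  proof -
    have "\<exists>cn\<in>centre_tuples D k. measure \<nu> (common_base X \<pi> cn) \<noteq> 0"
    proof (rule ccontr)
      assume "\<not> ?thesis"
      then have "common_base X \<pi> cn \<in> null_sets \<nu>" if "cn \<in> centre_tuples D k" for cn
        using that cbm[OF k that] by (intro null_setsI) (simp_all add: emeasure_eq_measure)
      then have "(\<Union>cn\<in>centre_tuples D k. common_base X \<pi> cn) \<in> null_sets \<nu>"
        using countable_centre_tuples[OF D(1)] by (intro null_sets_UN') auto
      then have "A k \<in> null_sets \<nu>" unfolding A_Un[OF k] .
      then show False using Ak by (simp add: measure_eq_0_null_sets)
    qed
    then obtain c n where cn: "(c, n) \<in> centre_tuples D k" "measure \<nu> (common_base X \<pi> (c, n)) \<noteq> 0" by auto
    then have cpos: "0 < measure \<nu> (common_base X \<pi> (c, n))" using zero_less_measure_iff by blast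
    have "ereal (ln (real k)) \<le> sup_seq_entropy X act"
      by (rule sup_seq_entropy_ge_if_positive_base[OF sys min mef inv k cn(1) cpos])
    moreover have "measure \<nu> (H - A k) = 0"
    proof (rule haar_invariant_null[OF sysH minH eq inv])
      show "H - A k \<in> sets \<nu>" using Hm Am by blast
      show "actH g -` (H - A k) \<inter> H = H - A k" for g by (rule Ainv)
      show "closed (common_base X \<pi> (c, n))" by (rule closed_common_base[OF G_system_compact[OF sys] p(1)])
      have sub: "common_base X \<pi> (c, n) \<subseteq> A k" unfolding A_Un[OF k] using cn(1) by blast
      then show "common_base X \<pi> (c, n) \<subseteq> H" unfolding A_def by blast
      show "(H - A k) \<inter> common_base X \<pi> (c, n) = {}" using sub by blast
      show "0 < measure \<nu> (common_base X \<pi> (c, n))" by (rule cpos)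
    qed
    then have "measure \<nu> (A k) = 1" using prob_compl[OF Am, of k] spc by simp
    ultimately show ?thesis by (simp add: elog_def)
  qed
  have A1: "A 1 = H"
  proof -
    have "enat 1 \<le> ecard {x \<in> X. \<pi> x = y}" if "y \<in> H" for y
    proof -
      have "y \<in> \<pi> ` X" using that p(2) by simp
      then obtain x where x: "x \<in> X" "\<pi> x = y" by auto
      show ?thesis by (rule enat_le_ecard[of "\<lambda>_. x"]) (use x in \<open>auto simp: inj_on_def\<close>)
    qed
    then show ?thesis unfolding A_def by blast
  qed
  have mH: "measure \<nu> H = 1" using prob_space spc by simp
  show ?thesis
  \<comment> \<open>\<open>K\<close> is the supremum of the \<open>k\<close> for which
    \<open>A k\<close> is not null.\<close>
  proof (cases "\<forall>k\<ge>1. 0 < measure \<nu> (A k)")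
    case True
    have "elog \<infinity> \<le> sup_seq_entropy X act"
    proof -
      \<comment> \<open>The lower bounds \<open>ln k\<close> are unbounded.\<close>
      have "ereal B \<le> sup_seq_entropy X act" for B
      proof -
        obtain k :: nat where k: "exp B < real k" using reals_Archimedean2 by blast
        have kp: "real k > 0" using k exp_gt_zero[of B] by linarith
        then have k1: "k \<ge> 1" by simp
        have "B \<le> ln (real k)" using k kp by (simp add: ln_ge_iff)
        then have "ereal B \<le> elog (enat k)" by (simp add: elog_def)
        also have "\<dots> \<le> sup_seq_entropy X act" using pos[OF k1] True k1 by blast
        finally show ?thesis .
      qed
      then have "sup_seq_entropy X act = \<infinity>" by (rule ereal_top)
      then show ?thesis by simp
    qed
    moreover have "emeasure \<nu> {y \<in> H. ecard {x \<in> X. \<pi> x = y} = \<infinity>} = 1"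
    proof -
      have "{y \<in> H. ecard {x \<in> X. \<pi> x = y} = \<infinity>} = (\<Inter>k. A (Suc k))"
      proof (intro subset_antisym subsetI)
        fix y assume "y \<in> (\<Inter>k. A (Suc k))"
        then have y: "y \<in> H" "enat (Suc k) \<le> ecard {x \<in> X. \<pi> x = y}" for k unfolding A_def by auto
        have "infinite {x \<in> X. \<pi> x = y}"
        proof
          assume "finite {x \<in> X. \<pi> x = y}"
          then show False using y(2)[of "card {x \<in> X. \<pi> x = y}"] unfolding ecard_def by simp
        qed
        then show "y \<in> {y \<in> H. ecard {x \<in> X. \<pi> x = y} = \<infinity>}" using y(1) by (simp add: ecard_def)
      qed (auto simp: A_def)
      moreover have "AE y in \<nu>. y \<in> (\<Inter>k. A (Suc k))"
      proof -
        have "AE y in \<nu>. y \<in> A (Suc k)" for k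
        proof (rule AE_prob_1)
          show "measure \<nu> (A (Suc k)) = 1" using pos[of "Suc k"] True by simp
        qed
        then have "AE y in \<nu>. \<forall>k. y \<in> A (Suc k)" by (simp add: AE_all_countable)
        then show ?thesis by simp
      qed
      then have "emeasure \<nu> (\<Inter>k. A (Suc k)) = 1"
        using Am by (intro emeasure_eq_1_AE sets.countable_INT) auto
      ultimately show ?thesis by simp
    qed
    ultimately show ?thesis by blast
  next
    case False
    then obtain k0 where k0: "k0 \<ge> 1" "measure \<nu> (A k0) = 0"
      using measure_nonneg[of \<nu>] by (meson antisym_conv1 not_less)
    \<comment> \<open>\<open>A 1 = H\<close> has measure 1, so the first null index is at least 2
      and its predecessor can serve as \<open>K\<close>.\<close>
    define k1 where "k1 = (LEAST k. k \<ge> 1 \<and> measure \<nu> (A k) = 0)"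
    have k1: "k1 \<ge> 1" "measure \<nu> (A k1) = 0" unfolding k1_def using LeastI[of "\<lambda>k. k \<ge> 1 \<and> measure \<nu> (A k) = 0" k0] k0 by auto
    have "k1 \<noteq> 1"
    proof
      assume "k1 = 1"
      then show False using k1(2) A1 mH by simp
    qed
    then obtain k where k: "k1 = Suc k" "k \<ge> 1" using k1(1) by (cases k1) auto
    have "measure \<nu> (A k) \<noteq> 0"
    proof
      assume "measure \<nu> (A k) = 0"
      then have "k1 \<le> k" unfolding k1_def using k(2) by (intro Least_le) simp
      then show False using k(1) by simp
    qed
    then have "0 < measure \<nu> (A k)" using zero_less_measure_iff by blast
    from pos[OF k(2) this] have ent: "elog (enat k) \<le> sup_seq_entropy X act" and mA: "measure \<nu> (A k) = 1" by auto
    have sub: "A (Suc k) \<subseteq> A k"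
    proof
      fix y assume "y \<in> A (Suc k)"
      then have "y \<in> H" "enat (Suc k) \<le> ecard {x \<in> X. \<pi> x = y}" unfolding A_def by auto
      moreover have "enat k \<le> enat (Suc k)" by simp
      ultimately show "y \<in> A k" unfolding A_def using order_trans by blast
    qed
    have set_eq: "{y \<in> H. ecard {x \<in> X. \<pi> x = y} = enat k} = A k - A (Suc k)"
    proof -
      have "e = enat k \<longleftrightarrow> enat k \<le> e \<and> \<not> enat (Suc k) \<le> e" for e by (cases e) auto
      then show ?thesis unfolding A_def by blast
    qed
    have "measure \<nu> (A k - A (Suc k)) = measure \<nu> (A k) - measure \<nu> (A (Suc k))"
      by (rule finite_measure_Diff[OF Am Am sub])
    then have "measure \<nu> {y \<in> H. ecard {x \<in> X. \<pi> x = y} = enat k} = 1"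
      unfolding set_eq using mA k1(2) k(1) by simp
    then have "emeasure \<nu> {y \<in> H. ecard {x \<in> X. \<pi> x = y} = enat k} = 1" by (simp add: emeasure_eq_measure)
    then show ?thesis using ent by blast
  qed
qed

end
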